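(* Let $f_I$ be such that $$\frac{M_B}{M_V}\notin\left[\frac{a}{4L-3a},\ \frac{4L-3a}{a}\right],$$ where $M_B=\int_{-L}^{p_0} f_I(x)\,dx$ and $M_V=-\int_{p_0}^{L} f_I(x)\,dx$ denote the initial masses of buyers and vendors. Then the free boundary value problem $$f_t - f_{xx} = \lambda(t)\big(\delta(x-p(t)+a)-\delta(x-p(t)-a)\big),\quad x\in(-L,L),\ t>0,$$ $$\lambda(t) = -f_x(p(t),t),\qquad f(p(t),t)=0,$$ $$f(x,0)=f_I(x),\qquad p(0)=p_0,$$ $$f_x(\pm L,t)=0,\quad t>0,$$ does not have a global-in-time solution which conserves both the mass of buyers and the mass of vendors.
   Context: Fix $0<a<L$. The datum satisfies $f_I\in L^2(-L,L)$, $p_0\in(-L+a,L-a)$, $f_I(p_0)=0$, $f_I(x)>0$ for $x<p_0$ and $f_I(x)<0$ for $x>p_0$ (with $x\in(-L,L)$). Here $\delta$ is the Dirac delta and the unknowns of the problem are the function $f$ and the free boundary $p$. At time $t$ the mass of buyers is $\int_{-L}^{p(t)} f(x,t)\,dx$ and the mass of vendors is $-\int_{p(t)}^{L} f(x,t)\,dx$; conserving them means that these quantities are constant in time. *)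

theory Defs
  imports "HOL-Analysis.Analysis"
begin

text \<open>
  Test functions of two real variables (space, time).  A smooth function \<open>\<phi>\<close> is represented by the
  table of its partial derivatives: \<open>D i j\<close> is the \<open>i\<close>-th derivative in \<open>x\<close> and \<open>j\<close>-th
  derivative in \<open>t\<close>, so that \<open>\<phi> = D 0 0\<close>, and \<open>\<phi>\<close> determines \<open>D\<close>.
\<close>

definition smooth_partials :: "(nat \<Rightarrow> nat \<Rightarrow> real \<Rightarrow> real \<Rightarrow> real) \<Rightarrow> bool" where
  "smooth_partials D \<longleftrightarrow>
     (\<forall>i j. continuous_on UNIV (\<lambda>(x, t). D i j x t) \<and>
       (\<forall>x t. ((\<lambda>y. D i j y t) has_real_derivative D (Suc i) j x t) (at x) \<and>
              ((\<lambda>s. D i j x s) has_real_derivative D i (Suc j) x t) (at t)))"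

definition test_function :: "(real \<times> real) set \<Rightarrow> (nat \<Rightarrow> nat \<Rightarrow> real \<Rightarrow> real \<Rightarrow> real) \<Rightarrow> bool" where
  "test_function \<Omega> D \<longleftrightarrow> smooth_partials D \<and>
     (\<exists>K. compact K \<and> K \<subseteq> \<Omega> \<and> (\<forall>x t. (x, t) \<notin> K \<longrightarrow> D 0 0 x t = 0))"

text \<open>
  The equation \<open>f\<^sub>t - f\<^sub>x\<^sub>x = lam(t) (\<delta>(x - p(t) + a) - \<delta>(x - p(t) - a))\<close> in the sense of
  distributions on \<open>(-L, L) \<times> (0, \<infinity>)\<close>.  A test function vanishes outside the domain,
  so a Dirac mass located outside the open interval \<open>(-L, L)\<close> does not contribute.
\<close>

definition price_equation ::
  "real \<Rightarrow> real \<Rightarrow> (real \<Rightarrow> real \<Rightarrow> real) \<Rightarrow> (real \<Rightarrow> real) \<Rightarrow> (real \<Rightarrow> real) \<Rightarrow> bool" where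
  "price_equation L a f p lam \<longleftrightarrow>
     (\<forall>D. test_function ({-L<..<L} \<times> {0<..}) D \<longrightarrow>
        (LINT t:{0<..}|lborel. (LINT x:{-L<..<L}|lborel. f x t * (- D 0 1 x t - D 2 0 x t)))
        = (LINT t:{0<..}|lborel. lam t * (D 0 0 (p t - a) t - D 0 0 (p t + a) t)))"

text \<open>
  Global-in-time solutions \<open>(f, p)\<close>.  Only the regularity giving a meaning to the individual
  equations is required: \<open>p\<close> is continuous; for positive times \<open>f\<close> is continuous up to
  \<open>x = \<plusminus>L\<close> and Lipschitz in \<open>x\<close>, locally uniformly in \<open>t\<close> (a bounded \<open>f\<^sub>x\<close>, allowing the
  jumps of \<open>f\<^sub>x\<close> which the Dirac masses create); \<open>f\<^sub>x\<close> exists at \<open>p(t)\<close>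
  and, one-sidedly, at \<open>\<plusminus>L\<close>; the initial datum is attained in \<open>L\<^sup>2(-L, L)\<close>.
  The sign of \<open>f\<close> on either side of \<open>p(t)\<close> is not prescribed for positive times.
\<close>

definition global_solution ::
  "real \<Rightarrow> real \<Rightarrow> (real \<Rightarrow> real) \<Rightarrow> real \<Rightarrow> (real \<Rightarrow> real \<Rightarrow> real) \<Rightarrow> (real \<Rightarrow> real) \<Rightarrow> bool" where
  "global_solution L a f\<^sub>I p\<^sub>0 f p \<longleftrightarrow>
     continuous_on {0..} p \<and> (\<forall>t\<ge>0. -L < p t \<and> p t < L) \<and>
     continuous_on ({-L..L} \<times> {0<..}) (\<lambda>(x, t). f x t) \<and>
     (\<forall>s T. 0 < s \<and> s < T \<longrightarrow> (\<exists>C. \<forall>t\<in>{s..T}. C-lipschitz_on {-L..L} (\<lambda>x. f x t))) \<and>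
     (\<exists>lam.
        price_equation L a f p lam \<and>
        (\<forall>t>0. ((\<lambda>x. f x t) has_real_derivative - lam t) (at (p t)))) \<and>
     (\<forall>t>0. f (p t) t = 0) \<and>
     (\<forall>x\<in>{-L<..<L}. f x 0 = f\<^sub>I x) \<and>
     ((\<lambda>t. LINT x|lebesgue_on {-L<..<L}. (f x t - f\<^sub>I x)\<^sup>2) \<longlongrightarrow> 0) (at_right 0) \<and>
     p 0 = p\<^sub>0 \<and>
     (\<forall>t>0. ((\<lambda>x. f x t) has_real_derivative 0) (at L within {-L..L}) \<and>
            ((\<lambda>x. f x t) has_real_derivative 0) (at (-L) within {-L..L}))"

definition buyer_mass :: "real \<Rightarrow> (real \<Rightarrow> real) \<Rightarrow> real \<Rightarrow> real" where
  "buyer_mass L g q = (LINT x|lebesgue_on {-L<..<q}. g x)"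

definition vendor_mass :: "real \<Rightarrow> (real \<Rightarrow> real) \<Rightarrow> real \<Rightarrow> real" where
  "vendor_mass L g q = - (LINT x|lebesgue_on {q<..<L}. g x)"

definition conserves_masses :: "real \<Rightarrow> (real \<Rightarrow> real \<Rightarrow> real) \<Rightarrow> (real \<Rightarrow> real) \<Rightarrow> bool" where
  "conserves_masses L f p \<longleftrightarrow>
     (\<forall>t\<ge>0. buyer_mass L (\<lambda>x. f x t) (p t) = buyer_mass L (\<lambda>x. f x 0) (p 0) \<and>
            vendor_mass L (\<lambda>x. f x t) (p t) = vendor_mass L (\<lambda>x. f x 0) (p 0))"

end

theory Submission
  imports Defs
begin

text \<open>
  The proof needs no regularity of the free boundary beyond continuity.  For a nonnegative weight
  \<open>\<phi>\<close> with \<open>\<phi>' = 0\<close> at \<open>-L\<close>, the positive part of \<open>f\<close> to the left of \<open>p\<close> satisfies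
  \<open>d/dt \<integral> \<phi> f\<^sup>+ \<le> \<integral> \<phi>'' f\<^sup>+ + \<lambda>\<^sup>+ (\<phi>(p - a) - \<phi>(p))\<close>, where \<open>\<phi>(p - a)\<close> is read as \<open>0\<close> when \<open>p - a \<le> -L\<close>.
  This follows by mollifying the equation and replacing \<open>f\<^sup>+\<close> by a convex function of \<open>f\<close> that is flat
  near \<open>0\<close>, so that the moving endpoint does not contribute.

  With \<open>\<phi> = 1\<close>, applied to \<open>-f\<close>, the inequality shows that \<open>f\<close> keeps its sign on both sides of \<open>p\<close>.  Since
  the mass of the buyers is constant, the inequality for \<open>c - \<phi>\<close> is the reverse inequality for \<open>\<phi>\<close>.
  The moments against \<open>cosh (n (x + L))\<close> then force \<open>-L + a \<le> p\<close>, and by reflection \<open>p \<le> L - a\<close>.  For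
  \<open>\<phi> = (x + L)\<^sup>2 / 2\<close> one has \<open>\<phi>'' = 1\<close>, and \<open>\<phi>(p) - \<phi>(p - a) = a (p + L - a / 2)\<close> lies between \<open>a\<^sup>2 / 2\<close> and
  \<open>a (4 L - 3 a) / 2\<close>; the reflected weight does the same for the vendors.  Combining the two moments so
  that the exchange terms \<open>\<lambda>\<close> cancel leaves a bounded quantity that grows at least at the rate
  \<open>a M\<^sub>V - (4 L - 3 a) M\<^sub>B\<close>, hence \<open>a M\<^sub>V \<le> (4 L - 3 a) M\<^sub>B\<close>; the other bound follows by reflection.
\<close>

text \<open>Three obstacles shape the proof. The equation holds only against test functions
  compactly supported in the open strip, so weights must first vanish near the wall, and the Neumann
  condition enters only when this cutoff is removed. The derivative of f at p(t) exists for each t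
  separately, with no continuity in time or space, so the term \<lambda> \<phi>(p) cannot come from
  an integration by parts; it is extracted by a blow-up at p(t) from the dissipation of the convex
  function. Finally, neither f nor \<lambda> has a sign a priori. The limits are taken in this
  order: mollification radius to 0, flatness threshold to 0, blow-up window to infinity, cutoff
  layer to 0.

  The threshold (4 L - 3 a) / a is the ratio of the two extremes of a (p + L - a / 2) over -L + a
  \<le> p \<le> L - a. Without the lower bound on p the smaller extreme would degenerate: once the
  source lies beyond the wall, the moment lost at p is only (p + L)^2 / 2, which can be arbitrarily
  small.\<close>

section \<open>Mollification\<close>

text \<open>
  The numerators are chosen so that \<open>bump (Suc n)\<close> is the derivative of \<open>bump n\<close>.
\<close>

primrec bump_numerator :: "nat \<Rightarrow> real poly" where
  "bump_numerator 0 = 1"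
| "bump_numerator (Suc n) =
     pderiv (bump_numerator n) * [:1, 0, -1:]\<^sup>2
     - smult (real (2 * n)) (bump_numerator n * [:0, -2:] * [:1, 0, -1:])
     + bump_numerator n * [:0, -2:]"

text \<open>\<open>bump 0\<close> is the classical exp(-1 / (1 - x^2)). All its derivatives are
  carried in one explicit sequence because \<open>test_function\<close> asks for the whole table of
  partial derivatives.\<close>

definition bump :: "nat \<Rightarrow> real \<Rightarrow> real" where
  "bump n x = (if \<bar>x\<bar> < 1
     then poly (bump_numerator n) x / (1 - x\<^sup>2) ^ (2 * n) * exp (- (1 / (1 - x\<^sup>2))) else 0)"

text \<open>One term of the exponential series at \<open>1 / w\<close> suffices. It lets the
  exponential absorb any power of \<open>1 - x\<^sup>2\<close> in the denominator of
  \<open>bump\<close>.\<close>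

lemma exp_minus_inverse_le:
  fixes w :: real
  assumes "0 < w"
  shows "exp (- (1 / w)) \<le> fact k * w ^ k"
proof -
  define z where "z = 1 / w"
  have z: "0 < z" "w = 1 / z" using assms by (auto simp: z_def)
  have "z ^ k / fact k \<le> (\<Sum>i. z ^ i / fact i)"
    using z sum_le_suminf[of "\<lambda>i. z ^ i / fact i" "{k}"] summable_exp_generic[of z]
    by (simp add: divide_inverse mult.commute scaleR_conv_of_real)
  also have "\<dots> = exp z"
    by (simp add: exp_def divide_inverse mult.commute scaleR_conv_of_real)
  finally have "exp (- z) \<le> fact k / z ^ k"
    using z by (simp add: exp_minus field_simps)
  then show ?thesis
    by (simp add: z power_divide)
qed

lemma has_real_derivative_0_if_quadratic_bound:
  fixes f :: "real \<Rightarrow> real"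
  assumes "\<And>y. \<bar>y - x\<bar> < 1 \<Longrightarrow> \<bar>f y - f x\<bar> \<le> C * (y - x)\<^sup>2"
  shows "(f has_real_derivative 0) (at x)"
proof -
  have "((\<lambda>y. C * \<bar>y - x\<bar>) \<longlongrightarrow> C * \<bar>x - x\<bar>) (at x)"
    by (intro tendsto_intros)
  then have l: "((\<lambda>y. C * \<bar>y - x\<bar>) \<longlongrightarrow> 0) (at x)"
    by simp
  have "((\<lambda>y. (f y - f x) / (y - x)) \<longlongrightarrow> 0) (at x)"
  proof (rule Lim_null_comparison[OF _ l])
    have "\<forall>\<^sub>F y in at x. \<bar>y - x\<bar> < 1"
      using eventually_at_ball[of 1 x UNIV] by (auto simp: dist_real_def abs_minus_commute elim: eventually_mono)
    moreover have "\<forall>\<^sub>F y in at x. y \<noteq> x"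
      by (simp add: eventually_at_filter)
    ultimately show "\<forall>\<^sub>F y in at x. norm ((f y - f x) / (y - x)) \<le> C * \<bar>y - x\<bar>"
    proof eventually_elim
      case (elim y)
      have "\<bar>f y - f x\<bar> \<le> (C * \<bar>y - x\<bar>) * \<bar>y - x\<bar>"
        using assms[of y] elim by (simp add: power2_eq_square abs_mult[symmetric] mult.assoc)
      then show ?case
        using elim by (simp add: abs_divide divide_le_eq)
    qed
  qed
  then show ?thesis
    by (simp add: has_field_derivative_iff)
qed

text \<open>Of the power \<open>2 * n + 2\<close> gained from the exponential, \<open>2 * n\<close>
  cancels the denominator and 2 remain. The remaining square makes \<open>bump n\<close>
  differentiable, with derivative 0, where it is glued to 0.\<close>

lemma bump_quadratic_bound:
  obtains C where "\<And>x. \<bar>bump n x\<bar> \<le> C * (1 - x\<^sup>2)\<^sup>2"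
proof -
  have "compact ((\<lambda>x. \<bar>poly (bump_numerator n) x\<bar>) ` {-1..1::real})"
    by (intro compact_continuous_image continuous_intros compact_Icc)
  then obtain C0 where C0: "\<And>x. x \<in> {-1..1} \<Longrightarrow> \<bar>poly (bump_numerator n) x\<bar> \<le> C0"
    using compact_imp_bounded bounded_real by (metis (no_types, lifting) abs_idempotent imageI)
  have C0': "0 \<le> C0" using C0[of 0] by simp
  show ?thesis
  proof (rule that)
    fix x
    show "\<bar>bump n x\<bar> \<le> (C0 * fact (2 * n + 2)) * (1 - x\<^sup>2)\<^sup>2"
    proof (cases "\<bar>x\<bar> < 1")
      case True
      define w where "w = 1 - x\<^sup>2"
      have w: "w > 0"
        using True by (simp add: w_def abs_square_less_1)
      have "exp (- (1 / w)) / w ^ (2 * n) \<le> (fact (2 * n + 2) * w ^ (2 * n + 2)) / w ^ (2 * n)"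
        by (intro divide_right_mono exp_minus_inverse_le w) (use w in simp)
      also have "\<dots> = fact (2 * n + 2) * w\<^sup>2"
        using w by (simp add: power_add power2_eq_square)
      finally have e: "exp (- (1 / w)) / w ^ (2 * n) \<le> fact (2 * n + 2) * w\<^sup>2" .
      have x: "x \<in> {-1..1}" using True by auto
      have "\<bar>bump n x\<bar> = \<bar>poly (bump_numerator n) x\<bar> * (exp (- (1 / w)) / w ^ (2 * n))"
        using True w by (simp add: bump_def w_def[symmetric] abs_mult)
      also have "\<dots> \<le> C0 * (fact (2 * n + 2) * w\<^sup>2)"
        using C0[OF x] w e C0' by (intro mult_mono) auto
      finally show ?thesis by (simp add: w_def)
    next
      case False
      then show ?thesis
        using C0' by (simp add: bump_def)
    qed
  qed
qed

lemma bump_outside: "1 \<le> \<bar>x\<bar> \<Longrightarrow> bump n x = 0"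
  by (simp add: bump_def)

lemma bump_deriv: "(bump n has_real_derivative bump (Suc n) x) (at x)"
proof (cases "\<bar>x\<bar> < 1")
  case True
  let ?P = "bump_numerator n"
  define w where "w = 1 - x\<^sup>2"
  have w: "w > 0"
    using True by (simp add: w_def abs_square_less_1)
  have nz: "1 - x\<^sup>2 \<noteq> 0" using w by (simp add: w_def)
  have dw: "((\<lambda>x. 1 - x\<^sup>2) has_real_derivative - 2 * x) (at x)"
    by (auto intro!: derivative_eq_intros)
  have dpow: "((\<lambda>x. (1 - x\<^sup>2) ^ (2 * n)) has_real_derivative real (2 * n) * w ^ (2 * n - 1) * (- 2 * x)) (at x)"
    using DERIV_power[OF dw, of "2 * n"] by (simp add: w_def mult_ac)
  have dexp: "((\<lambda>x. exp (- (1 / (1 - x\<^sup>2)))) has_real_derivative exp (- (1 / w)) * (- (2 * x) / (w * w))) (at x)"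
    using dw nz unfolding w_def by (auto intro!: derivative_eq_intros)
  have "((\<lambda>x. poly ?P x / (1 - x\<^sup>2) ^ (2 * n) * exp (- (1 / (1 - x\<^sup>2)))) has_real_derivative
      ((poly (pderiv ?P) x * w ^ (2 * n) - poly ?P x * (real (2 * n) * w ^ (2 * n - 1) * (- 2 * x))) / (w ^ (2 * n) * w ^ (2 * n))
        * exp (- (1 / w)) + poly ?P x / w ^ (2 * n) * (exp (- (1 / w)) * (- (2 * x) / (w * w))))) (at x)"
    using DERIV_mult[OF DERIV_divide[OF poly_DERIV[of ?P x] dpow] dexp] nz
    by (simp add: w_def mult_ac add_ac)
  moreover have "(poly (pderiv ?P) x * w ^ (2 * n) - poly ?P x * (real (2 * n) * w ^ (2 * n - 1) * (- 2 * x))) / (w ^ (2 * n) * w ^ (2 * n))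
        = (poly (pderiv ?P) x * w - poly ?P x * real (2 * n) * (- 2 * x)) / (w ^ (2 * n) * w)"
  \<comment> \<open>At \<open>n = 0\<close> the exponent \<open>2 * n - 1\<close> is truncated to 0,
    and \<open>w ^ (2 * n) = w * w ^ (2 * n - 1)\<close> holds only for positive
    \<open>n\<close>.\<close>
  proof (cases n)
    case 0
    then show ?thesis using w by simp
  next
    case (Suc m)
    have "w ^ (2 * n) = w * w ^ (2 * n - 1)"
      using Suc by (simp flip: power_Suc)
    then show ?thesis using w by (simp add: divide_simps) (simp add: algebra_simps)
  qed
  moreover have "(poly (pderiv ?P) x * w - poly ?P x * real (2 * n) * (- 2 * x)) / (w ^ (2 * n) * w)
        * exp (- (1 / w)) + poly ?P x / w ^ (2 * n) * (exp (- (1 / w)) * (- (2 * x) / (w * w))) = bump (Suc n) x"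
  proof -
    have 1: "poly [:1, 0, -1:] x = w" "poly [:0, -2:] x = - 2 * x"
      by (simp_all add: w_def power2_eq_square)
    have 2: "w ^ (2 * Suc n) = w ^ (2 * n) * w * w"
      by simp
    show ?thesis
      using True w
      unfolding bump_def w_def[symmetric] 2
      by (simp add: poly_add poly_diff poly_mult 1 del: poly_pCons mult_pCons_left mult_pCons_right)
        (simp add: field_simps power2_eq_square)
  qed
  ultimately have "((\<lambda>x. poly ?P x / (1 - x\<^sup>2) ^ (2 * n) * exp (- (1 / (1 - x\<^sup>2)))) has_real_derivative bump (Suc n) x) (at x)"
    by (simp only:)
  moreover have "\<forall>\<^sub>F y in nhds x. \<bar>y\<bar> < 1"
  proof -
    have "open {y::real. \<bar>y\<bar> < 1}"
      by (intro open_Collect_less continuous_intros)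
    then show ?thesis
      using True eventually_nhds_in_open[of "{y. \<bar>y\<bar> < 1}" x] by simp
  qed
  then have "\<forall>\<^sub>F y in nhds x. bump n y = poly ?P y / (1 - y\<^sup>2) ^ (2 * n) * exp (- (1 / (1 - y\<^sup>2)))"
    by eventually_elim (simp add: bump_def)
  ultimately show ?thesis
    by (subst DERIV_cong_ev[OF refl _ refl])
next
  case False
  obtain C where C: "\<And>x. \<bar>bump n x\<bar> \<le> C * (1 - x\<^sup>2)\<^sup>2"
    using bump_quadratic_bound by blast
  have C0: "0 \<le> C" using C[of 0] by simp
  \<comment> \<open>9 is the square of the crude bound 3 for \<open>1 + \<bar>y\<bar>\<close>; the
    other factor satisfies \<open>1 - \<bar>y\<bar> \<le> \<bar>y - x\<bar>\<close> because
    \<open>1 \<le> \<bar>x\<bar>\<close>.\<close>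
  have "\<bar>bump n y - bump n x\<bar> \<le> (C * 9) * (y - x)\<^sup>2" if "\<bar>y - x\<bar> < 1" for y
  proof (cases "\<bar>y\<bar> < 1")
    case True
    have "\<bar>1 - y\<^sup>2\<bar> = (1 - \<bar>y\<bar>) * (1 + \<bar>y\<bar>)"
      using True by (simp add: algebra_simps power2_eq_square[symmetric] abs_square_le_1)
    also have "\<dots> \<le> \<bar>y - x\<bar> * 3"
      using True False by (intro mult_mono) auto
    finally have "(1 - y\<^sup>2)\<^sup>2 \<le> (\<bar>y - x\<bar> * 3)\<^sup>2"
      by (metis abs_ge_zero power2_abs power_mono)
    then have "C * (1 - y\<^sup>2)\<^sup>2 \<le> C * (9 * (y - x)\<^sup>2)"
      using C0 by (intro mult_left_mono) (auto simp: power_mult_distrib)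
    then show ?thesis
      using C[of y] False by (simp add: bump_outside)
  next
    case outside: False
    then show ?thesis
      using False C0 by (simp add: bump_outside)
  qed
  then have "(bump n has_real_derivative 0) (at x)"
    by (rule has_real_derivative_0_if_quadratic_bound)
  then show ?thesis
    using False by (simp add: bump_outside)
qed

lemma bump_0_nonneg: "0 \<le> bump 0 x"
  by (simp add: bump_def)

lemma continuous_on_deriv_sequence:
  assumes "\<And>n x. (b n has_real_derivative b (Suc n) x) (at x)"
  shows "continuous_on S (b n :: real \<Rightarrow> real)"
  using assms by (meson DERIV_continuous_on has_field_derivative_at_within)

text \<open>The index is the order of the derivative, so that \<open>b i\<close> and
  \<open>b j\<close> are directly the factors in the derivative table of a product kernel.\<close>

definition mollifier :: "real \<Rightarrow> (nat \<Rightarrow> real \<Rightarrow> real) \<Rightarrow> bool" where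
  "mollifier \<epsilon> b \<longleftrightarrow> (\<forall>n x. (b n has_real_derivative b (Suc n) x) (at x)) \<and>
     (\<forall>x. 0 \<le> b 0 x) \<and> (\<forall>n x. \<epsilon> \<le> \<bar>x\<bar> \<longrightarrow> b n x = 0) \<and> integral {-\<epsilon>..\<epsilon>} (b 0) = 1"

lemma mollifier_exists:
  assumes "0 < \<epsilon>"
  obtains b where "mollifier \<epsilon> b"
proof -
  define d where "d n x = bump n (x / \<epsilon>) / \<epsilon> ^ n" for n x
  have d: "(d n has_real_derivative d (Suc n) x) (at x)" for n x
  proof -
    have "((\<lambda>x. bump n (x / \<epsilon>)) has_real_derivative bump (Suc n) (x / \<epsilon>) * (1 / \<epsilon>)) (at x)"
      by (rule DERIV_chain2[OF bump_deriv]) (use assms in \<open>auto intro!: derivative_eq_intros\<close>)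
    then have "((\<lambda>x. bump n (x / \<epsilon>) / \<epsilon> ^ n) has_real_derivative bump (Suc n) (x / \<epsilon>) * (1 / \<epsilon>) / \<epsilon> ^ n) (at x)"
      by (rule DERIV_cdivide)
    then show ?thesis
      by (simp add: d_def[abs_def])
  qed
  define c where "c = integral {-\<epsilon>..\<epsilon>} (d 0)"
  have "d 0 0 > 0" by (simp add: d_def bump_def)
  have "integral (cbox (-\<epsilon>) \<epsilon>) (d 0) \<noteq> 0"
  proof
    assume "integral (cbox (-\<epsilon>) \<epsilon>) (d 0) = 0"
    moreover have "continuous_on (cbox (-\<epsilon>) \<epsilon>) (d 0)"
      by (rule continuous_on_deriv_sequence[of d, OF d])
    moreover have "\<And>x. 0 \<le> d 0 x"
      by (simp add: d_def bump_0_nonneg)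
    ultimately have "\<forall>x\<in>cbox (-\<epsilon>) \<epsilon>. d 0 x = 0"
      using integral_cbox_eq_0_iff[of "-\<epsilon>" \<epsilon> "d 0"] assms by auto
    then show False
      using \<open>d 0 0 > 0\<close> assms by auto
  qed
  then have c: "c \<noteq> 0" by (simp add: c_def)
  have "c \<ge> 0"
    unfolding c_def by (intro integral_nonneg integrable_continuous_interval continuous_on_deriv_sequence[of d, OF d])
      (simp add: d_def bump_0_nonneg)
  have "mollifier \<epsilon> (\<lambda>n x. d n x / c)"
    unfolding mollifier_def
  proof (intro conjI allI impI)
    show "((\<lambda>x. d n x / c) has_real_derivative d (Suc n) x / c) (at x)" for n x
      by (rule DERIV_cdivide[OF d])
    show "0 \<le> d 0 x / c" for x
      using \<open>c \<ge> 0\<close> by (simp add: d_def bump_0_nonneg)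
    show "d n x / c = 0" if "\<epsilon> \<le> \<bar>x\<bar>" for n x
      using that assms by (simp add: d_def bump_outside)
    show "integral {-\<epsilon>..\<epsilon>} (\<lambda>x. d 0 x / c) = 1"
      using c by (simp add: c_def)
  qed
  then show ?thesis by (rule that)
qed

lemma mollifierD:
  assumes "mollifier \<epsilon> b"
  shows "(b n has_real_derivative b (Suc n) x) (at x)" "0 \<le> b 0 x" "\<epsilon> \<le> \<bar>x\<bar> \<Longrightarrow> b n x = 0"
    "integral {-\<epsilon>..\<epsilon>} (b 0) = 1" "continuous_on S (b n)"
  using assms continuous_on_deriv_sequence[of b S n] by (auto simp: mollifier_def)

lemma mollifier_integral_reflected:
  assumes b: "mollifier \<epsilon> b" and "0 < \<epsilon>" "lo \<le> x - \<epsilon>" "x + \<epsilon> \<le> hi"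
  shows "integral {lo..hi} (\<lambda>y. b 0 (x - y)) = 1"
proof -
  have i: "(b 0 has_integral 1) {-\<epsilon>..\<epsilon>}"
    using mollifierD(4)[OF b] integrable_integral[OF integrable_continuous_interval[OF mollifierD(5)[OF b]]] by metis
  have "((\<lambda>y. b 0 ((-1) *\<^sub>R y + x)) has_integral (1 / \<bar>-1\<bar> ^ 1) *\<^sub>R 1) ((\<lambda>y. (1 / (-1)) *\<^sub>R y + -((1/(-1)) *\<^sub>R x)) ` cbox (-\<epsilon>) \<epsilon>)"
    using has_integral_affinity[of "b 0" 1 "-\<epsilon>" \<epsilon> "-1" x] i by simp
  moreover have "((\<lambda>y. (1 / (-1)) *\<^sub>R y + -((1/(-1)) *\<^sub>R x)) ` cbox (-\<epsilon>) \<epsilon>) = {x-\<epsilon>..x+\<epsilon>}"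
    using image_affinity_atLeastAtMost[of "-1" x "-\<epsilon>" \<epsilon>] assms by simp
  ultimately have "((\<lambda>y. b 0 (x - y)) has_integral 1) {x-\<epsilon>..x+\<epsilon>}"
    by simp
  then have "((\<lambda>y. b 0 (x - y)) has_integral 1) {lo..hi}"
    by (rule has_integral_on_superset) (use assms in \<open>auto intro!: mollifierD(3)[OF b]\<close>)
  then show ?thesis by (rule integral_unique)
qed

text \<open>Convolution of \<open>v\<close>, known only on a box, with a product kernel. The pair
  \<open>q\<close> is (time, space), so that iterating the integral puts time outside, as in
  \<open>price_equation\<close>. Derivatives fall on \<open>g\<close> and \<open>h\<close>;
  \<open>v\<close> itself is only continuous.\<close>

definition smear ::
  "(real \<Rightarrow> real \<Rightarrow> real) \<Rightarrow> real \<times> real \<Rightarrow> real \<times> real \<Rightarrow> (real \<Rightarrow> real) \<Rightarrow> (real \<Rightarrow> real) \<Rightarrow> real \<Rightarrow> real \<Rightarrow> real"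
  where "smear v c d g h x t =
     integral (cbox c d) (\<lambda>q. v (snd q) (fst q) * g (x - snd q) * h (t - fst q))"

lemma continuous_on_comp_UNIV:
  "continuous_on UNIV g \<Longrightarrow> continuous_on S f \<Longrightarrow> continuous_on S (\<lambda>x. (g :: real \<Rightarrow> real) (f x))"
  by (rule continuous_on_compose2[of UNIV]) auto

lemma smear_continuous:
  assumes v: "continuous_on (cbox c d) (\<lambda>q. v (snd q) (fst q))"
    and g: "continuous_on UNIV g" and h: "continuous_on UNIV h"
  shows "continuous_on S (\<lambda>z. smear v c d g h (fst z) (snd z))"
  unfolding smear_def
proof (rule integral_continuous_on_param)
  show "continuous_on (S \<times> cbox c d) (\<lambda>(z, q). v (snd q) (fst q) * g (fst z - snd q) * h (snd z - fst q))"
    unfolding case_prod_beta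
    by (intro continuous_intros continuous_on_comp_UNIV[OF g] continuous_on_comp_UNIV[OF h]
        continuous_on_compose2[OF v]) auto
qed

lemma smear_deriv_x:
  assumes v: "continuous_on (cbox c d) (\<lambda>q. v (snd q) (fst q))"
    and g: "\<And>x. (g has_real_derivative g' x) (at x)" and g': "continuous_on UNIV g'"
    and h: "continuous_on UNIV h"
  shows "((\<lambda>x. smear v c d g h x t) has_real_derivative smear v c d g' h x t) (at x)"
  unfolding smear_def
proof (rule leibniz_rule_field_derivative[where U = UNIV])
  have gc: "continuous_on UNIV g"
    using g by (meson DERIV_continuous_on has_field_derivative_at_within)
  show "((\<lambda>x. v (snd q) (fst q) * g (x - snd q) * h (t - fst q)) has_real_derivative
      v (snd q) (fst q) * g' (x - snd q) * h (t - fst q)) (at x within UNIV)" for x q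
    by (auto intro!: derivative_eq_intros DERIV_chain2[OF g])
  show "(\<lambda>q. v (snd q) (fst q) * g (x - snd q) * h (t - fst q)) integrable_on cbox c d" for x
    by (intro integrable_continuous continuous_intros v continuous_on_comp_UNIV[OF gc] continuous_on_comp_UNIV[OF h])
  show "continuous_on (UNIV \<times> cbox c d) (\<lambda>(x, q). v (snd q) (fst q) * g' (x - snd q) * h (t - fst q))"
    unfolding case_prod_beta
    by (intro continuous_intros continuous_on_comp_UNIV[OF g'] continuous_on_comp_UNIV[OF h]
        continuous_on_compose2[OF v]) auto
qed auto

lemma smear_deriv_t:
  assumes v: "continuous_on (cbox c d) (\<lambda>q. v (snd q) (fst q))"
    and h: "\<And>x. (h has_real_derivative h' x) (at x)" and h': "continuous_on UNIV h'"
    and g: "continuous_on UNIV g"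
  shows "((\<lambda>t. smear v c d g h x t) has_real_derivative smear v c d g h' x t) (at t)"
  unfolding smear_def
proof (rule leibniz_rule_field_derivative[where U = UNIV])
  have hc: "continuous_on UNIV h"
    using h by (meson DERIV_continuous_on has_field_derivative_at_within)
  show "((\<lambda>t. v (snd q) (fst q) * g (x - snd q) * h (t - fst q)) has_real_derivative
      v (snd q) (fst q) * g (x - snd q) * h' (t - fst q)) (at t within UNIV)" for t q
    by (auto intro!: derivative_eq_intros DERIV_chain2[OF h])
  show "(\<lambda>q. v (snd q) (fst q) * g (x - snd q) * h (t - fst q)) integrable_on cbox c d" for t
    by (intro integrable_continuous continuous_intros v continuous_on_comp_UNIV[OF g] continuous_on_comp_UNIV[OF hc])
  show "continuous_on (UNIV \<times> cbox c d) (\<lambda>(t, q). v (snd q) (fst q) * g (x - snd q) * h' (t - fst q))"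
    unfolding case_prod_beta
    by (intro continuous_intros continuous_on_comp_UNIV[OF g] continuous_on_comp_UNIV[OF h']
        continuous_on_compose2[OF v]) auto
qed auto

text \<open>The kernel is nonnegative with integral 1 and vanishes unless both variables are within
  \<open>\<epsilon>\<close>, so the smeared value is an average of values that differ from
  \<open>v x t\<close> by at most \<open>e\<close>.\<close>

lemma smear_approx:
  assumes v: "continuous_on (cbox (s0, lo) (t0, hi)) (\<lambda>q. v (snd q) (fst q))"
    and b: "mollifier \<epsilon> b" and "0 < \<epsilon>"
    and x: "lo \<le> x - \<epsilon>" "x + \<epsilon> \<le> hi" and t: "s0 \<le> t - \<epsilon>" "t + \<epsilon> \<le> t0"
    and e: "\<And>y \<tau>. \<bar>y - x\<bar> \<le> \<epsilon> \<Longrightarrow> \<bar>\<tau> - t\<bar> \<le> \<epsilon> \<Longrightarrow> \<bar>v y \<tau> - v x t\<bar> \<le> e"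
  shows "\<bar>smear v (s0, lo) (t0, hi) (b 0) (b 0) x t - v x t\<bar> \<le> e"
proof -
  let ?k = "\<lambda>q. b 0 (x - snd q) * b 0 (t - fst q)"
  let ?B = "cbox (s0, lo) (t0, hi)"
  have bc: "continuous_on UNIV (b 0)"
    by (rule mollifierD(5)[OF b])
  have kc: "continuous_on ?B ?k"
    by (intro continuous_intros continuous_on_comp_UNIV[OF bc])
  have k0: "0 \<le> ?k q" for q
    by (simp add: mollifierD(2)[OF b])
  have "integral ?B ?k = integral {s0..t0} (\<lambda>\<tau>. integral {lo..hi} (\<lambda>y. b 0 (x - y) * b 0 (t - \<tau>)))"
    using integral_prod_continuous[OF kc] by simp
  also have "\<dots> = integral {s0..t0} (\<lambda>\<tau>. b 0 (t - \<tau>))"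
    by (simp add: mollifier_integral_reflected[OF b \<open>0 < \<epsilon>\<close> x])
  also have "\<dots> = 1"
    by (rule mollifier_integral_reflected[OF b \<open>0 < \<epsilon>\<close> t])
  finally have k1: "integral ?B ?k = 1" .
  have vki: "(\<lambda>q. v (snd q) (fst q) * ?k q) integrable_on ?B"
    by (intro integrable_continuous continuous_on_mult v kc)
  have cki: "(\<lambda>q. v x t * ?k q) integrable_on ?B"
    by (intro integrable_continuous continuous_on_mult continuous_on_const kc)
  have "smear v (s0, lo) (t0, hi) (b 0) (b 0) x t - v x t
      = integral ?B (\<lambda>q. v (snd q) (fst q) * ?k q) - integral ?B (\<lambda>q. v x t * ?k q)"
    using k1 by (simp add: smear_def mult.assoc)
  also have "\<dots> = integral ?B (\<lambda>q. v (snd q) (fst q) * ?k q - v x t * ?k q)"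
    using cki vki by (intro integral_diff[symmetric])
  finally have eq: "smear v (s0, lo) (t0, hi) (b 0) (b 0) x t - v x t = \<dots>" .
  have "norm (integral ?B (\<lambda>q. v (snd q) (fst q) * ?k q - v x t * ?k q)) \<le> integral ?B (\<lambda>q. e * ?k q)"
  proof (rule integral_norm_bound_integral)
    show "(\<lambda>q. v (snd q) (fst q) * ?k q - v x t * ?k q) integrable_on ?B"
      using cki vki by (intro integrable_diff)
    show "(\<lambda>q. e * ?k q) integrable_on ?B"
      by (intro integrable_continuous continuous_on_mult continuous_on_const kc)
    fix q
    show "norm (v (snd q) (fst q) * ?k q - v x t * ?k q) \<le> e * ?k q"
    proof (cases "\<bar>snd q - x\<bar> \<le> \<epsilon> \<and> \<bar>fst q - t\<bar> \<le> \<epsilon>")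
      case True
      have "norm (v (snd q) (fst q) * ?k q - v x t * ?k q) = \<bar>v (snd q) (fst q) - v x t\<bar> * ?k q"
        by (metis (no_types, lifting) abs_mult abs_of_nonneg k0 left_diff_distrib real_norm_def)
      also have "\<dots> \<le> e * ?k q"
        by (intro mult_right_mono e k0) (use True in auto)
      finally show ?thesis .
    next
      case False
      then have "?k q = 0"
        using mollifierD(3)[OF b, of "x - snd q" 0] mollifierD(3)[OF b, of "t - fst q" 0] by (auto simp: abs_minus_commute)
      then show ?thesis by (metis mult_zero_right diff_zero norm_zero order_refl)
    qed
  qed
  also have "integral ?B (\<lambda>q. e * ?k q) = e"
    using k1 by simp
  finally show ?thesis
    using eq by simp
qed

text \<open>Collects those properties of a solution that survive a change of sign and a reflection
  in space, so that estimates proved to the left of \<open>p\<close> transfer to the other sign and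
  to the other side. Initial datum and masses join in \<open>conserving_solution\<close>.\<close>

locale weak_solution =
  fixes L a :: real and u :: "real \<Rightarrow> real \<Rightarrow> real" and p \<kappa> :: "real \<Rightarrow> real"
  assumes a_pos: "0 < a"
    and p_cont: "continuous_on {0<..} p"
    and p_bounds: "\<And>t. 0 < t \<Longrightarrow> -L < p t \<and> p t < L"
    and u_cont: "continuous_on ({-L..L} \<times> {0<..}) (\<lambda>(x, t). u x t)"
    and u_lip: "\<And>s T. 0 < s \<Longrightarrow> s < T \<Longrightarrow> \<exists>C. \<forall>t\<in>{s..T}. C-lipschitz_on {-L..L} (\<lambda>x. u x t)"
    and eq: "price_equation L a u p \<kappa>"
    and flux: "\<And>t. 0 < t \<Longrightarrow> ((\<lambda>x. u x t) has_real_derivative - \<kappa> t) (at (p t))"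
    and zero: "\<And>t. 0 < t \<Longrightarrow> u (p t) t = 0"
    and neumann: "\<And>t. 0 < t \<Longrightarrow> ((\<lambda>x. u x t) has_real_derivative 0) (at L within {-L..L})"
      "\<And>t. 0 < t \<Longrightarrow> ((\<lambda>x. u x t) has_real_derivative 0) (at (-L) within {-L..L})"
begin

lemma u_cont_box: "0 < s0 \<Longrightarrow> continuous_on (cbox (s0, -L) (t0, L)) (\<lambda>q. u (snd q) (fst q))"
  using continuous_on_compose2[OF u_cont, of "cbox (s0, -L) (t0, L)" "\<lambda>q. (snd q, fst q)"]
  by (force intro!: continuous_intros)

text \<open>Each derivative of \<open>b i (x - y)\<close> in \<open>y\<close> costs a sign, and
  likewise in time; hence the factor \<open>(-1) ^ (i + j)\<close>.\<close>

lemma test_function_mollifier: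
  assumes b: "mollifier \<epsilon> b" and "0 < \<epsilon>"
    and x: "-L < x - \<epsilon>" "x + \<epsilon> < L" and t: "0 < t - \<epsilon>"
  shows "test_function ({-L<..<L} \<times> {0<..})
    (\<lambda>i j y \<tau>. (-1) ^ (i + j) * b i (x - y) * b j (t - \<tau>))"
  unfolding test_function_def smooth_partials_def
proof (intro conjI allI exI[of _ "cbox (x - \<epsilon>, t - \<epsilon>) (x + \<epsilon>, t + \<epsilon>)"] impI)
  have bc: "continuous_on UNIV (b i)" for i
    by (rule mollifierD(5)[OF b])
  show "continuous_on UNIV (\<lambda>(y, \<tau>). (-1) ^ (i + j) * b i (x - y) * b j (t - \<tau>))" for i j
    unfolding case_prod_beta
    by (intro continuous_intros continuous_on_comp_UNIV[OF bc])
  show "((\<lambda>y. (-1) ^ (i + j) * b i (x - y) * b j (t - \<tau>)) has_real_derivative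
      (-1) ^ (Suc i + j) * b (Suc i) (x - y) * b j (t - \<tau>)) (at y)" for i j y \<tau>
    by (auto intro!: derivative_eq_intros DERIV_chain2[OF mollifierD(1)[OF b]])
  show "((\<lambda>\<tau>. (-1) ^ (i + j) * b i (x - y) * b j (t - \<tau>)) has_real_derivative
      (-1) ^ (i + Suc j) * b i (x - y) * b (Suc j) (t - \<tau>)) (at \<tau>)" for i j y \<tau>
    by (auto intro!: derivative_eq_intros DERIV_chain2[OF mollifierD(1)[OF b]])
  show "compact (cbox (x - \<epsilon>, t - \<epsilon>) (x + \<epsilon>, t + \<epsilon>))"
    by (rule compact_cbox)
  show "cbox (x - \<epsilon>, t - \<epsilon>) (x + \<epsilon>, t + \<epsilon>) \<subseteq> {-L<..<L} \<times> {0<..}"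
    using x t by (auto simp: cbox_Pair_eq)
  fix y \<tau> assume "(y, \<tau>) \<notin> cbox (x - \<epsilon>, t - \<epsilon>) (x + \<epsilon>, t + \<epsilon>)"
  then have "\<epsilon> \<le> \<bar>x - y\<bar> \<or> \<epsilon> \<le> \<bar>t - \<tau>\<bar>"
    by (auto simp: cbox_Pair_eq)
  then show "(-1) ^ (0 + 0) * b 0 (x - y) * b 0 (t - \<tau>) = 0"
    using mollifierD(3)[OF b] by auto
qed

text \<open>Testing with the kernel centred at \<open>(x, t)\<close> turns the distributional
  equation into a pointwise one for the mollified \<open>u\<close>. The signs of the reflected
  kernel turn \<open>- D 0 1 - D 2 0\<close> into the heat operator on the kernel. The point must
  stay more than \<open>\<epsilon>\<close> away from both walls, or the kernel is no admissible test
  function.\<close>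

lemma smear_equation:
  assumes b: "mollifier \<epsilon> b" and "0 < \<epsilon>"
    and x: "-L < x - \<epsilon>" "x + \<epsilon> < L" and s0: "0 < s0" and t: "s0 \<le> t - \<epsilon>" "t + \<epsilon> \<le> t0"
  shows "smear u (s0, -L) (t0, L) (b 0) (b 1) x t - smear u (s0, -L) (t0, L) (b 2) (b 0) x t =
    (LINT \<tau>:{s0..t0}|lborel. \<kappa> \<tau> * (b 0 (x - (p \<tau> - a)) * b 0 (t - \<tau>) - b 0 (x - (p \<tau> + a)) * b 0 (t - \<tau>)))"
proof -
  let ?B = "cbox (s0, -L) (t0, L)"
  let ?k = "\<lambda>y \<tau>. b 0 (x - y) * b 1 (t - \<tau>) - b 2 (x - y) * b 0 (t - \<tau>)"
  have bc: "continuous_on UNIV (b i)" for i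
    by (rule mollifierD(5)[OF b])
  have uc: "continuous_on ?B (\<lambda>q. u (snd q) (fst q))"
    by (rule u_cont_box[OF s0])
  have kc: "continuous_on ?B (\<lambda>q. u (snd q) (fst q) * ?k (snd q) (fst q))"
    by (intro continuous_intros uc continuous_on_comp_UNIV[OF bc])
  \<comment> \<open>The smeared function uses a gauge integral over the closed interval, the
    equation a Lebesgue integral over the open one.\<close>
  have inner: "(LINT y:{-L<..<L}|lborel. u y \<tau> * ?k y \<tau>) = integral {-L..L} (\<lambda>y. u y \<tau> * ?k y \<tau>)"
    if "\<tau> \<in> {s0..t0}" for \<tau>
  proof -
    have c: "continuous_on {-L..L} (\<lambda>y. u y \<tau> * ?k y \<tau>)"
      using continuous_on_compose2[OF kc, of "{-L..L}" "Pair \<tau>"] that continuous_on_Pair[OF continuous_on_const continuous_on_id, of "{-L..L}" \<tau>]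
      by (simp add: cbox_Pair_eq image_subset_iff)
    have i: "set_integrable lborel {-L..L} (\<lambda>y. u y \<tau> * ?k y \<tau>)"
      unfolding set_integrable_def by (intro borel_integrable_compact c compact_Icc)
    then have "set_integrable lborel {-L<..<L} (\<lambda>y. u y \<tau> * ?k y \<tau>)"
      by (rule set_integrable_subset) auto
    then have "(LINT y:{-L<..<L}|lborel. u y \<tau> * ?k y \<tau>) = integral {-L<..<L} (\<lambda>y. u y \<tau> * ?k y \<tau>)"
      by (rule set_borel_integral_eq_integral)
    then show ?thesis
      by (simp add: integral_open_interval_real)
  qed
  have "smear u (s0, -L) (t0, L) (b 0) (b 1) x t - smear u (s0, -L) (t0, L) (b 2) (b 0) x t
      = integral ?B (\<lambda>q. u (snd q) (fst q) * ?k (snd q) (fst q))"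
    unfolding smear_def
    by (subst integral_diff[symmetric])
      (auto intro!: integrable_continuous continuous_intros uc continuous_on_comp_UNIV[OF bc] simp: algebra_simps)
  also have "\<dots> = integral {s0..t0} (\<lambda>\<tau>. integral {-L..L} (\<lambda>y. u y \<tau> * ?k y \<tau>))"
    using integral_prod_continuous[OF kc] by simp
  also have "\<dots> = (LINT \<tau>:{s0..t0}|lborel. integral {-L..L} (\<lambda>y. u y \<tau> * ?k y \<tau>))"
  proof -
    have "continuous_on {s0..t0} (\<lambda>\<tau>. integral (cbox (-L) L) (\<lambda>y. u y \<tau> * ?k y \<tau>))"
      using kc by (intro integral_continuous_on_param) (simp add: cbox_Pair_eq case_prod_beta)
    then have "set_integrable lborel {s0..t0} (\<lambda>\<tau>. integral {-L..L} (\<lambda>y. u y \<tau> * ?k y \<tau>))"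
      unfolding set_integrable_def by (intro borel_integrable_compact compact_Icc) simp
    then show ?thesis
      by (rule set_borel_integral_eq_integral(2)[symmetric])
  qed
  also have "\<dots> = (LINT \<tau>:{s0..t0}|lborel. (LINT y:{-L<..<L}|lborel. u y \<tau> * ?k y \<tau>))"
    using inner by (intro set_lebesgue_integral_cong) auto
  \<comment> \<open>Outside \<open>{s0..t0}\<close> the time factor of the kernel vanishes, so the
    integral may run over all positive times, as in \<open>price_equation\<close>.\<close>
  also have "\<dots> = (LINT \<tau>:{0<..}|lborel. (LINT y:{-L<..<L}|lborel. u y \<tau> * ?k y \<tau>))"
    unfolding set_lebesgue_integral_def[of _ "{s0..t0}"] set_lebesgue_integral_def[of _ "{0<..}"]
  proof (intro Bochner_Integration.integral_cong refl)
    fix \<tau>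
    have "(LINT y:{-L<..<L}|lborel. u y \<tau> * ?k y \<tau>) = 0" if "\<tau> \<notin> {s0..t0}"
    proof -
      have "b i (t - \<tau>) = 0" for i
        by (rule mollifierD(3)[OF b]) (use that t in auto)
      then show ?thesis
        by (simp add: set_lebesgue_integral_def)
    qed
    then show "indicator {s0..t0} \<tau> *\<^sub>R (LINT y:{-L<..<L}|lborel. u y \<tau> * ?k y \<tau>)
        = indicator {0<..} \<tau> *\<^sub>R (LINT y:{-L<..<L}|lborel. u y \<tau> * ?k y \<tau>)"
      using s0 by (cases "\<tau> \<in> {s0..t0}") (simp_all only: indicator_simps, auto simp: indicator_def)
  qed
  also have "\<dots> = (LINT \<tau>:{0<..}|lborel. \<kappa> \<tau> * (b 0 (x - (p \<tau> - a)) * b 0 (t - \<tau>) - b 0 (x - (p \<tau> + a)) * b 0 (t - \<tau>)))"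
    using eq[unfolded price_equation_def, rule_format, OF test_function_mollifier[OF b \<open>0 < \<epsilon>\<close> x, of t]] s0 t
    by (simp add: algebra_simps numeral_2_eq_2)
  also have "\<dots> = (LINT \<tau>:{s0..t0}|lborel. \<kappa> \<tau> * (b 0 (x - (p \<tau> - a)) * b 0 (t - \<tau>) - b 0 (x - (p \<tau> + a)) * b 0 (t - \<tau>)))"
  proof -
    have "b i (t - \<tau>) = 0" if "\<tau> \<notin> {s0..t0}" for i \<tau>
      by (rule mollifierD(3)[OF b]) (use that t in auto)
    then show ?thesis
      unfolding set_lebesgue_integral_def
      by (intro Bochner_Integration.integral_cong refl) (use s0 in \<open>auto simp: indicator_def\<close>)
  qed
  finally show ?thesis .
qed

end

section \<open>Integrals over a moving domain\<close>

text \<open>Here the centre of the kernel is fixed and its argument runs, as in the integrals over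
  \<open>x\<close> and \<open>t\<close> of \<open>source_estimate\<close>; in
  \<open>mollifier_integral_reflected\<close> the roles are exchanged. The kernel is not assumed to
  be even, so both are stated.\<close>

lemma mollifier_integral_shifted:
  assumes b: "mollifier \<epsilon> b" and "0 < \<epsilon>" "lo \<le> z - \<epsilon>" "z + \<epsilon> \<le> hi"
  shows "integral {lo..hi} (\<lambda>x. b 0 (x - z)) = 1"
proof -
  have i: "(b 0 has_integral 1) {-\<epsilon>..\<epsilon>}"
    using mollifierD(4)[OF b] integrable_integral[OF integrable_continuous_interval[OF mollifierD(5)[OF b]]] by metis
  have "((\<lambda>y. b 0 (1 *\<^sub>R y + (- z))) has_integral (1 / \<bar>1\<bar> ^ 1) *\<^sub>R 1) ((\<lambda>y. (1 / 1) *\<^sub>R y + -((1/1) *\<^sub>R (- z))) ` cbox (-\<epsilon>) \<epsilon>)"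
    using has_integral_affinity[of "b 0" 1 "-\<epsilon>" \<epsilon> 1 "- z"] i by simp
  moreover have "((\<lambda>y. (1 / 1) *\<^sub>R y + -((1/1) *\<^sub>R (- z))) ` cbox (-\<epsilon>) \<epsilon>) = {z-\<epsilon>..z+\<epsilon>}"
    using image_affinity_atLeastAtMost[of 1 z "-\<epsilon>" \<epsilon>] assms by (simp add: add.commute[of _ z])
  ultimately have "((\<lambda>x. b 0 (x - z)) has_integral 1) {z-\<epsilon>..z+\<epsilon>}"
    by (simp add: add.commute)
  then have "((\<lambda>x. b 0 (x - z)) has_integral 1) {lo..hi}"
    by (rule has_integral_on_superset) (use assms in \<open>auto intro!: mollifierD(3)[OF b]\<close>)
  then show ?thesis by (rule integral_unique)
qed

lemma mollifier_integral_le: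
  assumes b: "mollifier \<epsilon> b" and "0 < \<epsilon>"
  shows "integral {lo..hi} (\<lambda>x. b 0 (x - z)) \<le> 1"
proof -
  have bc: "continuous_on S (\<lambda>x. b 0 (x - z))" for S
    by (intro continuous_on_comp_UNIV[OF mollifierD(5)[OF b]] continuous_intros)
  have "integral {lo..hi} (\<lambda>x. b 0 (x - z)) \<le> integral {min lo (z-\<epsilon>)..max hi (z+\<epsilon>)} (\<lambda>x. b 0 (x - z))"
    by (intro integral_subset_le integrable_continuous_interval bc) (auto simp: mollifierD(2)[OF b])
  also have "\<dots> = 1"
    by (rule mollifier_integral_shifted[OF b \<open>0 < \<epsilon>\<close>]) auto
  finally show ?thesis .
qed

text \<open>The flux has no continuity in time, it is only bounded and measurable. This lemma and
  \<open>fubini_weight\<close> take the place of continuity arguments for products of such a weight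
  with a continuous function.\<close>

lemma set_integrable_weight:
  fixes k g :: "real \<Rightarrow> real"
  assumes k: "k \<in> borel_measurable borel" and C: "\<And>\<tau>. \<bar>k \<tau>\<bar> \<le> C"
    and g: "continuous_on {c..d} g"
  shows "set_integrable lborel {c..d} (\<lambda>\<tau>. k \<tau> * g \<tau>)"
proof -
  have gi: "integrable lborel (\<lambda>\<tau>. indicator {c..d} \<tau> *\<^sub>R g \<tau>)"
    by (intro borel_integrable_compact compact_Icc g)
  have "integrable lborel (\<lambda>\<tau>. k \<tau> * (indicator {c..d} \<tau> *\<^sub>R g \<tau>))"
  proof (rule Bochner_Integration.integrable_bound)
    show "integrable lborel (\<lambda>\<tau>. C * (indicator {c..d} \<tau> *\<^sub>R g \<tau>))"
      using gi by (rule integrable_mult_right)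
    show "(\<lambda>\<tau>. k \<tau> * (indicator {c..d} \<tau> *\<^sub>R g \<tau>)) \<in> borel_measurable lborel"
      using k borel_measurable_integrable[OF gi] by (simp add: borel_measurable_times)
    have "0 \<le> C" using C[of 0] by simp
    then show "AE \<tau> in lborel. norm (k \<tau> * (indicator {c..d} \<tau> *\<^sub>R g \<tau>)) \<le> norm (C * (indicator {c..d} \<tau> *\<^sub>R g \<tau>))"
      using C by (auto simp: abs_mult intro!: mult_right_mono)
  qed
  then show ?thesis
    by (simp add: set_integrable_def mult.left_commute)
qed

lemma fubini_weight:
  fixes k :: "real \<Rightarrow> real" and g :: "real \<Rightarrow> real \<Rightarrow> real"
  assumes k: "k \<in> borel_measurable borel" and C: "\<And>\<tau>. \<bar>k \<tau>\<bar> \<le> C"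
    and g: "continuous_on ({a..b} \<times> {c..d}) (\<lambda>(w, \<tau>). g w \<tau>)"
  shows "set_integrable lborel {a..b} (\<lambda>w. LINT \<tau>:{c..d}|lborel. k \<tau> * g w \<tau>)"
    and "(LINT w:{a..b}|lborel. LINT \<tau>:{c..d}|lborel. k \<tau> * g w \<tau>) =
      (LINT \<tau>:{c..d}|lborel. k \<tau> * (LINT w:{a..b}|lborel. g w \<tau>))"
proof -
  let ?S = "{a..b} \<times> {c..d}"
  define F where "F = (\<lambda>(w, \<tau>). k \<tau> * (indicator ?S (w, \<tau>) *\<^sub>R g w \<tau>))"
  have gi: "integrable (lborel :: (real \<times> real) measure) (\<lambda>z. indicator ?S z *\<^sub>R (case z of (w, \<tau>) \<Rightarrow> g w \<tau>))"
    by (intro borel_integrable_compact compact_Times compact_Icc g)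
  have "integrable (lborel :: (real \<times> real) measure) F"
  proof (rule Bochner_Integration.integrable_bound)
    show "integrable (lborel :: (real \<times> real) measure) (\<lambda>z. C * (indicator ?S z *\<^sub>R (case z of (w, \<tau>) \<Rightarrow> g w \<tau>)))"
      using gi by (rule integrable_mult_right)
    have "(\<lambda>z::real\<times>real. k (snd z)) \<in> borel_measurable borel"
      using k by (intro measurable_compose[OF _ k]) (simp add: borel_measurable_continuous_onI continuous_on_snd)
    moreover have "(\<lambda>z. indicator ?S z *\<^sub>R (case z of (w, \<tau>) \<Rightarrow> g w \<tau>)) \<in> borel_measurable borel"
      using borel_measurable_integrable[OF gi] by simp
    ultimately have "(\<lambda>z. k (snd z) * (indicator ?S z *\<^sub>R (case z of (w, \<tau>) \<Rightarrow> g w \<tau>))) \<in> borel_measurable borel"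
      by (rule borel_measurable_times)
    moreover have "F = (\<lambda>z. k (snd z) * (indicator ?S z *\<^sub>R (case z of (w, \<tau>) \<Rightarrow> g w \<tau>)))"
      by (auto simp: F_def)
    ultimately show "F \<in> borel_measurable (lborel :: (real \<times> real) measure)"
      by simp
    have "0 \<le> C" using C[of 0] by simp
    then show "AE z in (lborel :: (real \<times> real) measure). norm (F z) \<le> norm (C * (indicator ?S z *\<^sub>R (case z of (w, \<tau>) \<Rightarrow> g w \<tau>)))"
      using C by (auto simp: abs_mult F_def case_prod_beta intro!: mult_right_mono)
  qed
  then have Fi: "integrable (lborel \<Otimes>\<^sub>M lborel) F"
    by (simp add: lborel_prod)
  have F1: "(LINT \<tau>|lborel. F (w, \<tau>)) = indicator {a..b} w *\<^sub>R (LINT \<tau>:{c..d}|lborel. k \<tau> * g w \<tau>)" for w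
    unfolding set_lebesgue_integral_def F_def
    by (cases "w \<in> {a..b}") (auto intro!: Bochner_Integration.integral_cong simp: indicator_def)
  have F2: "(LINT w|lborel. F (w, \<tau>)) = indicator {c..d} \<tau> *\<^sub>R (k \<tau> * (LINT w:{a..b}|lborel. g w \<tau>))" for \<tau>
  proof -
    have "(LINT w|lborel. F (w, \<tau>)) = (LINT w|lborel. (indicator {c..d} \<tau> * k \<tau>) * (indicator {a..b} w *\<^sub>R g w \<tau>))"
      unfolding F_def by (intro Bochner_Integration.integral_cong) (auto simp: indicator_def)
    also have "\<dots> = (indicator {c..d} \<tau> * k \<tau>) * (LINT w|lborel. (indicator {a..b} w *\<^sub>R g w \<tau>))"
      by (rule Bochner_Integration.integral_mult_right_zero)
    finally show ?thesis
      by (simp add: set_lebesgue_integral_def)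
  qed
  show "set_integrable lborel {a..b} (\<lambda>w. LINT \<tau>:{c..d}|lborel. k \<tau> * g w \<tau>)"
    using lborel_pair.integrable_fst'[OF Fi] by (simp add: set_integrable_def F1)
  have "(LINT w|lborel. LINT \<tau>|lborel. F (w, \<tau>)) = (LINT \<tau>|lborel. LINT w|lborel. F (w, \<tau>))"
    using lborel_pair.Fubini_integral[of "\<lambda>w \<tau>. F (w, \<tau>)"] Fi by simp
  then show "(LINT w:{a..b}|lborel. LINT \<tau>:{c..d}|lborel. k \<tau> * g w \<tau>) =
      (LINT \<tau>:{c..d}|lborel. k \<tau> * (LINT w:{a..b}|lborel. g w \<tau>))"
    unfolding F1 F2 by (simp add: set_lebesgue_integral_def)
qed

lemma integral_rescale:
  fixes f :: "real \<Rightarrow> real"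
  assumes "0 < m" "continuous_on {lo..lo + m * l} f"
  shows "integral {lo..lo + m * l} f = m * integral {0..l} (\<lambda>z. f (lo + m * z))"
proof (cases "0 \<le> l")
  case True
  have "(f has_integral integral {lo..lo + m * l} f) (cbox lo (lo + m * l))"
    using integrable_integral[OF integrable_continuous_interval[OF assms(2)]] by simp
  from has_integral_affinity[OF this, of m lo]
  have "((\<lambda>z. f (m * z + lo)) has_integral (1 / m) * integral {lo..lo + m * l} f)
      ((\<lambda>x. (1 / m) *\<^sub>R x + - ((1 / m) *\<^sub>R lo)) ` cbox lo (lo + m * l))"
    using assms by simp
  moreover have "((\<lambda>x. (1 / m) *\<^sub>R x + - ((1 / m) *\<^sub>R lo)) ` cbox lo (lo + m * l)) = {0..l}"
    using image_affinity_atLeastAtMost[of "1 / m" "- (lo / m)" lo "lo + m * l"] assms True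
    by (simp add: field_simps)
  ultimately have "((\<lambda>z. f (m * z + lo)) has_integral (1 / m) * integral {lo..lo + m * l} f) {0..l}"
    by simp
  from integral_unique[OF this] show ?thesis
    using assms by (simp add: add.commute)
next
  case False
  then have "m * l < 0" using assms by (simp add: mult_pos_neg)
  then show ?thesis using False by simp
qed

text \<open>For the blow-up at the free boundary: \<open>m\<close> is the length scale and
  \<open>z\<close> the distance to \<open>c\<close> measured in that scale.\<close>

lemma integral_rescale_left:
  fixes f :: "real \<Rightarrow> real"
  assumes "0 < m" "continuous_on {c - m * l..c} f"
  shows "integral {c - m * l..c} f = m * integral {0..l} (\<lambda>z. f (c - m * z))"
proof -
  have "integral {c - m * l..c} f = integral {- c..- c + m * l} (\<lambda>x. f (- x))"
    using Henstock_Kurzweil_Integration.integral_reflect_real[of c "c - m * l" f, symmetric]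
    by (simp add: algebra_simps)
  also have "\<dots> = m * integral {0..l} (\<lambda>z. f (- (- c + m * z)))"
    by (rule integral_rescale[OF assms(1)])
      (auto intro!: continuous_intros continuous_on_compose2[OF assms(2)])
  finally show ?thesis by simp
qed

text \<open>The substitution \<open>x = lo + (p t - lo) * z\<close> moves the time dependence from
  the endpoint into the integrand, over the fixed interval from 0 to 1.\<close>

lemma continuous_on_moving_integral:
  fixes G :: "real \<Rightarrow> real \<Rightarrow> real"
  assumes G: "continuous_on ({lo..hi} \<times> S) (\<lambda>(x, t). G x t)"
    and p: "continuous_on S p" and bounds: "\<And>t. t \<in> S \<Longrightarrow> lo < p t \<and> p t \<le> hi"
  shows "continuous_on S (\<lambda>t. integral {lo..p t} (\<lambda>x. G x t))"
proof -
  have G1: "continuous_on A (\<lambda>z. G (f z) (g z))"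
    if "continuous_on A f" "continuous_on A g" "\<And>z. z \<in> A \<Longrightarrow> f z \<in> {lo..hi} \<and> g z \<in> S"
    for A :: "'a::topological_space set" and f g
  proof -
    have "continuous_on A (\<lambda>z. (f z, g z))"
      by (rule continuous_on_Pair[OF that(1,2)])
    moreover have "(\<lambda>z. (f z, g z)) ` A \<subseteq> {lo..hi} \<times> S"
      using that(3) by auto
    ultimately show ?thesis
      using continuous_on_compose2[OF G] by fastforce
  qed
  have "integral {lo..p t} (\<lambda>x. G x t) = (p t - lo) * integral (cbox 0 1) (\<lambda>z. G (lo + (p t - lo) * z) t)"
    if "t \<in> S" for t
  proof -
    have "continuous_on {lo..lo + (p t - lo) * 1} (\<lambda>x. G x t)"
      by (rule G1[OF continuous_on_id continuous_on_const]) (use bounds[OF that] that in auto)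
    then show ?thesis
      using integral_rescale[of "p t - lo" lo 1 "\<lambda>x. G x t"] bounds[OF that] by simp
  qed
  moreover have "continuous_on S (\<lambda>t. (p t - lo) * integral (cbox 0 1) (\<lambda>z. G (lo + (p t - lo) * z) t))"
  proof (intro continuous_intros p integral_continuous_on_param)
    have "continuous_on (S \<times> cbox 0 (1::real)) (\<lambda>w. G (lo + (p (fst w) - lo) * snd w) (fst w))"
    proof (rule G1)
      show "continuous_on (S \<times> cbox 0 1) (\<lambda>w. lo + (p (fst w) - lo) * snd w)"
        by (intro continuous_intros continuous_on_compose2[OF p]) auto
      fix w assume w: "w \<in> S \<times> cbox 0 (1::real)"
      then have S: "fst w \<in> S" and b: "0 \<le> snd w" "snd w \<le> 1" by auto
      define d where "d = (p (fst w) - lo) * snd w"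
      have "0 \<le> d" "d \<le> p (fst w) - lo"
        using bounds[OF S] b unfolding d_def by (auto intro!: mult_left_le)
      then show "lo + (p (fst w) - lo) * snd w \<in> {lo..hi} \<and> fst w \<in> S"
        using bounds[OF S] S unfolding d_def[symmetric] by auto
    qed (intro continuous_intros)
    then show "continuous_on (S \<times> cbox 0 1) (\<lambda>(t, z). G (lo + (p t - lo) * z) t)"
      by (simp add: case_prod_beta)
  qed
  ultimately show ?thesis
    by (simp cong: continuous_on_cong)
qed

text \<open>
  The integrand vanishes near the moving endpoint, so the endpoint contributes nothing although it
  is merely continuous in time.
\<close>

lemma moving_domain_derivative:
  fixes G Gt :: "real \<Rightarrow> real \<Rightarrow> real"
  assumes Gt: "\<And>x t. (G x has_real_derivative Gt x t) (at t)"
    and Gc: "continuous_on UNIV (\<lambda>(x, t). G x t)" and Gtc: "continuous_on UNIV (\<lambda>(x, t). Gt x t)"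
    and p: "continuous_on S p" and t0: "t0 \<in> S" and "0 < \<rho>"
    and vanish: "\<And>t x. t \<in> S \<Longrightarrow> \<bar>x - p t\<bar> \<le> \<rho> \<Longrightarrow> G x t = 0"
    and lo: "lo \<le> p t0 - \<rho>"
  shows "((\<lambda>t. integral {lo..p t} (\<lambda>x. G x t)) has_real_derivative integral {lo..p t0} (\<lambda>x. Gt x t0)) (at t0 within S)"
proof -
  have Gx: "continuous_on A (\<lambda>x. G x t)" for A t
    by (rule continuous_on_compose2[OF Gc, of A "\<lambda>x. (x, t)", unfolded case_prod_conv]) (auto intro!: continuous_intros)
  obtain d where d: "d > 0" "\<And>t. t \<in> S \<Longrightarrow> dist t t0 < d \<Longrightarrow> dist (p t) (p t0) < \<rho>"
    using p t0 \<open>0 < \<rho>\<close> unfolding continuous_on_iff by metis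
  have "((\<lambda>t. integral (cbox lo (p t0)) (\<lambda>x. G x t)) has_real_derivative integral (cbox lo (p t0)) (\<lambda>x. Gt x t0)) (at t0 within UNIV)"
  proof (rule leibniz_rule_field_derivative)
    show "((\<lambda>t. G x t) has_real_derivative Gt x t) (at t within UNIV)" for t x
      by (simp add: Gt)
    show "(\<lambda>x. G x t) integrable_on cbox lo (p t0)" for t
      using Gx by (simp add: integrable_continuous_interval)
    show "continuous_on (UNIV \<times> cbox lo (p t0)) (\<lambda>(t, x). Gt x t)"
      unfolding case_prod_beta
      by (rule continuous_on_compose2[OF Gtc, of _ "\<lambda>z. (snd z, fst z)", unfolded case_prod_conv])
        (auto intro!: continuous_intros)
  qed auto
  then have "((\<lambda>t. integral {lo..p t0} (\<lambda>x. G x t)) has_real_derivative integral {lo..p t0} (\<lambda>x. Gt x t0)) (at t0 within S)"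
    by (auto intro: has_field_derivative_at_within)
  \<comment> \<open>For times so close that \<open>p\<close> moves by less than
    \<open>\<rho>\<close>, the piece between \<open>p t\<close> and \<open>p t0\<close> lies where
    \<open>G\<close> vanishes, so the domain can be frozen at \<open>p t0\<close> and the Leibniz
    rule for a fixed interval applies.\<close>
  moreover have "integral {lo..p t0} (\<lambda>x. G x t) = integral {lo..p t} (\<lambda>x. G x t)" if "t \<in> S" "dist t t0 < d" for t
  proof -
    have near: "\<bar>p t - p t0\<bar> < \<rho>"
      using d(2)[OF that] by (simp add: dist_real_def)
    have z: "integral {x..y} (\<lambda>x. G x t) = 0" if "\<And>z. z \<in> {x..y} \<Longrightarrow> \<bar>z - p t\<bar> \<le> \<rho>" for x y
      using vanish[OF \<open>t \<in> S\<close>] that by (subst integral_cong[where g = "\<lambda>_. 0"]) auto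
    show ?thesis
    proof (cases "p t \<le> p t0")
      case True
      have "integral {lo..p t} (\<lambda>x. G x t) + integral {p t..p t0} (\<lambda>x. G x t) = integral {lo..p t0} (\<lambda>x. G x t)"
        by (intro Henstock_Kurzweil_Integration.integral_combine integrable_continuous_interval Gx)
          (use True near lo in auto)
      moreover have "integral {p t..p t0} (\<lambda>x. G x t) = 0"
        by (rule z) (use near in auto)
      ultimately show ?thesis by simp
    next
      case False
      have "integral {lo..p t0} (\<lambda>x. G x t) + integral {p t0..p t} (\<lambda>x. G x t) = integral {lo..p t} (\<lambda>x. G x t)"
        by (intro Henstock_Kurzweil_Integration.integral_combine integrable_continuous_interval Gx)
          (use False \<open>0 < \<rho>\<close> lo in auto)
      moreover have "integral {p t0..p t} (\<lambda>x. G x t) = 0"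
        by (rule z) (use near in auto)
      ultimately show ?thesis by simp
    qed
  qed
  ultimately show ?thesis
    by (rule has_field_derivative_transform_within[OF _ d(1) t0])
qed

lemma has_integral_derivative:
  fixes F f :: "real \<Rightarrow> real"
  assumes "\<And>x. (F has_real_derivative f x) (at x)" "lo \<le> c"
  shows "(f has_integral F c - F lo) {lo..c}"
  using assms by (intro fundamental_theorem_of_calculus)
    (auto simp: has_real_derivative_iff_has_vector_derivative[symmetric] intro: has_field_derivative_at_within)

text \<open>
  Near \<open>c\<close> the dissipation \<open>\<phi> j2(w) w1\<^sup>2\<close> is bounded below by \<open>\<phi> j2(w) (- 2 \<mu> w1 - \<mu>\<^sup>2)\<close>, which involves
  no square of the derivative; the choice \<open>w1 c = - \<mu>\<close> makes this sharp in the blow-up limit.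
\<close>

lemma dissipation_estimate:
  fixes w w1 w2 \<phi> \<phi>1 \<phi>2 j j1 j2 :: "real \<Rightarrow> real"
  assumes w: "\<And>x. (w has_real_derivative w1 x) (at x)" "\<And>x. (w1 has_real_derivative w2 x) (at x)"
      "continuous_on UNIV w2"
    and \<phi>: "\<And>x. (\<phi> has_real_derivative \<phi>1 x) (at x)" "\<And>x. (\<phi>1 has_real_derivative \<phi>2 x) (at x)"
      "continuous_on UNIV \<phi>2"
    and j: "\<And>x. (j has_real_derivative j1 x) (at x)" "\<And>x. (j1 has_real_derivative j2 x) (at x)"
      "continuous_on UNIV j2"
    and \<phi>_nonneg: "\<And>x. x \<le> c \<Longrightarrow> 0 \<le> \<phi> x" and j2_nonneg: "\<And>x. 0 \<le> j2 x"
    and c: "j (w c) = 0" "j1 (w c) = 0" and lo: "\<phi> lo = 0" "\<phi>1 lo = 0"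
    and h: "0 \<le> h" "lo \<le> c - h"
  shows "integral {lo..c} (\<lambda>x. \<phi> x * (j1 (w x) * w2 x)) \<le> integral {lo..c} (\<lambda>x. \<phi>2 x * j (w x))
    - (2 * \<mu> * \<phi> (c - h) * j1 (w (c - h)) + 2 * \<mu> * integral {c - h..c} (\<lambda>x. \<phi>1 x * j1 (w x))
       - \<mu>\<^sup>2 * integral {c - h..c} (\<lambda>x. \<phi> x * j2 (w x)))"
proof -
  have cont: "continuous_on A f" if "\<And>x. (f has_real_derivative f' x) (at x)" for A and f f' :: "real \<Rightarrow> real"
    using that by (meson DERIV_continuous_on has_field_derivative_at_within)
  define J J1 J2 where "J x = j (w x)" and "J1 x = j1 (w x)" and "J2 x = j2 (w x)" for x
  have dJ: "(J has_real_derivative J1 x * w1 x) (at x)" and dJ1: "(J1 has_real_derivative J2 x * w1 x) (at x)" for x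
    unfolding J_def[abs_def] J1_def[abs_def] J2_def[abs_def]
    using DERIV_chain2[OF j(1) w(1)] DERIV_chain2[OF j(2) w(1)] by auto
  have c0: "continuous_on A w1" "continuous_on A w2" "continuous_on A \<phi>" "continuous_on A \<phi>1" "continuous_on A \<phi>2"
      "continuous_on A J" "continuous_on A J1" "continuous_on A J2" for A
    subgoal by (rule cont[OF w(2)])
    subgoal by (rule continuous_on_subset[OF w(3)]) simp
    subgoal by (rule cont[OF \<phi>(1)])
    subgoal by (rule cont[OF \<phi>(2)])
    subgoal by (rule continuous_on_subset[OF \<phi>(3)]) simp
    subgoal by (rule cont[OF dJ])
    subgoal by (rule cont[OF dJ1])
    subgoal unfolding J2_def[abs_def] by (rule continuous_on_comp_UNIV[OF j(3) cont[OF w(1)]])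
    done
  note ints = integrable_continuous_interval continuous_on_add continuous_on_diff continuous_on_mult
    continuous_on_power continuous_on_const c0
  have le: "lo \<le> c" "c - h \<le> c" using h by auto
  let ?D = "\<lambda>x. \<phi> x * (J2 x * (w1 x)\<^sup>2)"
  \<comment> \<open>The integrand is the exact derivative of
    \<open>\<phi> J1 w1 - \<phi>1 J\<close>: two integrations by parts at once. The boundary terms
    vanish at \<open>c\<close> through \<open>J\<close> and \<open>J1\<close>, at \<open>lo\<close>
    through \<open>\<phi>\<close> and \<open>\<phi>1\<close>.\<close>
  have "((\<lambda>x. ?D x + \<phi> x * (J1 x * w2 x) - \<phi>2 x * J x) has_integral
      (\<phi> c * (J1 c * w1 c) - \<phi>1 c * J c) - (\<phi> lo * (J1 lo * w1 lo) - \<phi>1 lo * J lo)) {lo..c}"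
  proof (rule has_integral_derivative[OF _ le(1)])
    fix x
    show "((\<lambda>x. \<phi> x * (J1 x * w1 x) - \<phi>1 x * J x) has_real_derivative
        ?D x + \<phi> x * (J1 x * w2 x) - \<phi>2 x * J x) (at x)"
      by (rule derivative_eq_intros \<phi> dJ dJ1 w refl)+ (simp add: algebra_simps power2_eq_square)
  qed
  then have "integral {lo..c} (\<lambda>x. ?D x + \<phi> x * (J1 x * w2 x) - \<phi>2 x * J x) = 0"
    using c lo by (simp add: integral_unique J_def J1_def)
  moreover have "integral {lo..c} (\<lambda>x. ?D x + \<phi> x * (J1 x * w2 x) - \<phi>2 x * J x)
      = integral {lo..c} (\<lambda>x. ?D x + \<phi> x * (J1 x * w2 x)) - integral {lo..c} (\<lambda>x. \<phi>2 x * J x)"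
    by (intro Henstock_Kurzweil_Integration.integral_diff ints)
  moreover have "integral {lo..c} (\<lambda>x. ?D x + \<phi> x * (J1 x * w2 x))
      = integral {lo..c} ?D + integral {lo..c} (\<lambda>x. \<phi> x * (J1 x * w2 x))"
    by (intro Henstock_Kurzweil_Integration.integral_add ints)
  moreover have "integral {c - h..c} ?D \<le> integral {lo..c} ?D"
    by (intro integral_subset_le ints) (use h \<phi>_nonneg j2_nonneg in \<open>auto simp: J2_def\<close>)
  \<comment> \<open>The two integrands differ by \<open>\<phi> J2 (w1 + \<mu>)\<^sup>2\<close>. The
    term linear in \<open>w1\<close> is grouped with \<open>\<phi>1 J1\<close> so that it becomes
    the derivative of \<open>\<phi> J1\<close> and can be integrated.\<close>
  moreover have "integral {c - h..c} (\<lambda>x. (- 2 * \<mu>) * (\<phi>1 x * J1 x + \<phi> x * (J2 x * w1 x)) + ((2 * \<mu>) * (\<phi>1 x * J1 x) - \<mu>\<^sup>2 * (\<phi> x * J2 x)))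
      \<le> integral {c - h..c} ?D"
  proof (intro integral_le ints)
    fix x assume "x \<in> {c - h..c}"
    then have "0 \<le> \<phi> x * J2 x * (w1 x + \<mu>)\<^sup>2"
      using \<phi>_nonneg j2_nonneg by (simp add: J2_def)
    then show "(- 2 * \<mu>) * (\<phi>1 x * J1 x + \<phi> x * (J2 x * w1 x)) + ((2 * \<mu>) * (\<phi>1 x * J1 x) - \<mu>\<^sup>2 * (\<phi> x * J2 x)) \<le> ?D x"
      by (simp add: algebra_simps power2_eq_square)
  qed
  moreover have "integral {c - h..c} (\<lambda>x. (- 2 * \<mu>) * (\<phi>1 x * J1 x + \<phi> x * (J2 x * w1 x)) + ((2 * \<mu>) * (\<phi>1 x * J1 x) - \<mu>\<^sup>2 * (\<phi> x * J2 x)))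
     = integral {c - h..c} (\<lambda>x. (- 2 * \<mu>) * (\<phi>1 x * J1 x + \<phi> x * (J2 x * w1 x)))
       + integral {c - h..c} (\<lambda>x. (2 * \<mu>) * (\<phi>1 x * J1 x) - \<mu>\<^sup>2 * (\<phi> x * J2 x))"
    by (intro Henstock_Kurzweil_Integration.integral_add ints)
  moreover have "integral {c - h..c} (\<lambda>x. (2 * \<mu>) * (\<phi>1 x * J1 x) - \<mu>\<^sup>2 * (\<phi> x * J2 x))
     = integral {c - h..c} (\<lambda>x. (2 * \<mu>) * (\<phi>1 x * J1 x)) - integral {c - h..c} (\<lambda>x. \<mu>\<^sup>2 * (\<phi> x * J2 x))"
    by (intro Henstock_Kurzweil_Integration.integral_diff ints)
  moreover have "integral {c - h..c} (\<lambda>x. \<phi>1 x * J1 x + \<phi> x * (J2 x * w1 x)) = \<phi> c * J1 c - \<phi> (c - h) * J1 (c - h)"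
  proof (intro integral_unique has_integral_derivative[OF _ le(2)])
    fix x
    show "((\<lambda>x. \<phi> x * J1 x) has_real_derivative \<phi>1 x * J1 x + \<phi> x * (J2 x * w1 x)) (at x)"
      by (rule derivative_eq_intros \<phi> dJ1 refl)+ simp
  qed
  moreover have "J c = 0" "J1 c = 0"
    using c by (simp_all add: J_def J1_def)
  ultimately show ?thesis
    unfolding J_def[symmetric] J1_def[symmetric] J2_def[symmetric] integral_mult_right
    by (simp only: mult_zero_right diff_0)
qed

section \<open>The flux at the free boundary: bounds, measurability and the source term\<close>

context weak_solution
begin

lemma flux_bound:
  assumes "0 < t" and C: "C-lipschitz_on {-L..L} (\<lambda>x. u x t)"
  shows "\<bar>\<kappa> t\<bar> \<le> C"
proof -
  have "((\<lambda>y. (u y t - u (p t) t) / (y - p t)) \<longlongrightarrow> - \<kappa> t) (at (p t))"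
    using flux[OF \<open>0 < t\<close>] by (simp add: has_field_derivative_iff)
  then have lim: "((\<lambda>y. \<bar>(u y t - u (p t) t) / (y - p t)\<bar>) \<longlongrightarrow> \<bar>- \<kappa> t\<bar>) (at (p t))"
    by (rule tendsto_rabs)
  have "\<forall>\<^sub>F y in at (p t). y \<in> {-L<..<L}"
    using p_bounds[OF \<open>0 < t\<close>] by (intro eventually_at_in_open') auto
  moreover have "\<forall>\<^sub>F y in at (p t). y \<noteq> p t"
    by (simp add: eventually_at_filter)
  ultimately have "\<forall>\<^sub>F y in at (p t). \<bar>(u y t - u (p t) t) / (y - p t)\<bar> \<le> C"
  proof eventually_elim
    case (elim y)
    have "dist (u y t) (u (p t) t) \<le> C * dist y (p t)"
      using p_bounds[OF \<open>0 < t\<close>] elim by (intro lipschitz_onD[OF C]) auto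
    then show ?case
      using elim by (simp add: dist_real_def divide_le_eq)
  qed
  with lim have "\<bar>- \<kappa> t\<bar> \<le> C"
    by (rule tendsto_upperbound) simp
  then show ?thesis by simp
qed

lemma u_bound_near_p:
  assumes "0 < t" and C: "C-lipschitz_on {-L..L} (\<lambda>x. u x t)" and "x \<in> {-L..L}"
  shows "\<bar>u x t\<bar> \<le> C * \<bar>x - p t\<bar>"
  using lipschitz_onD[OF C, of x "p t"] p_bounds[OF \<open>0 < t\<close>] zero[OF \<open>0 < t\<close>] assms(3)
  by (auto simp: dist_real_def)

lemma p_compact_bounds:
  assumes "0 < s"
  obtains r where "0 < r" "\<And>t. t \<in> {s..T} \<Longrightarrow> -L + r < p t \<and> p t < L - r"
proof (cases "{s..T} = {}")
  case True
  then show ?thesis by (intro that[of 1]) auto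
next
  case False
  have c: "continuous_on {s..T} p"
    using p_cont by (rule continuous_on_subset) (use assms in auto)
  obtain t1 where t1: "t1 \<in> {s..T}" "\<And>t. t \<in> {s..T} \<Longrightarrow> p t \<le> p t1"
    using continuous_attains_sup[OF compact_Icc False c] by auto
  obtain t2 where t2: "t2 \<in> {s..T}" "\<And>t. t \<in> {s..T} \<Longrightarrow> p t2 \<le> p t"
    using continuous_attains_inf[OF compact_Icc False c] by auto
  define r where "r = min (L - p t1) (p t2 + L) / 2"
  have "0 < r"
    using p_bounds[of t1] p_bounds[of t2] t1(1) t2(1) assms by (auto simp: r_def)
  moreover have "-L + r < p t \<and> p t < L - r" if "t \<in> {s..T}" for t
    using t1(2)[OF that] t2(2)[OF that] \<open>0 < r\<close> by (auto simp: r_def min_def field_simps split: if_splits)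
  ultimately show ?thesis by (rule that)
qed

text \<open>Set to 0 outside \<open>{s..T}\<close>, so that it is bounded and measurable on the
  whole line, the form that \<open>set_integrable_weight\<close> and \<open>fubini_weight\<close>
  expect.\<close>

definition positive_flux :: "real \<Rightarrow> real \<Rightarrow> real \<Rightarrow> real" where
  "positive_flux s T t = (if t \<in> {s..T} then max 0 (\<kappa> t) else 0)"

lemma positive_flux_nonneg: "0 \<le> positive_flux s T t"
  by (simp add: positive_flux_def)

lemma positive_flux_bound:
  assumes "0 < s" "\<forall>t\<in>{s..T}. C-lipschitz_on {-L..L} (\<lambda>x. u x t)" "0 \<le> C"
  shows "\<bar>positive_flux s T t\<bar> \<le> C"
  using assms flux_bound[of t C] by (auto simp: positive_flux_def)

text \<open>\<open>\<kappa>\<close> is known only pointwise, as a derivative at \<open>p t\<close>.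
  It is the limit of the difference quotients \<open>- u (p t + e n) t / e n\<close>, each of which
  is continuous in \<open>t\<close>.\<close>

lemma flux_measurable:
  assumes "0 < s"
  shows "(\<lambda>t. if t \<in> {s..T} then \<kappa> t else 0) \<in> borel_measurable borel"
proof -
  obtain r where r: "0 < r" "\<And>t. t \<in> {s..T} \<Longrightarrow> -L + r < p t \<and> p t < L - r"
    using p_compact_bounds[OF assms] by blast
  \<comment> \<open>The step never exceeds \<open>r\<close>, so \<open>p t + e n\<close> stays
    inside the domain for all \<open>t\<close> of the compact time interval at once.\<close>
  define e where "e n = r / real (Suc n)" for n
  have e: "0 < e n" "e n \<le> r" for n
    using r(1) by (auto simp: e_def divide_le_eq)
  have "e \<longlonglongrightarrow> 0"
    using tendsto_mult[OF tendsto_const[of r] LIMSEQ_inverse_real_of_nat]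
    by (simp add: e_def[abs_def] divide_inverse)
  define q where "q n t = indicator {s..T} t *\<^sub>R (- (u (p t + e n) t) / e n)" for n t
  have pc: "continuous_on {s..T} p"
    using p_cont by (rule continuous_on_subset) (use assms in auto)
  have "q n \<in> borel_measurable borel" for n
    unfolding q_def
  proof (rule borel_measurable_continuous_on_indicator)
    have "continuous_on {s..T} (\<lambda>t. (p t + e n, t))"
      by (intro continuous_intros pc)
    moreover have "(\<lambda>t. (p t + e n, t)) ` {s..T} \<subseteq> {-L..L} \<times> {0<..}"
    proof (rule image_subsetI)
      fix t assume t: "t \<in> {s..T}"
      show "(p t + e n, t) \<in> {-L..L} \<times> {0<..}"
        using r(1) r(2)[OF t] e[of n] t assms by auto
    qed
    ultimately have "continuous_on {s..T} (\<lambda>t. u (p t + e n) t)"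
      using continuous_on_compose2[OF u_cont] by fastforce
    then show "continuous_on {s..T} (\<lambda>t. - (u (p t + e n) t) / e n)"
      using e(1)[of n] by (intro continuous_intros) auto
  qed simp
  moreover have "(\<lambda>n. q n t) \<longlonglongrightarrow> (if t \<in> {s..T} then \<kappa> t else 0)" for t
  proof (cases "t \<in> {s..T}")
    case True
    then have "0 < t" using assms by auto
    have "((\<lambda>h. (u (p t + h) t - u (p t) t) / h) \<longlongrightarrow> - \<kappa> t) (at 0)"
      using flux[OF \<open>0 < t\<close>] by (simp add: DERIV_def)
    moreover have "filterlim e (at 0) sequentially"
      using \<open>e \<longlonglongrightarrow> 0\<close> e(1) by (auto simp: filterlim_at less_imp_neq[symmetric] intro!: always_eventually)
    ultimately have "(\<lambda>n. (u (p t + e n) t - u (p t) t) / e n) \<longlonglongrightarrow> - \<kappa> t"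
      by (rule filterlim_compose)
    then have "(\<lambda>n. - ((u (p t + e n) t - u (p t) t) / e n)) \<longlonglongrightarrow> \<kappa> t"
      using tendsto_minus by fastforce
    then show ?thesis
      using True zero[OF \<open>0 < t\<close>] by (simp add: q_def)
  next
    case False
    then show ?thesis by (auto simp: q_def)
  qed
  ultimately show ?thesis
    by (rule borel_measurable_LIMSEQ_real[rotated])
qed

lemma positive_flux_measurable:
  assumes "0 < s"
  shows "positive_flux s T \<in> borel_measurable borel"
proof -
  have "(\<lambda>t. max 0 (if t \<in> {s..T} then \<kappa> t else 0)) \<in> borel_measurable borel"
    by (intro borel_measurable_max flux_measurable[OF assms] measurable_const) simp
  also have "(\<lambda>t. max 0 (if t \<in> {s..T} then \<kappa> t else 0)) = positive_flux s T"
    by (auto simp: positive_flux_def)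
  finally show ?thesis .
qed


lemma p_cont_subset: "0 < s \<Longrightarrow> continuous_on {s..T} p"
  using p_cont by (rule continuous_on_subset) auto

text \<open>
  Within time \<open>\<epsilon>\<close> the price moves by at most \<open>a / 2\<close>, so the mollified sink stays to the right of \<open>p t\<close>
  and only the source at \<open>p t - a\<close> matters.
\<close>

lemma source_estimate:
  fixes \<phi> :: "real \<Rightarrow> real"
  assumes b: "mollifier \<epsilon> b" and \<epsilon>: "0 < \<epsilon>" "\<epsilon> \<le> a / 2"
    and times: "0 < s0" "s0 + \<epsilon> \<le> s" "s < T" "T + \<epsilon> \<le> t0"
    and C: "\<And>t. t \<in> {s0..t0} \<Longrightarrow> \<bar>\<kappa> t\<bar> \<le> C"
    and modulus: "\<And>t \<tau>. t \<in> {s..T} \<Longrightarrow> \<tau> \<in> {s0..t0} \<Longrightarrow> \<bar>\<tau> - t\<bar> \<le> \<epsilon> \<Longrightarrow> \<bar>p \<tau> - p t\<bar> \<le> a / 2"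
    and \<phi>: "continuous_on UNIV \<phi>" "\<And>x. x \<le> L \<Longrightarrow> 0 \<le> \<phi> x" "\<And>x. x \<in> {-L-a..L} \<Longrightarrow> \<phi> x \<le> B"
      "\<And>x y. x \<in> {-L-a-1..L+1} \<Longrightarrow> y \<in> {-L-a-1..L+1} \<Longrightarrow> \<bar>\<phi> x - \<phi> y\<bar> \<le> N * \<bar>x - y\<bar>"
    and lo: "-L < lo - \<epsilon>" and hi: "\<And>t. t \<in> {s..T} \<Longrightarrow> lo \<le> p t \<and> p t + \<epsilon> < L"
  obtains Kb where
    "\<And>t g. t \<in> {s..T} \<Longrightarrow> continuous_on UNIV g \<Longrightarrow> (\<And>x. x \<le> L \<Longrightarrow> 0 \<le> g x \<and> g x \<le> \<phi> x) \<Longrightarrow>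
      integral {lo..p t} (\<lambda>x. g x * (smear u (s0, -L) (t0, L) (b 0) (b 1) x t - smear u (s0, -L) (t0, L) (b 2) (b 0) x t)) \<le> Kb t"
    "Kb integrable_on {s..T}"
    "integral {s..T} Kb \<le> integral {s..T} (\<lambda>t. positive_flux s T t * \<phi> (p t - a)) + (2 * C * B + C * N * (t0 - s0)) * \<epsilon>"
proof -
  define k where "k = positive_flux s0 t0"
  define \<kappa>0 where "\<kappa>0 t = (if t \<in> {s0..t0} then \<kappa> t else 0)" for t
  have C0: "0 \<le> C" using C[of s] times \<epsilon> by force
  have B0: "0 \<le> B" using \<phi>(2)[of L] \<phi>(3)[of L] a_pos p_bounds[of s] times \<epsilon> by force
  have k_meas: "k \<in> borel_measurable borel" and \<kappa>0_meas: "\<kappa>0 \<in> borel_measurable borel"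
    unfolding k_def \<kappa>0_def[abs_def] using positive_flux_measurable flux_measurable times(1) by auto
  have kC: "\<bar>k t\<bar> \<le> C" and \<kappa>0C: "\<bar>\<kappa>0 t\<bar> \<le> C" and k0: "0 \<le> k t" for t
    using C[of t] C0 by (auto simp: k_def \<kappa>0_def positive_flux_def)
  have bc: "continuous_on UNIV (b i)" for i
    by (rule mollifierD(5)[OF b])
  have b0: "0 \<le> b 0 x" for x
    by (rule mollifierD(2)[OF b])
  have pc: "continuous_on {s0..t0} p"
    by (rule p_cont_subset[OF times(1)])
  have pc': "continuous_on A (\<lambda>z. p (f z))" if "continuous_on A f" "f ` A \<subseteq> {s0..t0}" for A :: "(real \<times> real) set" and f
    using continuous_on_compose2[OF pc that] .
  \<comment> \<open>The weight averaged around the source. If the source lies near or beyond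
    \<open>-L\<close>, part of the kernel is cut off, which can only lower \<open>Q\<close>.\<close>
  define Q where "Q \<tau> = (LINT x:{-L..L}|lborel. \<phi> x * b 0 (x - (p \<tau> - a)))" for \<tau>
  \<comment> \<open>Time average of the gain from the source. It does not involve \<open>g\<close>,
    so one bound serves all integrands of the first conclusion.\<close>
  define Kb where "Kb t = (LINT \<tau>:{s0..t0}|lborel. k \<tau> * (Q \<tau> * b 0 (t - \<tau>)))" for t
  define Kp where "Kp x t = (LINT \<tau>:{s0..t0}|lborel. k \<tau> * (b 0 (x - (p \<tau> - a)) * b 0 (t - \<tau>)))" for x t
  have \<phi>b: "continuous_on S (\<lambda>x. \<phi> x * b 0 (x - z))" for S z
    by (intro continuous_intros continuous_on_comp_UNIV[OF bc] continuous_on_subset[OF \<phi>(1)]) auto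
  have Q_HK: "Q \<tau> = integral {-L..L} (\<lambda>x. \<phi> x * b 0 (x - (p \<tau> - a)))" for \<tau>
    unfolding Q_def by (intro set_borel_integral_eq_integral(2))
      (unfold set_integrable_def, intro borel_integrable_compact compact_Icc \<phi>b)
  have Q0: "0 \<le> Q \<tau>" for \<tau>
    unfolding Q_HK by (intro integral_nonneg integrable_continuous_interval \<phi>b) (simp add: \<phi>(2) b0)
  have Q_upper: "Q \<tau> \<le> \<phi> (p \<tau> - a) + N * \<epsilon>" if "\<tau> \<in> {s0..t0}" for \<tau>
  proof -
    let ?z = "p \<tau> - a"
    have z: "-L - a \<le> ?z" "?z \<le> L"
      using p_bounds[of \<tau>] that times a_pos by auto
    have "N \<ge> 0"
      using \<phi>(4)[of 0 1] p_bounds[of s] times \<epsilon> a_pos by (force simp: abs_le_iff)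
    have bcz: "continuous_on S (\<lambda>x. b 0 (x - ?z))" for S
      by (intro continuous_intros continuous_on_comp_UNIV[OF bc])
    have "Q \<tau> \<le> integral {-L..L} (\<lambda>x. (\<phi> ?z + N * \<epsilon>) * b 0 (x - ?z))"
      unfolding Q_HK
    proof (intro integral_le integrable_continuous_interval \<phi>b continuous_on_mult continuous_on_const bcz)
      fix x assume x: "x \<in> {-L..L}"
      show "\<phi> x * b 0 (x - ?z) \<le> (\<phi> ?z + N * \<epsilon>) * b 0 (x - ?z)"
      proof (cases "\<bar>x - ?z\<bar> \<le> \<epsilon>")
        case True
        have "\<bar>\<phi> x - \<phi> ?z\<bar> \<le> N * \<bar>x - ?z\<bar>"
          using x z a_pos by (intro \<phi>(4)) auto
        also have "\<dots> \<le> N * \<epsilon>"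
          using True \<open>N \<ge> 0\<close> by (rule mult_left_mono)
        finally show ?thesis
          by (intro mult_right_mono b0) auto
      next
        case False
        then have "b 0 (x - ?z) = 0"
          by (intro mollifierD(3)[OF b]) auto
        then show ?thesis by (simp only: mult_zero_right)
      qed
    qed
    also have "\<dots> = (\<phi> ?z + N * \<epsilon>) * integral {-L..L} (\<lambda>x. b 0 (x - ?z))"
      by (rule integral_mult_right)
    also have "\<dots> \<le> (\<phi> ?z + N * \<epsilon>) * 1"
      using \<phi>(2)[of ?z] z \<open>N \<ge> 0\<close> \<epsilon> by (intro mult_left_mono mollifier_integral_le[OF b]) auto
    finally show ?thesis by simp
  qed
  have cont_xt: "continuous_on {s0..t0} (\<lambda>\<tau>. b 0 (x - (p \<tau> + c)) * b 0 (t - \<tau>))" for x t c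
    by (intro continuous_intros continuous_on_comp_UNIV[OF bc] pc)
  have K_upper: "smear u (s0, -L) (t0, L) (b 0) (b 1) x t - smear u (s0, -L) (t0, L) (b 2) (b 0) x t \<le> Kp x t"
    if t: "t \<in> {s..T}" and x: "x \<in> {lo..p t}" for x t
  proof -
    have "smear u (s0, -L) (t0, L) (b 0) (b 1) x t - smear u (s0, -L) (t0, L) (b 2) (b 0) x t =
      (LINT \<tau>:{s0..t0}|lborel. \<kappa> \<tau> * (b 0 (x - (p \<tau> - a)) * b 0 (t - \<tau>) - b 0 (x - (p \<tau> + a)) * b 0 (t - \<tau>)))"
      by (rule smear_equation[OF b \<epsilon>(1) _ _ times(1)]) (use x lo hi[OF t] t times in auto)
    also have "\<dots> = (LINT \<tau>:{s0..t0}|lborel. \<kappa>0 \<tau> * (b 0 (x - (p \<tau> - a)) * b 0 (t - \<tau>) - b 0 (x - (p \<tau> + a)) * b 0 (t - \<tau>)))"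
      by (intro set_lebesgue_integral_cong) (auto simp: \<kappa>0_def)
    also have "\<dots> \<le> Kp x t"
      unfolding Kp_def
    proof (intro set_integral_mono set_integrable_weight[OF \<kappa>0_meas \<kappa>0C] set_integrable_weight[OF k_meas kC])
      show "continuous_on {s0..t0} (\<lambda>\<tau>. b 0 (x - (p \<tau> - a)) * b 0 (t - \<tau>) - b 0 (x - (p \<tau> + a)) * b 0 (t - \<tau>))"
        using continuous_on_diff[OF cont_xt[of x "-a" t] cont_xt[of x a t]] by simp
      show "continuous_on {s0..t0} (\<lambda>\<tau>. b 0 (x - (p \<tau> - a)) * b 0 (t - \<tau>))"
        using cont_xt[of x "-a" t] by simp
      fix \<tau> assume \<tau>: "\<tau> \<in> {s0..t0}"
      show "\<kappa>0 \<tau> * (b 0 (x - (p \<tau> - a)) * b 0 (t - \<tau>) - b 0 (x - (p \<tau> + a)) * b 0 (t - \<tau>))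
          \<le> k \<tau> * (b 0 (x - (p \<tau> - a)) * b 0 (t - \<tau>))"
      proof (cases "\<bar>\<tau> - t\<bar> \<le> \<epsilon>")
        case True
        have "x - (p \<tau> + a) \<le> - \<epsilon>"
          using abs_le_D2[OF modulus[OF t \<tau> True]] x \<epsilon>(2) by simp
        then have "b 0 (x - (p \<tau> + a)) = 0"
          by (intro mollifierD(3)[OF b]) auto
        then have "\<kappa>0 \<tau> * (b 0 (x - (p \<tau> - a)) * b 0 (t - \<tau>) - b 0 (x - (p \<tau> + a)) * b 0 (t - \<tau>))
            = \<kappa>0 \<tau> * (b 0 (x - (p \<tau> - a)) * b 0 (t - \<tau>))"
          by (simp only: mult_zero_left diff_zero)
        also have "\<dots> \<le> k \<tau> * (b 0 (x - (p \<tau> - a)) * b 0 (t - \<tau>))"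
          using \<tau> by (intro mult_right_mono mult_nonneg_nonneg b0) (auto simp: k_def \<kappa>0_def positive_flux_def)
        finally show ?thesis .
      next
        case False
        then have "b 0 (t - \<tau>) = 0"
          by (intro mollifierD(3)[OF b]) auto
        then show ?thesis by (simp only: mult_zero_right diff_zero order_refl)
      qed
    qed
    finally show ?thesis .
  qed
  have Kp0: "0 \<le> Kp x t" for x t
    unfolding Kp_def set_lebesgue_integral_def
    by (intro Bochner_Integration.integral_nonneg) (simp add: k0 b0)
  have cont2: "continuous_on ({-L..L} \<times> {s0..t0}) (\<lambda>(x, \<tau>). \<phi> x * b 0 (x - (p \<tau> - a)) * b 0 (t - \<tau>))" for t
    unfolding case_prod_beta
    by (intro continuous_intros continuous_on_comp_UNIV[OF bc] continuous_on_comp_UNIV[OF \<phi>(1)] pc') auto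
  have \<phi>Kp: "(LINT \<tau>:{s0..t0}|lborel. k \<tau> * (\<phi> x * b 0 (x - (p \<tau> - a)) * b 0 (t - \<tau>))) = \<phi> x * Kp x t" for x t
    unfolding Kp_def set_integral_mult_right[symmetric] by (simp add: mult_ac)
  have int_Kp: "set_integrable lborel {-L..L} (\<lambda>x. \<phi> x * Kp x t)" for t
    using fubini_weight(1)[OF k_meas kC cont2] by (simp only: \<phi>Kp)
  have "integral {-L..L} (\<lambda>x. \<phi> x * Kp x t) = Kb t" for t
  proof -
    have "integral {-L..L} (\<lambda>x. \<phi> x * Kp x t) = (LINT x:{-L..L}|lborel. \<phi> x * Kp x t)"
      using set_borel_integral_eq_integral(2)[OF int_Kp] by simp
    also have "\<dots> = (LINT \<tau>:{s0..t0}|lborel. k \<tau> * (LINT x:{-L..L}|lborel. \<phi> x * b 0 (x - (p \<tau> - a)) * b 0 (t - \<tau>)))"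
      using fubini_weight(2)[OF k_meas kC cont2] by (simp only: \<phi>Kp)
    finally show ?thesis
      by (simp only: set_integral_mult_left Q_def Kb_def)
  qed
  note Kb_eq = this
  show ?thesis
  proof (rule that[of Kb])
    fix t and g :: "real \<Rightarrow> real"
    assume t: "t \<in> {s..T}" and gc: "continuous_on UNIV g" and g: "\<And>x. x \<le> L \<Longrightarrow> 0 \<le> g x \<and> g x \<le> \<phi> x"
    let ?K = "\<lambda>x. smear u (s0, -L) (t0, L) (b 0) (b 1) x t - smear u (s0, -L) (t0, L) (b 2) (b 0) x t"
    have sub: "{lo..p t} \<subseteq> {-L..L}"
      using lo hi[OF t] \<epsilon> by auto
    have smear_x: "continuous_on S (\<lambda>x. smear u (s0, -L) (t0, L) (b i) (b l) x t)" for i l S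
      using continuous_on_compose2[OF smear_continuous[OF u_cont_box[OF times(1)] bc bc, of UNIV], of S "\<lambda>x. (x, t)"]
        continuous_on_Pair[OF continuous_on_id continuous_on_const, of S t]
      by simp
    have Kp_int: "(\<lambda>x. \<phi> x * Kp x t) integrable_on {-L..L}"
      by (rule set_borel_integral_eq_integral(1)[OF int_Kp])
    then have Kp_int': "(\<lambda>x. \<phi> x * Kp x t) integrable_on {lo..p t}"
      by (rule integrable_on_subinterval[OF _ sub])
    have "integral {lo..p t} (\<lambda>x. g x * ?K x) \<le> integral {lo..p t} (\<lambda>x. \<phi> x * Kp x t)"
    proof (intro integral_le Kp_int')
      show "(\<lambda>x. g x * ?K x) integrable_on {lo..p t}"
        by (intro integrable_continuous_interval continuous_intros smear_x continuous_on_subset[OF gc]) auto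
      fix x assume x: "x \<in> {lo..p t}"
      then have xL: "x \<le> L" using sub by auto
      \<comment> \<open>First \<open>?K\<close> is replaced by its nonnegative majorant
        \<open>Kp\<close>, and only then \<open>g\<close> by \<open>\<phi>\<close>:
        \<open>?K\<close> itself has no sign.\<close>
      have "g x * ?K x \<le> g x * Kp x t"
        using K_upper[OF t x] g[OF xL] by (intro mult_left_mono) auto
      also have "\<dots> \<le> \<phi> x * Kp x t"
        using g[OF xL] Kp0 by (intro mult_right_mono) auto
      finally show "g x * ?K x \<le> \<phi> x * Kp x t" .
    qed
    also have "\<dots> \<le> integral {-L..L} (\<lambda>x. \<phi> x * Kp x t)"
      by (intro integral_subset_le sub Kp_int Kp_int') (simp add: \<phi>(2) Kp0)
    finally show "integral {lo..p t} (\<lambda>x. g x * ?K x) \<le> Kb t"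
      by (simp only: Kb_eq)
  next
    have Q_cont: "continuous_on {s0..t0} Q"
    proof -
      have "continuous_on {s0..t0} (\<lambda>\<tau>. integral (cbox (-L) L) (\<lambda>x. \<phi> x * b 0 (x - (p \<tau> - a))))"
        by (rule integral_continuous_on_param, unfold case_prod_beta)
          (intro continuous_intros continuous_on_comp_UNIV[OF bc] continuous_on_comp_UNIV[OF \<phi>(1)] pc', auto)
      then show ?thesis by (simp add: Q_HK[abs_def])
    qed
    have cont3: "continuous_on ({s..T} \<times> {s0..t0}) (\<lambda>(t, \<tau>). Q \<tau> * b 0 (t - \<tau>))"
      unfolding case_prod_beta
      by (intro continuous_intros continuous_on_comp_UNIV[OF bc] continuous_on_compose2[OF Q_cont]) auto
    have Kb_int: "set_integrable lborel {s..T} Kb"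
      unfolding Kb_def using fubini_weight(1)[OF k_meas kC cont3] .
    then show "Kb integrable_on {s..T}"
      by (rule set_borel_integral_eq_integral(1))
    \<comment> \<open>The share of the time kernel at \<open>\<tau>\<close> that falls into
      \<open>{s..T}\<close>: between 0 and 1, and 0 as soon as \<open>\<tau>\<close> is more than
      \<open>\<epsilon>\<close> outside.\<close>
    define \<beta> where "\<beta> \<tau> = integral {s..T} (\<lambda>t. b 0 (t - \<tau>))" for \<tau>
    have b_shift: "continuous_on S (\<lambda>t. b 0 (t - \<tau>))" for S \<tau>
      by (intro continuous_intros continuous_on_comp_UNIV[OF bc])
    have \<beta>_LINT: "(LINT t:{s..T}|lborel. b 0 (t - \<tau>)) = \<beta> \<tau>" for \<tau>
      unfolding \<beta>_def by (intro set_borel_integral_eq_integral(2))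
        (unfold set_integrable_def, intro borel_integrable_compact compact_Icc b_shift)
    have \<beta>1: "0 \<le> \<beta> \<tau>" "\<beta> \<tau> \<le> 1" for \<tau>
      unfolding \<beta>_def using \<epsilon>
      by (auto intro!: mollifier_integral_le[OF b] integral_nonneg integrable_continuous_interval b_shift simp: b0)
    have \<beta>0: "\<beta> \<tau> = 0" if "\<tau> \<notin> {s-\<epsilon>..T+\<epsilon>}" for \<tau>
    proof -
      have "integral {s..T} (\<lambda>t. b 0 (t - \<tau>)) = integral {s..T} (\<lambda>t. 0)"
        by (intro integral_cong mollifierD(3)[OF b]) (use that in auto)
      then show ?thesis by (simp add: \<beta>_def)
    qed
    \<comment> \<open>The first two terms pay for the end strips of length \<open>\<epsilon>\<close>
      into which the kernel spills over, with flux at most \<open>C\<close> and weight at most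
      \<open>B\<close>; the last one pays for evaluating the weight at the source instead of
      averaging it.\<close>
    define E where "E \<tau> = C * B * indicator {s-\<epsilon>..s} \<tau> + C * B * indicator {T..T+\<epsilon>} \<tau> + C * N * \<epsilon>" for \<tau> :: real
    have k_sT: "k \<tau> = positive_flux s T \<tau>" if "\<tau> \<in> {s..T}" for \<tau>
      using that times \<epsilon> by (auto simp: k_def positive_flux_def)
    have pf_int: "set_integrable lborel {s..T} (\<lambda>\<tau>. positive_flux s T \<tau> * \<phi> (p \<tau> - a))"
    proof (rule set_integrable_weight)
      show "positive_flux s T \<in> borel_measurable borel"
        using times \<epsilon> by (intro positive_flux_measurable) auto
      show "\<bar>positive_flux s T \<tau>\<bar> \<le> C" for \<tau>
        using k_sT[of \<tau>] kC[of \<tau>] C0 by (cases "\<tau> \<in> {s..T}") (auto simp: positive_flux_def)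
      show "continuous_on {s..T} (\<lambda>\<tau>. \<phi> (p \<tau> - a))"
        by (intro continuous_on_comp_UNIV[OF \<phi>(1)] continuous_intros p_cont_subset) (use times \<epsilon> in auto)
    qed
    have ind_int: "integrable lborel (\<lambda>\<tau>. indicator {x..y} \<tau> * (c::real))" for x y :: real and c
      using borel_integrable_compact[of "{x..y}" "\<lambda>_. c"] by simp
    have E_int: "set_integrable lborel {s0..t0} E"
    proof -
      have "integrable lborel (\<lambda>\<tau>. indicator {s-\<epsilon>..s} \<tau> * (C * B) + indicator {T..T+\<epsilon>} \<tau> * (C * B) + indicator {s0..t0} \<tau> * (C * N * \<epsilon>))"
        by (intro Bochner_Integration.integrable_add ind_int)
      also have "(\<lambda>\<tau>. indicator {s-\<epsilon>..s} \<tau> * (C * B) + indicator {T..T+\<epsilon>} \<tau> * (C * B) + indicator {s0..t0} \<tau> * (C * N * \<epsilon>))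
         = (\<lambda>\<tau>. indicator {s0..t0} \<tau> *\<^sub>R E \<tau>)"
        using times \<epsilon> by (auto simp: E_def indicator_def fun_eq_iff)
      finally show ?thesis by (simp add: set_integrable_def)
    qed
    have E_val: "(LINT \<tau>:{s0..t0}|lborel. E \<tau>) = (2 * C * B + C * N * (t0 - s0)) * \<epsilon>"
    proof -
      have "(LINT \<tau>:{s0..t0}|lborel. E \<tau>) = (LINT \<tau>|lborel. indicator {s-\<epsilon>..s} \<tau> * (C * B) + indicator {T..T+\<epsilon>} \<tau> * (C * B) + indicator {s0..t0} \<tau> * (C * N * \<epsilon>))"
        unfolding set_lebesgue_integral_def using times \<epsilon>
        by (intro Bochner_Integration.integral_cong) (auto simp: E_def indicator_def)
      also have "\<dots> = (2 * C * B + C * N * (t0 - s0)) * \<epsilon>"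
        using times \<epsilon> by (simp add: ind_int algebra_simps)
      finally show ?thesis .
    qed
    let ?pf = "\<lambda>\<tau>. indicator {s..T} \<tau> * (positive_flux s T \<tau> * \<phi> (p \<tau> - a))"
    have pf_int0: "set_integrable lborel {s0..t0} ?pf"
    proof -
      have "(\<lambda>\<tau>. indicator {s0..t0} \<tau> *\<^sub>R ?pf \<tau>) = (\<lambda>\<tau>. indicator {s..T} \<tau> *\<^sub>R (positive_flux s T \<tau> * \<phi> (p \<tau> - a)))"
        using times \<epsilon> by (auto simp: indicator_def fun_eq_iff)
      then show ?thesis using pf_int by (simp add: set_integrable_def)
    qed
    have pf_val: "(LINT \<tau>:{s0..t0}|lborel. ?pf \<tau>) = integral {s..T} (\<lambda>\<tau>. positive_flux s T \<tau> * \<phi> (p \<tau> - a))"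
    proof -
      have "(LINT \<tau>:{s0..t0}|lborel. ?pf \<tau>) = (LINT \<tau>:{s..T}|lborel. positive_flux s T \<tau> * \<phi> (p \<tau> - a))"
        unfolding set_lebesgue_integral_def using times \<epsilon>
        by (intro Bochner_Integration.integral_cong) (auto simp: indicator_def)
      then show ?thesis using set_borel_integral_eq_integral(2)[OF pf_int] by simp
    qed
    have "integral {s..T} Kb = (LINT t:{s..T}|lborel. Kb t)"
      using set_borel_integral_eq_integral(2)[OF Kb_int] by simp
    also have "\<dots> = (LINT \<tau>:{s0..t0}|lborel. k \<tau> * (LINT t:{s..T}|lborel. Q \<tau> * b 0 (t - \<tau>)))"
      unfolding Kb_def by (rule fubini_weight(2)[OF k_meas kC cont3])
    also have "\<dots> = (LINT \<tau>:{s0..t0}|lborel. k \<tau> * (Q \<tau> * \<beta> \<tau>))"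
      by (simp only: set_integral_mult_right \<beta>_LINT)
    also have "\<dots> \<le> (LINT \<tau>:{s0..t0}|lborel. ?pf \<tau> + E \<tau>)"
    proof (intro set_integral_mono set_integral_add(1) pf_int0 E_int set_integrable_weight[OF k_meas kC])
      have "continuous_on {s0..t0} (\<lambda>\<tau>. integral (cbox s T) (\<lambda>t. b 0 (t - \<tau>)))"
        by (rule integral_continuous_on_param, unfold case_prod_beta)
          (intro continuous_intros continuous_on_comp_UNIV[OF bc])
      then have "continuous_on {s0..t0} \<beta>" by (simp add: \<beta>_def[abs_def])
      then show "continuous_on {s0..t0} (\<lambda>\<tau>. Q \<tau> * \<beta> \<tau>)"
        by (intro continuous_on_mult Q_cont)
      fix \<tau> assume \<tau>: "\<tau> \<in> {s0..t0}"
      have N0: "0 \<le> N"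
        using \<phi>(4)[of 0 1] p_bounds[of s] times \<epsilon> a_pos by (force simp: abs_le_iff)
      show "k \<tau> * (Q \<tau> * \<beta> \<tau>) \<le> ?pf \<tau> + E \<tau>"
      proof (cases "\<tau> \<in> {s-\<epsilon>..T+\<epsilon>}")
        case True
        have "Q \<tau> * \<beta> \<tau> \<le> (\<phi> (p \<tau> - a) + N * \<epsilon>) * 1"
          using Q_upper[OF \<tau>] Q0 \<beta>1 by (intro mult_mono) (auto intro: order_trans)
        then have "k \<tau> * (Q \<tau> * \<beta> \<tau>) \<le> k \<tau> * (\<phi> (p \<tau> - a) + N * \<epsilon>)"
          using k0 by (simp add: mult_left_mono)
        also have "\<dots> = k \<tau> * \<phi> (p \<tau> - a) + k \<tau> * (N * \<epsilon>)"
          by (rule distrib_left)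
        also have "k \<tau> * (N * \<epsilon>) \<le> C * (N * \<epsilon>)"
          using kC[of \<tau>] N0 \<epsilon> by (intro mult_right_mono) auto
        also have "k \<tau> * \<phi> (p \<tau> - a) + C * (N * \<epsilon>) \<le> ?pf \<tau> + E \<tau>"
        proof (cases "\<tau> \<in> {s..T}")
          case True
          then show ?thesis
            using C0 B0 k_sT[OF True] by (simp add: E_def mult.assoc)
        next
          case False
          have "k \<tau> * \<phi> (p \<tau> - a) \<le> C * B"
            using kC[of \<tau>] k0 \<phi>(2)[of "p \<tau> - a"] \<phi>(3)[of "p \<tau> - a"] p_bounds[of \<tau>] \<tau> times a_pos C0 by (intro mult_mono) auto
          moreover have "\<tau> \<in> {s-\<epsilon>..s} \<or> \<tau> \<in> {T..T+\<epsilon>}"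
            using True False by auto
          then have "C * B \<le> C * B * indicator {s-\<epsilon>..s} \<tau> + C * B * indicator {T..T+\<epsilon>} \<tau>"
            using C0 B0 by (auto simp: indicator_def)
          ultimately show ?thesis
            using False by (simp add: E_def mult.assoc)
        qed
        finally show ?thesis by simp
      next
        case False
        then show ?thesis
          using \<beta>0[OF False] C0 B0 N0 \<epsilon> k0 \<phi>(2) by (auto simp: E_def positive_flux_nonneg)
      qed
    qed
    also have "\<dots> = (LINT \<tau>:{s0..t0}|lborel. ?pf \<tau>) + (LINT \<tau>:{s0..t0}|lborel. E \<tau>)"
      by (rule set_integral_add(2)[OF pf_int0 E_int])
    finally show "integral {s..T} Kb \<le> integral {s..T} (\<lambda>t. positive_flux s T t * \<phi> (p t - a)) + (2 * C * B + C * N * (t0 - s0)) * \<epsilon>"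
      by (simp only: pf_val E_val)
  qed
qed

end

section \<open>The inequality for a smooth convex function of the solution\<close>

lemma integral_diff_bound:
  fixes f g :: "real \<Rightarrow> real"
  assumes "continuous_on {x..y} f" "continuous_on {x..y} g" "x \<le> y" "\<And>z. z \<in> {x..y} \<Longrightarrow> \<bar>f z - g z\<bar> \<le> c"
  shows "\<bar>integral {x..y} f - integral {x..y} g\<bar> \<le> c * (y - x)"
proof -
  have "integral {x..y} f - integral {x..y} g = integral {x..y} (\<lambda>z. f z - g z)"
    using assms by (intro Henstock_Kurzweil_Integration.integral_diff[symmetric] integrable_continuous_interval)
  moreover have "norm (integral {x..y} (\<lambda>z. f z - g z)) \<le> c * (y - x)"
    using assms by (intro integral_bound continuous_on_diff) auto
  ultimately show ?thesis by simp
qed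

lemma bounded_on_Icc:
  fixes f :: "real \<Rightarrow> real"
  assumes "continuous_on {x..y} f"
  obtains B where "0 \<le> B" "\<And>z. z \<in> {x..y} \<Longrightarrow> \<bar>f z\<bar> \<le> B"
proof -
  obtain B where "\<forall>v\<in>f ` {x..y}. norm v \<le> B"
    using compact_imp_bounded[OF compact_continuous_image[OF assms compact_Icc]] unfolding bounded_iff by blast
  then show ?thesis by (intro that[of "max 0 B"]) (auto intro: max.coboundedI2)
qed

lemma le_if_le_plus_small:
  fixes X Y K :: real
  assumes "0 < e0" "\<And>e. 0 < e \<Longrightarrow> e \<le> e0 \<Longrightarrow> X \<le> Y + K * e"
  shows "X \<le> Y"
proof (rule tendsto_lowerbound)
  have "((\<lambda>e. Y + K * e) \<longlongrightarrow> Y + K * 0) (at_right 0)"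
    by (intro tendsto_intros)
  then show "((\<lambda>e. Y + K * e) \<longlongrightarrow> Y) (at_right 0)" by simp
  show "\<forall>\<^sub>F e in at_right 0. X \<le> Y + K * e"
    using eventually_at_right_less[of "0::real"] eventually_at_right_field[of _ "0::real"] assms
    by (metis (mono_tags, lifting) less_eq_real_def)
qed simp

lemma lipschitz_bound_if_deriv_bound:
  fixes f f' :: "real \<Rightarrow> real"
  assumes d: "\<And>x. (f has_real_derivative f' x) (at x)" and B: "\<And>x. x \<in> {lo..hi} \<Longrightarrow> \<bar>f' x\<bar> \<le> B"
    and "x \<in> {lo..hi}" "y \<in> {lo..hi}"
  shows "\<bar>f x - f y\<bar> \<le> B * \<bar>x - y\<bar>"
  using field_differentiable_bound[of "{lo..hi}" f f' B x y] assms
  by (auto intro: has_field_derivative_at_within simp: abs_minus_commute)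

context weak_solution
begin

lemma uniform_modulus:
  assumes "0 < s0" "0 < e"
  obtains \<epsilon> where "0 < \<epsilon>"
    "\<And>x t y \<tau>. x \<in> {-L..L} \<Longrightarrow> y \<in> {-L..L} \<Longrightarrow> t \<in> {s0..t0} \<Longrightarrow> \<tau> \<in> {s0..t0} \<Longrightarrow>
      \<bar>y - x\<bar> \<le> \<epsilon> \<Longrightarrow> \<bar>\<tau> - t\<bar> \<le> \<epsilon> \<Longrightarrow> \<bar>u y \<tau> - u x t\<bar> \<le> e"
    "\<And>t \<tau>. t \<in> {s0..t0} \<Longrightarrow> \<tau> \<in> {s0..t0} \<Longrightarrow> \<bar>\<tau> - t\<bar> \<le> \<epsilon> \<Longrightarrow> \<bar>p \<tau> - p t\<bar> \<le> a / 2"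
proof -
  have "continuous_on ({-L..L} \<times> {s0..t0}) (\<lambda>(x, t). u x t)"
    using u_cont by (rule continuous_on_subset) (use assms in auto)
  then have "uniformly_continuous_on ({-L..L} \<times> {s0..t0}) (\<lambda>(x, t). u x t)"
    by (intro compact_uniformly_continuous compact_Times compact_Icc)
  then obtain d1 where d1: "d1 > 0" "\<And>z z'. z \<in> {-L..L} \<times> {s0..t0} \<Longrightarrow> z' \<in> {-L..L} \<times> {s0..t0} \<Longrightarrow>
      dist z' z < d1 \<Longrightarrow> dist (case z' of (x, t) \<Rightarrow> u x t) (case z of (x, t) \<Rightarrow> u x t) < e"
    using \<open>0 < e\<close> unfolding uniformly_continuous_on_def by metis
  have "uniformly_continuous_on {s0..t0} p"
    by (intro compact_uniformly_continuous p_cont_subset compact_Icc assms)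
  moreover have "0 < a / 2" using a_pos by simp
  ultimately obtain d2 where d2: "d2 > 0" "\<And>t \<tau>. t \<in> {s0..t0} \<Longrightarrow> \<tau> \<in> {s0..t0} \<Longrightarrow> dist \<tau> t < d2 \<Longrightarrow> dist (p \<tau>) (p t) < a / 2"
    unfolding uniformly_continuous_on_def by metis
  show ?thesis
  \<comment> \<open>A third, because two displacements of this size must still add up to strictly
    less than \<open>d1\<close>.\<close>
  proof (rule that[of "min d1 d2 / 3"])
    show "0 < min d1 d2 / 3" using d1 d2 by simp
    fix x t y \<tau>
    assume *: "x \<in> {-L..L}" "y \<in> {-L..L}" "t \<in> {s0..t0}" "\<tau> \<in> {s0..t0}" "\<bar>y - x\<bar> \<le> min d1 d2 / 3" "\<bar>\<tau> - t\<bar> \<le> min d1 d2 / 3"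
    have "dist (y, \<tau>) (x, t) \<le> \<bar>y - x\<bar> + \<bar>\<tau> - t\<bar>"
      by (simp add: dist_Pair_Pair dist_real_def sqrt_sum_squares_le_sum_abs)
    also have "\<dots> < d1" using * d1(1) d2(1) by (auto simp: min_def split: if_splits)
    finally show "\<bar>u y \<tau> - u x t\<bar> \<le> e"
      using d1(2)[of "(x, t)" "(y, \<tau>)"] * by (simp add: dist_real_def)
  next
    fix t \<tau> assume *: "t \<in> {s0..t0}" "\<tau> \<in> {s0..t0}" "\<bar>\<tau> - t\<bar> \<le> min d1 d2 / 3"
    then have "dist \<tau> t < d2"
      using d1(1) d2(1) by (auto simp: dist_real_def min_def split: if_splits)
    then show "\<bar>p \<tau> - p t\<bar> \<le> a / 2"
      using d2(2)[of t \<tau>] * by (simp add: dist_real_def)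
  qed
qed

lemma u_slab_continuous:
  fixes g f :: "real \<Rightarrow> real"
  assumes "0 < s" "-L \<le> lo" "continuous_on UNIV g" "continuous_on UNIV f"
  shows "continuous_on ({lo..L} \<times> {s..T}) (\<lambda>(x, t). g x * f (u x t))"
proof -
  have "continuous_on ({lo..L} \<times> {s..T}) (\<lambda>(x, t). u x t)"
    using u_cont by (rule continuous_on_subset) (use assms in auto)
  then show ?thesis
    unfolding case_prod_beta
    by (intro continuous_on_mult continuous_on_comp_UNIV[OF assms(3)] continuous_on_comp_UNIV[OF assms(4)]
        continuous_intros)
qed

lemma u_slice_continuous:
  fixes g f :: "real \<Rightarrow> real"
  assumes "0 < t" "-L \<le> lo" "hi \<le> L" "continuous_on UNIV g" "continuous_on UNIV f"
  shows "continuous_on {lo..hi} (\<lambda>x. g x * f (u x t))"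
proof -
  have "continuous_on {lo..hi} (\<lambda>x. (x, t))"
    by (intro continuous_intros)
  moreover have "(\<lambda>x. (x, t)) ` {lo..hi} \<subseteq> {-L..L} \<times> {0<..}"
    using assms by auto
  ultimately have "continuous_on {lo..hi} (\<lambda>x. u x t)"
    using continuous_on_compose2[OF u_cont] by fastforce
  then show ?thesis
    by (intro continuous_on_mult continuous_on_comp_UNIV[OF assms(5)] continuous_on_subset[OF assms(4)]) auto
qed

text \<open>The right-hand side of \<open>dissipation_estimate\<close> with the positive flux as
  \<open>\<mu>\<close>, written for \<open>u\<close> itself instead of its mollification.
  \<open>h\<close> is the width of the window to the left of \<open>p\<close> on which the
  dissipation is kept.\<close>

definition kato_rate where
  "kato_rate lo s T h \<phi> \<phi>1 \<phi>2 j j1 j2 t =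
    integral {lo..p t} (\<lambda>x. \<phi>2 x * j (u x t))
    - positive_flux s T t * (2 * (\<phi> (p t - h) * j1 (u (p t - h) t)) + 2 * integral {p t - h..p t} (\<lambda>x. \<phi>1 x * j1 (u x t)))
    + (positive_flux s T t)\<^sup>2 * integral {p t - h..p t} (\<lambda>x. \<phi> x * j2 (u x t))"

lemma positive_flux_weight_integrable:
  assumes "0 < s" "s < T" "continuous_on {s..T} g"
  shows "(\<lambda>t. positive_flux s T t * g t) integrable_on {s..T}"
    "(\<lambda>t. (positive_flux s T t)\<^sup>2 * g t) integrable_on {s..T}"
proof -
  obtain C where C: "\<forall>t\<in>{s..T}. C-lipschitz_on {-L..L} (\<lambda>x. u x t)"
    using u_lip[OF assms(1,2)] by blast
  have "0 \<le> C" using C assms lipschitz_on_nonneg by fastforce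
  have m: "positive_flux s T \<in> borel_measurable borel" "\<And>t. \<bar>positive_flux s T t\<bar> \<le> C"
    using positive_flux_measurable positive_flux_bound[OF _ C \<open>0 \<le> C\<close>] assms by auto
  show "(\<lambda>t. positive_flux s T t * g t) integrable_on {s..T}"
    by (rule set_borel_integral_eq_integral(1)[OF set_integrable_weight[OF m assms(3)]])
  have "\<bar>(positive_flux s T t)\<^sup>2\<bar> \<le> C\<^sup>2" for t
    using power_mono[OF m(2)[of t], of 2] by (simp add: power2_abs)
  then show "(\<lambda>t. (positive_flux s T t)\<^sup>2 * g t) integrable_on {s..T}"
    using m(1) by (intro set_borel_integral_eq_integral(1)[OF set_integrable_weight[OF _ _ assms(3)]]) auto
qed

lemma kato_rate_integrable:
  assumes times: "0 < s" "s < T" and lo: "-L < lo"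
    and d: "\<And>t. t \<in> {s..T} \<Longrightarrow> lo + d \<le> p t" and h: "0 \<le> h" "h < d"
    and \<phi>: "continuous_on UNIV \<phi>" "continuous_on UNIV \<phi>1" "continuous_on UNIV \<phi>2"
    and j: "continuous_on UNIV j" "continuous_on UNIV j1" "continuous_on UNIV j2"
  shows "kato_rate lo s T h \<phi> \<phi>1 \<phi>2 j j1 j2 integrable_on {s..T}"
proof -
  have pc: "continuous_on {s..T} p" by (rule p_cont_subset[OF times(1)])
  have pL: "p t \<le> L" if "t \<in> {s..T}" for t
    using p_bounds[of t] times that by auto
  have tail: "continuous_on {s..T} (\<lambda>t. integral {p t - h..p t} (\<lambda>x. g x * f (u x t)))"
    if "continuous_on UNIV g" "continuous_on UNIV f" for g f :: "real \<Rightarrow> real"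
  proof -
    \<comment> \<open>\<open>continuous_on_moving_integral\<close> allows only one moving endpoint,
      hence the window integral is written as a difference.\<close>
    have "continuous_on {s..T} (\<lambda>t. integral {lo..p t} (\<lambda>x. g x * f (u x t)) - integral {lo..p t - h} (\<lambda>x. g x * f (u x t)))"
    proof (rule continuous_on_diff)
      have slab: "continuous_on ({lo..L} \<times> {s..T}) (\<lambda>(x, t). g x * f (u x t))"
        using lo by (intro u_slab_continuous times that) auto
      show "continuous_on {s..T} (\<lambda>t. integral {lo..p t} (\<lambda>x. g x * f (u x t)))"
        by (rule continuous_on_moving_integral[OF slab pc]) (use d h pL in force)
      show "continuous_on {s..T} (\<lambda>t. integral {lo..p t - h} (\<lambda>x. g x * f (u x t)))"
        by (rule continuous_on_moving_integral[OF slab]) (use d h pL in \<open>force intro!: continuous_intros pc\<close>)+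
    qed
    moreover have "integral {lo..p t} (\<lambda>x. g x * f (u x t)) - integral {lo..p t - h} (\<lambda>x. g x * f (u x t))
        = integral {p t - h..p t} (\<lambda>x. g x * f (u x t))" if t: "t \<in> {s..T}" for t
      using Henstock_Kurzweil_Integration.integral_combine[of lo "p t - h" "p t" "\<lambda>x. g x * f (u x t)"]
        d[OF t] h pL[OF t] lo times t \<open>continuous_on UNIV g\<close> \<open>continuous_on UNIV f\<close>
      by (simp add: integrable_continuous_interval u_slice_continuous)
    ultimately show ?thesis by (rule continuous_on_eq)
  qed
  have point: "continuous_on {s..T} (\<lambda>t. \<phi> (p t - h) * j1 (u (p t - h) t))"
  proof -
    have "continuous_on {s..T} (\<lambda>t. (p t - h, t))"
      by (intro continuous_intros pc)
    moreover have "(\<lambda>t. (p t - h, t)) ` {s..T} \<subseteq> {lo..L} \<times> {s..T}"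
      using d h pL by force
    ultimately show ?thesis
      using continuous_on_compose2[OF u_slab_continuous[OF times(1) _ \<phi>(1) j(2), of lo T]] lo by fastforce
  qed
  have "continuous_on {s..T} (\<lambda>t. integral {lo..p t} (\<lambda>x. \<phi>2 x * j (u x t)))"
    by (rule continuous_on_moving_integral[OF u_slab_continuous[OF times(1) _ \<phi>(3) j(1)] pc])
      (use lo d h pL in force)+
  then show ?thesis
    unfolding kato_rate_def[abs_def]
    by (intro integrable_add integrable_diff integrable_continuous_interval positive_flux_weight_integrable
        times continuous_intros tail point \<phi> j)
qed


text \<open>The moment \<open>A t\<close> of \<open>j\<close> applied to the mollified
  \<open>u\<close> is differentiable in time, because \<open>j\<close> is flat up to
  \<open>\<delta>\<close> and the Lipschitz bound keeps \<open>u\<close> below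
  \<open>\<delta>\<close> near \<open>p\<close>. The mollified equation trades the time derivative
  for diffusion plus source, and each passage from the mollified to the actual \<open>u\<close>
  costs a multiple of \<open>e\<close>.\<close>

lemma kato_convex:
  fixes \<phi> \<phi>1 \<phi>2 j j1 j2 :: "real \<Rightarrow> real"
  assumes times: "0 < s" "s < T" and lo: "-L < lo"
    and d: "\<And>t. t \<in> {s..T} \<Longrightarrow> lo + d \<le> p t" and h: "0 \<le> h" "h < d"
    and \<phi>: "\<And>x. (\<phi> has_real_derivative \<phi>1 x) (at x)" "\<And>x. (\<phi>1 has_real_derivative \<phi>2 x) (at x)"
      "continuous_on UNIV \<phi>2" and \<phi>0: "\<And>x. x \<le> L \<Longrightarrow> 0 \<le> \<phi> x" and \<phi>lo: "\<phi> lo = 0" "\<phi>1 lo = 0"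
    and j: "\<And>x. (j has_real_derivative j1 x) (at x)" "\<And>x. (j1 has_real_derivative j2 x) (at x)"
      "continuous_on UNIV j2" and j1: "\<And>x. 0 \<le> j1 x \<and> j1 x \<le> 1" and j2: "\<And>x. 0 \<le> j2 x"
    and M: "\<And>x y. \<bar>j1 x - j1 y\<bar> \<le> M * \<bar>x - y\<bar>" "\<And>x y. \<bar>j2 x - j2 y\<bar> \<le> M * \<bar>x - y\<bar>"
    and \<delta>: "0 < \<delta>" "\<And>x. x \<le> \<delta> \<Longrightarrow> j x = 0 \<and> j1 x = 0"
  shows "integral {lo..p T} (\<lambda>x. \<phi> x * j (u x T)) - integral {lo..p s} (\<lambda>x. \<phi> x * j (u x s))
    \<le> integral {s..T} (kato_rate lo s T h \<phi> \<phi>1 \<phi>2 j j1 j2) + integral {s..T} (\<lambda>t. positive_flux s T t * \<phi> (p t - a))"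
proof -
  \<comment> \<open>Leaves room in time for the mollification kernel on both sides of
    \<open>{s..T}\<close>.\<close>
  define s0 where "s0 = s / 2"
  define t0 where "t0 = T + 1"
  have st: "0 < s0" "s0 < s" "T < t0" "s0 < t0" using times by (auto simp: s0_def t0_def)
  obtain C where C: "\<forall>t\<in>{s0..t0}. C-lipschitz_on {-L..L} (\<lambda>x. u x t)"
    using u_lip[OF st(1,4)] by blast
  have C0: "0 \<le> C" using C st lipschitz_on_nonneg by fastforce
  have \<kappa>C: "\<bar>\<kappa> t\<bar> \<le> C" if "t \<in> {s0..t0}" for t
    using flux_bound[of t C] C that st by auto
  obtain r where r: "0 < r" "\<And>t. t \<in> {s0..t0} \<Longrightarrow> -L + r < p t \<and> p t < L - r"
    using p_compact_bounds[OF st(1)] by blast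
  have cont: "continuous_on A f" if "\<And>x. (f has_real_derivative f' x) (at x)" for A and f f' :: "real \<Rightarrow> real"
    using that by (meson DERIV_continuous_on has_field_derivative_at_within)
  note \<phi>c = cont[OF \<phi>(1)] cont[OF \<phi>(2)] and jc = cont[OF j(1)] cont[OF j(2)]
  obtain B0 where B0: "0 \<le> B0" "\<And>z. z \<in> {-L-a-1..L+1} \<Longrightarrow> \<bar>\<phi> z\<bar> \<le> B0"
    using bounded_on_Icc[OF \<phi>c(1)] by metis
  obtain B1 where B1: "0 \<le> B1" "\<And>z. z \<in> {-L-a-1..L+1} \<Longrightarrow> \<bar>\<phi>1 z\<bar> \<le> B1"
    using bounded_on_Icc[OF \<phi>c(2)] by metis
  obtain B2 where B2: "0 \<le> B2" "\<And>z. z \<in> {-L-a-1..L+1} \<Longrightarrow> \<bar>\<phi>2 z\<bar> \<le> B2"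
    using bounded_on_Icc[OF continuous_on_subset[OF \<phi>(3)]] by (metis subset_UNIV)
  define B where "B = max B0 (max B1 B2)"
  have B: "0 \<le> B" "\<bar>\<phi> z\<bar> \<le> B" "\<bar>\<phi>1 z\<bar> \<le> B" "\<bar>\<phi>2 z\<bar> \<le> B" if "z \<in> {-L-a-1..L+1}" for z
    using B0(1) B0(2)[OF that] B1(2)[OF that] B2(2)[OF that] unfolding B_def le_max_iff_disj by auto
  have Lpos: "-L < L" using p_bounds[of s] times by auto
  have "0 \<le> B" using B(1)[of 0] Lpos a_pos by auto
  have M0: "0 \<le> M" using M(1)[of 0 1] abs_ge_zero[of "j1 0 - j1 1"] by simp
  have jM: "\<bar>j x - j y\<bar> \<le> \<bar>x - y\<bar>" for x y
    using lipschitz_bound_if_deriv_bound[OF j(1), of "min x y" "max x y" 1 x y] j1 by auto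
  \<comment> \<open>Half-width of the strip around \<open>p\<close> in which \<open>j\<close> must
    vanish: \<open>d\<close> keeps it to the right of \<open>lo\<close>, \<open>r / 2\<close> keeps
    it inside the domain, and the last bound gives \<open>\<bar>u\<bar> \<le> \<delta> / 2\<close>
    there. \<open>C + 1\<close> guards against \<open>C = 0\<close>.\<close>
  define \<rho> where "\<rho> = min d (min (r / 2) (\<delta> / (2 * (C + 1))))"
  have "0 < d" using h by simp
  then have \<rho>: "0 < \<rho>" "\<rho> \<le> d" "\<rho> \<le> r / 2" "C * \<rho> \<le> \<delta> / 2"
  proof -
    have \<rho>_le: "\<rho> \<le> \<delta> / (2 * (C + 1))"
      unfolding \<rho>_def by (intro min.coboundedI2 min.cobounded2)
    show "0 < \<rho>"
      using \<open>0 < d\<close> r(1) \<delta>(1) C0 by (auto simp: \<rho>_def)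
    show "\<rho> \<le> d" "\<rho> \<le> r / 2"
      unfolding \<rho>_def by (intro min.coboundedI2 min.cobounded1)+
    have "C * \<rho> \<le> (C + 1) * (\<delta> / (2 * (C + 1)))"
      using C0 \<open>0 < \<rho>\<close> \<rho>_le by (intro mult_mono) auto
    also have "\<dots> = \<delta> / 2" using C0 by (simp add: field_simps)
    finally show "C * \<rho> \<le> \<delta> / 2" .
  qed
  let ?R = "kato_rate lo s T h \<phi> \<phi>1 \<phi>2 j j1 j2"
  let ?k = "positive_flux s T"
  have k: "0 \<le> ?k t" "?k t \<le> C" for t
    using \<kappa>C[of t] C0 st by (auto simp: positive_flux_def)
  \<comment> \<open>\<open>c1\<close> collects the cost of replacing the mollified \<open>u\<close>
    in the three parts of \<open>kato_rate\<close>, with \<open>2 * L\<close> bounding the length of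
    the domain and \<open>d\<close> that of the window. \<open>K\<close> adds the cost at the times
    \<open>s\<close> and \<open>T\<close> and the error of \<open>source_estimate\<close>.\<close>
  define c1 where "c1 = 2 * L * B + C * (2 * (B * M) + 2 * (B * M * d)) + C\<^sup>2 * (B * M * d)"
  define K where "K = 2 * (2 * L * B) + c1 * (T - s) + (2 * C * B + C * B * (t0 - s0))"
  have R_int: "?R integrable_on {s..T}"
    by (rule kato_rate_integrable[OF times lo d h \<phi>c \<phi>(3) jc j(3)])
  show ?thesis
  proof (rule le_if_le_plus_small)
    show "0 < \<delta> / 2" using \<delta> by simp
    fix e assume e: "0 < e" "e \<le> \<delta> / 2"
    obtain \<epsilon>0 where \<epsilon>0: "0 < \<epsilon>0"
      "\<And>x t y \<tau>. x \<in> {-L..L} \<Longrightarrow> y \<in> {-L..L} \<Longrightarrow> t \<in> {s0..t0} \<Longrightarrow> \<tau> \<in> {s0..t0} \<Longrightarrow>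
        \<bar>y - x\<bar> \<le> \<epsilon>0 \<Longrightarrow> \<bar>\<tau> - t\<bar> \<le> \<epsilon>0 \<Longrightarrow> \<bar>u y \<tau> - u x t\<bar> \<le> e"
      "\<And>t \<tau>. t \<in> {s0..t0} \<Longrightarrow> \<tau> \<in> {s0..t0} \<Longrightarrow> \<bar>\<tau> - t\<bar> \<le> \<epsilon>0 \<Longrightarrow> \<bar>p \<tau> - p t\<bar> \<le> a / 2"
      using uniform_modulus[OF st(1) e(1)] by blast
    \<comment> \<open>\<open>\<epsilon>0\<close> is the modulus of continuity; \<open>r / 2\<close>
      and \<open>(lo + L) / 2\<close> keep the kernel off the walls; \<open>s0\<close> and 1 keep it
      inside \<open>{s0..t0}\<close>; \<open>a / 2\<close> separates the sink from \<open>p\<close>;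
      \<open>e\<close> makes the source error a multiple of \<open>e\<close>.\<close>
    define \<epsilon> where "\<epsilon> = Min {\<epsilon>0, r / 2, s0, 1, a / 2, (lo + L) / 2, e}"
    have \<epsilon>le: "\<epsilon> \<le> z" if "z \<in> {\<epsilon>0, r / 2, s0, 1, a / 2, (lo + L) / 2, e}" for z
      unfolding \<epsilon>_def by (rule Min_le[OF _ that]) simp
    have \<epsilon>: "0 < \<epsilon>" "\<epsilon> \<le> \<epsilon>0" "\<epsilon> \<le> r / 2" "\<epsilon> \<le> s0" "\<epsilon> \<le> 1" "\<epsilon> \<le> a / 2" "\<epsilon> \<le> (lo + L) / 2" "\<epsilon> \<le> e"
    proof -
      show "0 < \<epsilon>"
        using \<epsilon>0(1) r(1) st(1) a_pos lo e(1) unfolding \<epsilon>_def by simp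
    qed (rule \<epsilon>le, blast)+
    obtain b where b: "mollifier \<epsilon> b"
      using mollifier_exists[OF \<epsilon>(1)] .
    have bc: "continuous_on UNIV (b i)" for i
      by (rule mollifierD(5)[OF b])
    note b' = mollifierD(1)[OF b]
    note uc = u_cont_box[OF st(1), of t0]
    define sm where "sm i l = smear u (s0, -L) (t0, L) (b i) (b l)" for i l
    have sm_x: "((\<lambda>x. sm i l x t) has_real_derivative sm (Suc i) l x t) (at x)" for i l x t
      unfolding sm_def by (rule smear_deriv_x[OF uc b' bc bc])
    have sm_t: "((\<lambda>t. sm i l x t) has_real_derivative sm i (Suc l) x t) (at t)" for i l x t
      unfolding sm_def by (rule smear_deriv_t[OF uc b' bc bc])
    have sm_c: "continuous_on S (\<lambda>z. sm i l (fst z) (snd z))" for i l S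
      unfolding sm_def by (rule smear_continuous[OF uc bc bc])
    have sm_cx: "continuous_on S (\<lambda>x. sm i l x t)" for i l S t
      by (rule cont[OF sm_x])
    let ?U = "sm 0 0"
    have close: "\<bar>?U x t - u x t\<bar> \<le> e" if "t \<in> {s..T}" "-L + \<epsilon> \<le> x" "x \<le> L - \<epsilon>" for x t
      unfolding sm_def
    proof (rule smear_approx[OF uc b \<epsilon>(1)])
      show "-L \<le> x - \<epsilon>" "x + \<epsilon> \<le> L" using that by auto
      show times': "s0 \<le> t - \<epsilon>" "t + \<epsilon> \<le> t0" using that \<epsilon> by (auto simp: s0_def t0_def)
      fix y \<tau> assume "\<bar>y - x\<bar> \<le> \<epsilon>" "\<bar>\<tau> - t\<bar> \<le> \<epsilon>"
      then show "\<bar>u y \<tau> - u x t\<bar> \<le> e"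
        using that times' \<epsilon> by (intro \<epsilon>0(2)) auto
    qed
    have pr: "-L + r < p t" "p t < L - r" if "t \<in> {s..T}" for t
      using r(2)[of t] that st by auto
    have closed_strip: "\<bar>?U x t - u x t\<bar> \<le> e" if "t \<in> {s..T}" "x \<in> {lo..p t}" for x t
      using that \<epsilon> pr[OF that(1)] r(1) lo by (intro close) auto
    \<comment> \<open>Half of \<open>\<delta>\<close> is spent on \<open>u\<close>, through the
      Lipschitz bound, and the other half on the mollification error, through
      \<open>e \<le> \<delta> / 2\<close>.\<close>
    have small: "?U x t \<le> \<delta>" if t: "t \<in> {s..T}" and x: "\<bar>x - p t\<bar> \<le> \<rho>" for x t
    proof -
      have "-L + \<epsilon> \<le> x" "x \<le> L - \<epsilon>"
        using abs_le_D1[OF x] abs_le_D2[OF x] pr[OF t] \<rho>(3) \<epsilon>(3) by auto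
      moreover from this have "\<bar>u x t\<bar> \<le> C * \<bar>x - p t\<bar>"
        using t st C \<epsilon>(1) by (intro u_bound_near_p) auto
      moreover have "C * \<bar>x - p t\<bar> \<le> C * \<rho>"
        using x C0 by (rule mult_left_mono)
      ultimately show ?thesis
        using close[OF t, of x] \<rho>(4) e(2) by linarith
    qed
    define A where "A t = integral {lo..p t} (\<lambda>x. \<phi> x * j (?U x t))" for t
    define A' where "A' t = integral {lo..p t} (\<lambda>x. \<phi> x * (j1 (?U x t) * sm 0 1 x t))" for t
    have A_deriv: "(A has_real_derivative A' t) (at t within {s..T})" if t: "t \<in> {s..T}" for t
      unfolding A_def[abs_def] A'_def
    proof (rule moving_domain_derivative[OF _ _ _ p_cont_subset[OF times(1)] t \<rho>(1)])
      show "((\<lambda>t. \<phi> x * j (?U x t)) has_real_derivative \<phi> x * (j1 (?U x t) * sm 0 1 x t)) (at t)" for x t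
        using DERIV_cmult[OF DERIV_chain2[OF j(1) sm_t[of 0 0]]] by simp
      show "continuous_on UNIV (\<lambda>(x, t). \<phi> x * j (?U x t))"
        unfolding case_prod_beta
        by (intro continuous_on_mult continuous_on_comp_UNIV[OF \<phi>c(1)] continuous_on_comp_UNIV[OF jc(1)] sm_c continuous_intros)
      show "continuous_on UNIV (\<lambda>(x, t). \<phi> x * (j1 (?U x t) * sm 0 1 x t))"
        unfolding case_prod_beta
        by (intro continuous_on_mult continuous_on_comp_UNIV[OF \<phi>c(1)] continuous_on_comp_UNIV[OF jc(2)] sm_c continuous_intros)
      show "\<phi> x * j (?U x t) = 0" if "t \<in> {s..T}" "\<bar>x - p t\<bar> \<le> \<rho>" for x t
        using \<delta>(2)[OF small[OF that]] by simp
      show "lo \<le> p t - \<rho>" using d[OF t] \<rho>(2) by simp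
    qed
    have A_int: "(A' has_integral (A T - A s)) {s..T}"
      using times A_deriv by (intro fundamental_theorem_of_calculus)
        (auto simp: has_real_derivative_iff_has_vector_derivative[symmetric])
    have g1: "s0 + \<epsilon> \<le> s" "T + \<epsilon> \<le> t0" using \<epsilon> by (auto simp: s0_def t0_def)
    have g2: "\<bar>p \<tau> - p t\<bar> \<le> a / 2" if "t \<in> {s..T}" "\<tau> \<in> {s0..t0}" "\<bar>\<tau> - t\<bar> \<le> \<epsilon>" for t \<tau>
      using that \<epsilon> st by (intro \<epsilon>0(3)) auto
    have g3: "\<phi> x \<le> B" if "x \<in> {-L-a..L}" for x
      using B(2)[of x] that by (auto simp: abs_le_iff)
    have g4: "\<bar>\<phi> x - \<phi> y\<bar> \<le> B * \<bar>x - y\<bar>" if "x \<in> {-L-a-1..L+1}" "y \<in> {-L-a-1..L+1}" for x y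
      using that B(3) by (intro lipschitz_bound_if_deriv_bound[OF \<phi>(1)]) auto
    have g5: "-L < lo - \<epsilon>" using \<epsilon>(7) lo by (simp add: field_simps)
    have g6: "lo \<le> p t \<and> p t + \<epsilon> < L" if "t \<in> {s..T}" for t
      using d[OF that] pr[OF that] \<open>0 < d\<close> \<epsilon>(3) r(1) by auto
    obtain Kb where Kb:
      "\<And>t g. t \<in> {s..T} \<Longrightarrow> continuous_on UNIV g \<Longrightarrow> (\<And>x. x \<le> L \<Longrightarrow> 0 \<le> g x \<and> g x \<le> \<phi> x) \<Longrightarrow>
        integral {lo..p t} (\<lambda>x. g x * (sm 0 1 x t - sm 2 0 x t)) \<le> Kb t"
      "Kb integrable_on {s..T}"
      "integral {s..T} Kb \<le> integral {s..T} (\<lambda>t. ?k t * \<phi> (p t - a)) + (2 * C * B + C * B * (t0 - s0)) * \<epsilon>"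
      unfolding sm_def
    proof (rule source_estimate[OF b \<epsilon>(1,6) st(1) g1(1) times(2) g1(2) \<kappa>C g2 \<phi>c(1) \<phi>0 g3 g4 g5 g6], assumption+, goal_cases)
      case (1 Kb)
      show ?case by (rule 1(1)) (fact 1)+
    qed
    have rate: "A' t \<le> ?R t + c1 * e + Kb t" if t: "t \<in> {s..T}" for t
    proof -
      have t': "0 < t" using t times by auto
      have pL: "lo \<le> p t" "p t \<le> L" "lo \<le> p t - h" "p t - h \<le> p t"
        using d[OF t] h pr[OF t] r(1) by auto
      note cU = sm_cx[of _ 0 0 t]
      have Uint: "continuous_on S (\<lambda>x. g x * f (?U x t))" if "continuous_on UNIV g" "continuous_on UNIV f" for S f and g :: "real \<Rightarrow> real"
        by (intro continuous_on_mult continuous_on_comp_UNIV[OF that(2)] cU continuous_on_subset[OF that(1)]) auto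
      \<comment> \<open>The second space derivative is added and subtracted. The first summand is
        the one of \<open>dissipation_estimate\<close>; the second is the mollified equation against
        \<open>\<phi> j1\<close>, which lies between 0 and \<open>\<phi>\<close> as
        \<open>source_estimate\<close> requires.\<close>
      have "A' t = integral {lo..p t} (\<lambda>x. \<phi> x * (j1 (?U x t) * sm 2 0 x t) + \<phi> x * j1 (?U x t) * (sm 0 1 x t - sm 2 0 x t))"
        unfolding A'_def by (simp add: algebra_simps)
      also have "\<dots> = integral {lo..p t} (\<lambda>x. \<phi> x * (j1 (?U x t) * sm 2 0 x t))
          + integral {lo..p t} (\<lambda>x. \<phi> x * j1 (?U x t) * (sm 0 1 x t - sm 2 0 x t))"
        by (intro Henstock_Kurzweil_Integration.integral_add integrable_continuous_interval continuous_on_mult continuous_on_diff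
            sm_cx \<phi>c continuous_on_comp_UNIV[OF jc(2)])
      also have "integral {lo..p t} (\<lambda>x. \<phi> x * j1 (?U x t) * (sm 0 1 x t - sm 2 0 x t)) \<le> Kb t"
        using j1 \<phi>0 by (intro Kb(1)[OF t] continuous_on_mult sm_cx \<phi>c continuous_on_comp_UNIV[OF jc(2)])
          (auto intro: mult_left_le)
      also have "integral {lo..p t} (\<lambda>x. \<phi> x * (j1 (?U x t) * sm 2 0 x t)) \<le> integral {lo..p t} (\<lambda>x. \<phi>2 x * j (?U x t))
        - (2 * ?k t * \<phi> (p t - h) * j1 (?U (p t - h) t) + 2 * ?k t * integral {p t - h..p t} (\<lambda>x. \<phi>1 x * j1 (?U x t))
       - (?k t)\<^sup>2 * integral {p t - h..p t} (\<lambda>x. \<phi> x * j2 (?U x t)))"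
      proof (rule dissipation_estimate[where w = "\<lambda>x. ?U x t" and ?w1.0 = "\<lambda>x. sm 1 0 x t"])
        show "((\<lambda>x. ?U x t) has_real_derivative sm 1 0 x t) (at x)" for x
          using sm_x[of 0 0 t x] by simp
        show "((\<lambda>x. sm 1 0 x t) has_real_derivative sm 2 0 x t) (at x)" for x
          using sm_x[of 1 0 t x] by (simp add: numeral_2_eq_2)
        show "continuous_on UNIV (\<lambda>x. sm 2 0 x t)" by (rule sm_cx)
        show "j (?U (p t) t) = 0" "j1 (?U (p t) t) = 0"
          using \<delta>(2)[OF small[OF t, of "p t"]] \<rho>(1) by auto
      qed (use \<phi> \<phi>0 \<phi>lo j j2 h pL in auto)
      finally have 1: "A' t \<le> integral {lo..p t} (\<lambda>x. \<phi>2 x * j (?U x t))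
        - (2 * ?k t * \<phi> (p t - h) * j1 (?U (p t - h) t) + 2 * ?k t * integral {p t - h..p t} (\<lambda>x. \<phi>1 x * j1 (?U x t))
       - (?k t)\<^sup>2 * integral {p t - h..p t} (\<lambda>x. \<phi> x * j2 (?U x t))) + Kb t"
        by simp
      have inB: "x \<in> {-L-a-1..L+1}" if "x \<in> {lo..p t}" for x
        using that lo pL a_pos by auto
      have "\<bar>integral {lo..p t} (\<lambda>x. \<phi>2 x * j (?U x t)) - integral {lo..p t} (\<lambda>x. \<phi>2 x * j (u x t))\<bar> \<le> B * e * (p t - lo)"
      proof (intro integral_diff_bound Uint u_slice_continuous pL t' \<phi>(3) jc)
        fix x assume x: "x \<in> {lo..p t}"
        have "\<bar>\<phi>2 x * j (?U x t) - \<phi>2 x * j (u x t)\<bar> = \<bar>\<phi>2 x\<bar> * \<bar>j (?U x t) - j (u x t)\<bar>"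
          by (simp add: abs_mult[symmetric] right_diff_distrib)
        also have "\<dots> \<le> B * e"
          using jM[of "?U x t" "u x t"] closed_strip[OF t x] B(4)[OF inB[OF x]] \<open>0 \<le> B\<close> by (intro mult_mono) auto
        finally show "\<bar>\<phi>2 x * j (?U x t) - \<phi>2 x * j (u x t)\<bar> \<le> B * e" .
      qed (use lo in simp)
      also have "\<dots> \<le> B * e * (2 * L)"
        using pL lo e \<open>0 \<le> B\<close> by (intro mult_left_mono) auto
      finally have 2: "integral {lo..p t} (\<lambda>x. \<phi>2 x * j (?U x t)) \<le> integral {lo..p t} (\<lambda>x. \<phi>2 x * j (u x t)) + B * e * (2 * L)"
        by simp
      have j1e: "\<bar>j1 (?U x t) - j1 (u x t)\<bar> \<le> M * e" "\<bar>j2 (?U x t) - j2 (u x t)\<bar> \<le> M * e" if "x \<in> {lo..p t}" for x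
        using M[of "?U x t" "u x t"] mult_left_mono[OF closed_strip[OF t that] M0] by auto
      have sub: "x \<in> {lo..p t}" if "x \<in> {p t - h..p t}" for x
        using that pL by auto
      have "\<bar>integral {p t - h..p t} (\<lambda>x. \<phi>1 x * j1 (?U x t)) - integral {p t - h..p t} (\<lambda>x. \<phi>1 x * j1 (u x t))\<bar> \<le> B * (M * e) * (p t - (p t - h))"
      proof (intro integral_diff_bound Uint u_slice_continuous pL t' \<phi>c jc)
        fix x assume x: "x \<in> {p t - h..p t}"
        have "\<bar>\<phi>1 x * j1 (?U x t) - \<phi>1 x * j1 (u x t)\<bar> = \<bar>\<phi>1 x\<bar> * \<bar>j1 (?U x t) - j1 (u x t)\<bar>"
          by (simp add: abs_mult[symmetric] right_diff_distrib)
        also have "\<dots> \<le> B * (M * e)"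
          using j1e(1)[OF sub[OF x]] B(3)[OF inB[OF sub[OF x]]] \<open>0 \<le> B\<close> by (intro mult_mono) auto
        finally show "\<bar>\<phi>1 x * j1 (?U x t) - \<phi>1 x * j1 (u x t)\<bar> \<le> B * (M * e)" .
      qed (use lo pL in simp)
      then have 3: "integral {p t - h..p t} (\<lambda>x. \<phi>1 x * j1 (u x t)) - integral {p t - h..p t} (\<lambda>x. \<phi>1 x * j1 (?U x t)) \<le> B * (M * e) * h"
        by simp
      have "\<bar>integral {p t - h..p t} (\<lambda>x. \<phi> x * j2 (?U x t)) - integral {p t - h..p t} (\<lambda>x. \<phi> x * j2 (u x t))\<bar> \<le> B * (M * e) * (p t - (p t - h))"
      proof (intro integral_diff_bound Uint u_slice_continuous pL t' \<phi>c j(3))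
        fix x assume x: "x \<in> {p t - h..p t}"
        have "\<bar>\<phi> x * j2 (?U x t) - \<phi> x * j2 (u x t)\<bar> = \<bar>\<phi> x\<bar> * \<bar>j2 (?U x t) - j2 (u x t)\<bar>"
          by (simp add: abs_mult[symmetric] right_diff_distrib)
        also have "\<dots> \<le> B * (M * e)"
          using j1e(2)[OF sub[OF x]] B(2)[OF inB[OF sub[OF x]]] \<open>0 \<le> B\<close> by (intro mult_mono) auto
        finally show "\<bar>\<phi> x * j2 (?U x t) - \<phi> x * j2 (u x t)\<bar> \<le> B * (M * e)" .
      qed (use lo pL in simp)
      then have 4: "integral {p t - h..p t} (\<lambda>x. \<phi> x * j2 (?U x t)) - integral {p t - h..p t} (\<lambda>x. \<phi> x * j2 (u x t)) \<le> B * (M * e) * h"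
        by simp
      have ph: "p t - h \<in> {lo..p t}" using pL h by auto
      have "\<phi> (p t - h) * (j1 (u (p t - h) t) - j1 (?U (p t - h) t)) \<le> B * (M * e)"
        using j1e(1)[OF ph] B(2)[OF inB[OF ph]] \<open>0 \<le> B\<close> \<phi>0[of "p t - h"] pL M0 e(1)
        by (intro order_trans[OF mult_left_mono mult_right_mono]) auto
      then have 5: "\<phi> (p t - h) * j1 (u (p t - h) t) - \<phi> (p t - h) * j1 (?U (p t - h) t) \<le> B * (M * e)"
        by (simp add: right_diff_distrib)
      have hd: "B * (M * e) * h \<le> B * (M * e) * d"
        using h \<open>0 \<le> B\<close> M0 e by (intro mult_left_mono) auto
      define X where "X = 2 * (\<phi> (p t - h) * j1 (?U (p t - h) t)) + 2 * integral {p t - h..p t} (\<lambda>x. \<phi>1 x * j1 (?U x t))"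
      define Y where "Y = 2 * (\<phi> (p t - h) * j1 (u (p t - h) t)) + 2 * integral {p t - h..p t} (\<lambda>x. \<phi>1 x * j1 (u x t))"
      have "Y - X \<le> 2 * (B * (M * e)) + 2 * (B * (M * e) * d)"
        using 3 5 hd unfolding X_def Y_def by linarith
      then have "?k t * (Y - X) \<le> ?k t * (2 * (B * (M * e)) + 2 * (B * (M * e) * d))"
        using k by (intro mult_left_mono) auto
      also have "\<dots> \<le> C * (2 * (B * (M * e)) + 2 * (B * (M * e) * d))"
        using k \<open>0 \<le> B\<close> M0 e \<open>0 < d\<close> by (intro mult_right_mono) auto
      finally have 6: "?k t * Y - ?k t * X \<le> C * (2 * (B * (M * e)) + 2 * (B * (M * e) * d))"
        by (simp add: right_diff_distrib)
      define V where "V = integral {p t - h..p t} (\<lambda>x. \<phi> x * j2 (?U x t))"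
      define W where "W = integral {p t - h..p t} (\<lambda>x. \<phi> x * j2 (u x t))"
      have "(?k t)\<^sup>2 * (V - W) \<le> (?k t)\<^sup>2 * (B * (M * e) * d)"
        using 4 hd unfolding V_def W_def by (intro mult_left_mono) auto
      also have "\<dots> \<le> C\<^sup>2 * (B * (M * e) * d)"
        using k \<open>0 \<le> B\<close> M0 e \<open>0 < d\<close> by (intro mult_right_mono power_mono) auto
      finally have 7: "(?k t)\<^sup>2 * V - (?k t)\<^sup>2 * W \<le> C\<^sup>2 * (B * (M * e) * d)"
        by (simp add: right_diff_distrib)
      have "A' t \<le> integral {lo..p t} (\<lambda>x. \<phi>2 x * j (?U x t)) - ?k t * X + (?k t)\<^sup>2 * V + Kb t"
        using 1 unfolding X_def V_def by (simp add: algebra_simps)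
      moreover have "?R t = integral {lo..p t} (\<lambda>x. \<phi>2 x * j (u x t)) - ?k t * Y + (?k t)\<^sup>2 * W"
        by (simp add: kato_rate_def Y_def W_def)
      moreover have "B * e * (2 * L) + C * (2 * (B * (M * e)) + 2 * (B * (M * e) * d)) + C\<^sup>2 * (B * (M * e) * d) = c1 * e"
        by (simp add: c1_def algebra_simps)
      ultimately show ?thesis using 2 6 7 by linarith
    qed
    have Rc_int: "(\<lambda>t. ?R t + c1 * e) integrable_on {s..T}"
      by (intro integrable_add R_int) auto
    have "A T - A s = integral {s..T} A'"
      using A_int by (simp add: integral_unique)
    also have "\<dots> \<le> integral {s..T} (\<lambda>t. ?R t + c1 * e + Kb t)"
      using A_int by (intro integral_le integrable_add[OF Rc_int Kb(2)] rate) (auto intro: has_integral_integrable)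
    also have "\<dots> = integral {s..T} (\<lambda>t. ?R t + c1 * e) + integral {s..T} Kb"
      by (rule Henstock_Kurzweil_Integration.integral_add[OF Rc_int Kb(2)])
    also have "integral {s..T} (\<lambda>t. ?R t + c1 * e) = integral {s..T} ?R + integral {s..T} (\<lambda>t. c1 * e)"
      by (rule Henstock_Kurzweil_Integration.integral_add[OF R_int]) (rule integrable_const_ivl)
    also have "integral {s..T} (\<lambda>t. c1 * e) = c1 * e * (T - s)"
      using times by simp
    finally have main: "A T - A s \<le> integral {s..T} ?R + c1 * e * (T - s) + integral {s..T} Kb" .
    have A_close: "\<bar>A t - integral {lo..p t} (\<lambda>x. \<phi> x * j (u x t))\<bar> \<le> 2 * L * B * e" if t: "t \<in> {s..T}" for t
    proof -
      have t': "0 < t" using t times by auto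
      have pL: "lo \<le> p t" "p t \<le> L"
        using d[OF t] h pr[OF t] r(1) by auto
      have "\<bar>A t - integral {lo..p t} (\<lambda>x. \<phi> x * j (u x t))\<bar> \<le> B * e * (p t - lo)"
        unfolding A_def
      proof (intro integral_diff_bound u_slice_continuous pL t' \<phi>c jc)
        show "continuous_on {lo..p t} (\<lambda>x. \<phi> x * j (?U x t))"
          by (intro continuous_on_mult continuous_on_comp_UNIV[OF jc(1)] sm_cx \<phi>c)
        fix x assume x: "x \<in> {lo..p t}"
        have xB: "x \<in> {-L-a-1..L+1}" using x lo pL a_pos by auto
        have "\<bar>\<phi> x * j (?U x t) - \<phi> x * j (u x t)\<bar> = \<bar>\<phi> x\<bar> * \<bar>j (?U x t) - j (u x t)\<bar>"
          by (simp add: abs_mult[symmetric] right_diff_distrib)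
        also have "\<dots> \<le> B * e"
          using jM[of "?U x t" "u x t"] closed_strip[OF t x] B(2)[OF xB] \<open>0 \<le> B\<close> by (intro mult_mono) auto
        finally show "\<bar>\<phi> x * j (?U x t) - \<phi> x * j (u x t)\<bar> \<le> B * e" .
      qed (use lo in simp)
      also have "\<dots> \<le> B * e * (2 * L)"
        using pL lo e \<open>0 \<le> B\<close> by (intro mult_left_mono) auto
      finally show ?thesis by (simp add: mult_ac)
    qed
    have "(2 * C * B + C * B * (t0 - s0)) * \<epsilon> \<le> (2 * C * B + C * B * (t0 - s0)) * e"
      using \<epsilon>(8) C0 \<open>0 \<le> B\<close> st by (intro mult_left_mono) auto
    moreover have "K * e = 2 * (2 * L * B * e) + c1 * e * (T - s) + (2 * C * B + C * B * (t0 - s0)) * e"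
      by (simp add: K_def algebra_simps)
    ultimately show "integral {lo..p T} (\<lambda>x. \<phi> x * j (u x T)) - integral {lo..p s} (\<lambda>x. \<phi> x * j (u x s))
        \<le> integral {s..T} ?R + integral {s..T} (\<lambda>t. ?k t * \<phi> (p t - a)) + K * e"
      using main Kb(3) abs_le_D1[OF A_close[of s]] abs_le_D2[OF A_close[of T]] times
      by auto
  qed
qed

end

section \<open>The Kato inequality\<close>

text \<open>For negative \<open>x\<close> the interval is empty and the integral is 0 by default.
  Since \<open>f\<close> vanishes up to 1, this is still a primitive on the whole line.\<close>

lemma antiderivative_from_0:
  fixes f :: "real \<Rightarrow> real"
  assumes f: "continuous_on UNIV f" and f0: "\<And>x. x \<le> 1 \<Longrightarrow> f x = 0"
  shows "((\<lambda>x. integral {0..x} f) has_real_derivative f x) (at x)"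
    and "x \<le> 1 \<Longrightarrow> integral {0..x} f = 0"
proof -
  have z: "integral {0..y} f = 0" if "y \<le> 1" for y
    by (subst integral_cong[where g = "\<lambda>_. 0"]) (use f0 that in auto)
  then show "x \<le> 1 \<Longrightarrow> integral {0..x} f = 0" .
  show "((\<lambda>x. integral {0..x} f) has_real_derivative f x) (at x)"
  proof (cases "x < 1")
    case True
    have "((\<lambda>_. 0) has_real_derivative 0) (at x)" by simp
    moreover have "\<forall>\<^sub>F y in nhds x. integral {0..y} f = 0"
      using eventually_nhds_in_open[of "{..<1}" x] True by (auto intro: z elim!: eventually_mono)
    ultimately show ?thesis
      using f0[of x] True by (subst DERIV_cong_ev[OF refl _ refl]) auto
  next
    case False
    have "((\<lambda>x. integral {0..x} f) has_real_derivative f x) (at x within {0..x+1})"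
      by (rule integral_has_real_derivative[OF continuous_on_subset[OF f]]) (use False in auto)
    moreover have "at x within {0..x+1} = at x"
      by (rule at_within_Icc_at) (use False in auto)
    ultimately show ?thesis by simp
  qed
qed

text \<open>A smooth convex stand-in for the positive part, with slope 0 up to 1 and slope 1 from 2
  on. Rescaled to \<open>\<delta> * J (v / \<delta>)\<close> it is flat up to
  \<open>\<delta>\<close> and within \<open>2 * \<delta>\<close> of \<open>max 0 v\<close>.\<close>

definition convex_profile :: "(real \<Rightarrow> real) \<Rightarrow> (real \<Rightarrow> real) \<Rightarrow> (real \<Rightarrow> real) \<Rightarrow> real \<Rightarrow> bool" where
  "convex_profile J J1 J2 M \<longleftrightarrow>
     (\<forall>x. (J has_real_derivative J1 x) (at x)) \<and> (\<forall>x. (J1 has_real_derivative J2 x) (at x)) \<and>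
     continuous_on UNIV J2 \<and> (\<forall>x. 0 \<le> J1 x \<and> J1 x \<le> 1) \<and> (\<forall>x. 0 \<le> J2 x) \<and> 0 \<le> M \<and>
     (\<forall>x y. \<bar>J1 x - J1 y\<bar> \<le> M * \<bar>x - y\<bar>) \<and> (\<forall>x y. \<bar>J2 x - J2 y\<bar> \<le> M * \<bar>x - y\<bar>) \<and>
     (\<forall>x\<le>1. J x = 0 \<and> J1 x = 0) \<and> (\<forall>x\<ge>2. J1 x = 1) \<and> (\<forall>x. \<bar>J x - max 0 x\<bar> \<le> 2) \<and> (\<forall>x. J2 x \<le> M)"

lemma convex_profileD:
  assumes "convex_profile J J1 J2 M"
  shows "(J has_real_derivative J1 x) (at x)" "(J1 has_real_derivative J2 x) (at x)"
    "continuous_on UNIV J2" "0 \<le> J1 x \<and> J1 x \<le> 1" "0 \<le> J2 x" "0 \<le> M"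
    "\<bar>J1 x - J1 y\<bar> \<le> M * \<bar>x - y\<bar>" "\<bar>J2 x - J2 y\<bar> \<le> M * \<bar>x - y\<bar>"
    "x \<le> 1 \<Longrightarrow> J x = 0 \<and> J1 x = 0" "2 \<le> x \<Longrightarrow> J1 x = 1" "\<bar>J x - max 0 x\<bar> \<le> 2" "J2 x \<le> M"
  using assms unfolding convex_profile_def by blast+

text \<open>Serves twice: its primitive is a convex profile, and rescaled in space it is the cutoff
  near \<open>-L\<close>, where its second derivative has to be controlled as well.\<close>

definition smooth_step :: "(real \<Rightarrow> real) \<Rightarrow> (real \<Rightarrow> real) \<Rightarrow> (real \<Rightarrow> real) \<Rightarrow> real \<Rightarrow> bool" where
  "smooth_step \<psi> \<psi>1 \<psi>2 M \<longleftrightarrow>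
     (\<forall>x. (\<psi> has_real_derivative \<psi>1 x) (at x)) \<and> (\<forall>x. (\<psi>1 has_real_derivative \<psi>2 x) (at x)) \<and>
     continuous_on UNIV \<psi>2 \<and> (\<forall>x. 0 \<le> \<psi> x \<and> \<psi> x \<le> 1) \<and> (\<forall>x. 0 \<le> \<psi>1 x \<and> \<psi>1 x \<le> M) \<and>
     (\<forall>x. \<bar>\<psi>2 x\<bar> \<le> M) \<and> (\<forall>x\<le>1. \<psi> x = 0) \<and> (\<forall>x\<ge>2. \<psi> x = 1) \<and>
     (\<forall>x. x \<le> 1 \<or> 2 \<le> x \<longrightarrow> \<psi>1 x = 0 \<and> \<psi>2 x = 0)"

lemma smooth_stepD:
  assumes "smooth_step \<psi> \<psi>1 \<psi>2 M"
  shows "(\<psi> has_real_derivative \<psi>1 x) (at x)" "(\<psi>1 has_real_derivative \<psi>2 x) (at x)"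
    "continuous_on UNIV \<psi>2" "0 \<le> \<psi> x \<and> \<psi> x \<le> 1" "0 \<le> \<psi>1 x \<and> \<psi>1 x \<le> M"
    "\<bar>\<psi>2 x\<bar> \<le> M" "x \<le> 1 \<Longrightarrow> \<psi> x = 0" "2 \<le> x \<Longrightarrow> \<psi> x = 1"
    "x \<le> 1 \<or> 2 \<le> x \<Longrightarrow> \<psi>1 x = 0 \<and> \<psi>2 x = 0"
  using assms unfolding smooth_step_def by blast+

lemma smooth_step_exists:
  obtains \<psi> \<psi>1 \<psi>2 M where "smooth_step \<psi> \<psi>1 \<psi>2 M"
proof -
  \<comment> \<open>Radius 1/2, to be centred at 3/2: the derivative of the step then vanishes
    outside the interval from 1 to 2.\<close>
  obtain b where b: "mollifier (1/2) b"
    by (rule mollifier_exists[of "1/2"]) auto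
  define \<psi>1 where "\<psi>1 x = b 0 (x - 3/2)" for x
  define \<psi>2 where "\<psi>2 x = b 1 (x - 3/2)" for x
  define \<psi> where "\<psi> x = integral {0..x} \<psi>1" for x
  have \<psi>1c: "continuous_on S \<psi>1" and \<psi>2c: "continuous_on S \<psi>2" for S
    unfolding \<psi>1_def[abs_def] \<psi>2_def[abs_def]
    by (intro continuous_on_comp_UNIV[OF mollifierD(5)[OF b]] continuous_intros)+
  have vanish: "\<psi>1 x = 0 \<and> \<psi>2 x = 0" if "x \<le> 1 \<or> 2 \<le> x" for x
    unfolding \<psi>1_def \<psi>2_def using that by (intro conjI mollifierD(3)[OF b]) auto
  have d\<psi>: "(\<psi> has_real_derivative \<psi>1 x) (at x)" for x
    unfolding \<psi>_def[abs_def] by (rule antiderivative_from_0(1)[OF \<psi>1c]) (use vanish in auto)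
  have \<psi>_0: "\<psi> x = 0" if "x \<le> 1" for x
    unfolding \<psi>_def by (rule antiderivative_from_0(2)[OF \<psi>1c _ that]) (use vanish in auto)
  have \<psi>_01: "0 \<le> \<psi> x \<and> \<psi> x \<le> 1" for x
    unfolding \<psi>_def \<psi>1_def[abs_def]
    by (intro conjI mollifier_integral_le[OF b] integral_nonneg integrable_continuous_interval
        \<psi>1c[unfolded \<psi>1_def[abs_def]] mollifierD(2)[OF b]) simp
  have \<psi>_1: "\<psi> x = 1" if "2 \<le> x" for x
    unfolding \<psi>_def \<psi>1_def[abs_def] by (rule mollifier_integral_shifted[OF b]) (use that in auto)
  have d\<psi>1: "(\<psi>1 has_real_derivative \<psi>2 x) (at x)" for x
  proof -
    have "((\<lambda>x. b 0 (x - 3/2)) has_real_derivative b (Suc 0) (x - 3/2) * 1) (at x)"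
      by (rule DERIV_chain2[OF mollifierD(1)[OF b]]) (auto intro!: derivative_eq_intros)
    then show ?thesis by (simp add: \<psi>1_def[abs_def] \<psi>2_def)
  qed
  obtain M1 where M1: "0 \<le> M1" "\<And>z. z \<in> {1..2} \<Longrightarrow> \<bar>\<psi>1 z\<bar> \<le> M1"
    using bounded_on_Icc[OF \<psi>1c] by metis
  obtain M2 where M2: "0 \<le> M2" "\<And>z. z \<in> {1..2} \<Longrightarrow> \<bar>\<psi>2 z\<bar> \<le> M2"
    using bounded_on_Icc[OF \<psi>2c] by metis
  have "\<bar>\<psi>1 z\<bar> \<le> max M1 M2" "\<bar>\<psi>2 z\<bar> \<le> max M1 M2" for z
    using M1 M2 vanish[of z] by (cases "z \<in> {1..2}"; auto simp: le_max_iff_disj)+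
  moreover have "0 \<le> \<psi>1 x" for x
    by (simp add: \<psi>1_def mollifierD(2)[OF b])
  ultimately have "smooth_step \<psi> \<psi>1 \<psi>2 (max M1 M2)"
    unfolding smooth_step_def
    using d\<psi> d\<psi>1 \<psi>2c \<psi>_01 \<psi>_0 \<psi>_1 vanish by (auto simp: abs_le_iff)
  then show ?thesis by (rule that)
qed

lemma convex_profile_exists:
  obtains J J1 J2 M where "convex_profile J J1 J2 M"
proof -
  obtain J1 J2 J3 M where step: "smooth_step J1 J2 J3 M"
    by (rule smooth_step_exists)
  note st = smooth_stepD[OF step]
  define J where "J x = integral {0..x} J1" for x
  have J1c: "continuous_on S J1" for S
    using st(1) by (meson DERIV_continuous_on has_field_derivative_at_within)
  have J2c: "continuous_on S J2" for S
    using st(2) by (meson DERIV_continuous_on has_field_derivative_at_within)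
  have dJ: "(J has_real_derivative J1 x) (at x)" for x
    unfolding J_def[abs_def] by (rule antiderivative_from_0(1)[OF J1c st(7)])
  have J_0: "J x = 0" if "x \<le> 1" for x
    unfolding J_def by (rule antiderivative_from_0(2)[OF J1c st(7) that])
  have J_near: "\<bar>J x - max 0 x\<bar> \<le> 2" for x
  proof (cases "x \<le> 1")
    case True
    then show ?thesis using J_0[OF True] by auto
  next
    case False
    have up: "\<bar>J x - J 1\<bar> \<le> 1 * \<bar>x - 1\<bar>"
      using st(4) False by (intro lipschitz_bound_if_deriv_bound[OF dJ, of 1 x]) auto
    \<comment> \<open>\<open>J x - x\<close> decreases up to 2 and is constant afterwards, since the
      slope of \<open>J\<close> is at most 1 and equals 1 from 2 on. With \<open>0 \<le> J 2\<close>
      this yields the constant 2 of \<open>convex_profile\<close>.\<close>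
    have low: "J 2 - 2 \<le> J x - x"
    proof (cases "x \<le> 2")
      case True
      have "\<bar>J 2 - J x\<bar> \<le> 1 * \<bar>2 - x\<bar>"
        using st(4) True by (intro lipschitz_bound_if_deriv_bound[OF dJ, of x 2]) auto
      then show ?thesis using True by auto
    next
      case False
      have "((\<lambda>x. J x - x) has_real_derivative J1 y - 1) (at y)" for y
        by (auto intro!: derivative_eq_intros dJ)
      then have "\<bar>(J x - x) - (J 2 - 2)\<bar> \<le> 0 * \<bar>x - 2\<bar>"
        using st(8) False by (intro lipschitz_bound_if_deriv_bound[where f = "\<lambda>x. J x - x", of "\<lambda>y. J1 y - 1" 2 x]) auto
      then show ?thesis by simp
    qed
    have "0 \<le> J 2"
      unfolding J_def using st(4) by (intro integral_nonneg integrable_continuous_interval J1c) auto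
    then show ?thesis using up low J_0[of 1] False by auto
  qed
  have "0 \<le> M" using st(5)[of 0] by simp
  have L1: "\<bar>J1 x - J1 y\<bar> \<le> M * \<bar>x - y\<bar>" for x y
    using st(5) by (intro lipschitz_bound_if_deriv_bound[OF st(1), of "min x y" "max x y"]) auto
  have L2: "\<bar>J2 x - J2 y\<bar> \<le> M * \<bar>x - y\<bar>" for x y
    using st(6) by (intro lipschitz_bound_if_deriv_bound[OF st(2), of "min x y" "max x y"]) auto
  have "convex_profile J J1 J2 M"
    unfolding convex_profile_def using dJ st J2c \<open>0 \<le> M\<close> J_0 J_near L1 L2 by auto
  then show ?thesis by (rule that)
qed

section \<open>The boundary flux by blow-up\<close>

context weak_solution
begin

text \<open>First-order expansion at the single point \<open>p t\<close>. The limit comes for fixed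
  \<open>z\<close> and \<open>t\<close> without any uniformity, so dominated convergence has to
  carry it through the integrals over both.\<close>

lemma blow_up_limit:
  assumes t: "0 < t" and z: "0 \<le> z" and \<delta>: "\<And>n. 0 < \<delta> n" "\<delta> \<longlonglongrightarrow> 0"
  shows "(\<lambda>n. u (p t - \<delta> n * z) t / \<delta> n) \<longlonglongrightarrow> \<kappa> t * z"
proof (cases "z = 0")
  case True
  then show ?thesis using zero[OF t] by simp
next
  case False
  then have "0 < z" using z by simp
  have "((\<lambda>h. (u (p t + h) t - u (p t) t) / h) \<longlongrightarrow> - \<kappa> t) (at 0)"
    using flux[OF t] by (simp add: DERIV_def)
  moreover have "filterlim (\<lambda>n. - (\<delta> n * z)) (at 0) sequentially"
  proof -
    have "(\<lambda>n. - (\<delta> n * z)) \<longlonglongrightarrow> - (0 * z)"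
      by (intro tendsto_intros \<delta>(2))
    moreover have "- (\<delta> n * z) \<noteq> 0" for n
      using \<delta>(1)[of n] \<open>0 < z\<close> by simp
    ultimately show ?thesis by (simp add: filterlim_at)
  qed
  ultimately have "(\<lambda>n. (u (p t + - (\<delta> n * z)) t - u (p t) t) / (- (\<delta> n * z))) \<longlonglongrightarrow> - \<kappa> t"
    by (rule filterlim_compose)
  then have "(\<lambda>n. - z * ((u (p t + - (\<delta> n * z)) t - u (p t) t) / (- (\<delta> n * z)))) \<longlonglongrightarrow> - z * - \<kappa> t"
    by (rule tendsto_mult_left)
  moreover have "- z * ((u (p t + - (\<delta> n * z)) t - u (p t) t) / (- (\<delta> n * z))) = u (p t - \<delta> n * z) t / \<delta> n" for n
    using \<open>0 < z\<close> \<delta>(1)[of n] zero[OF t] by (simp add: field_simps)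
  ultimately show ?thesis by (simp add: mult.commute)
qed

text \<open>
  The profile \<open>j\<close> is rescaled to \<open>\<delta> J (u / \<delta>)\<close> and the dissipation is kept on a window of width \<open>\<delta> Z\<close> to
  the left of \<open>p\<close>.  There \<open>u\<close> is asymptotically linear with slope \<open>- \<kappa>\<close>, so as \<open>\<delta> \<rightarrow> 0\<close> and then
  \<open>Z \<rightarrow> \<infinity>\<close> at least the flux \<open>max 0 \<kappa>\<close> leaves through \<open>p\<close>.
\<close>

lemma kato_interior:
  fixes \<phi> \<phi>1 \<phi>2 :: "real \<Rightarrow> real"
  assumes times: "0 < s" "s < T" and lo: "-L < lo" and "0 < d"
    and d: "\<And>t. t \<in> {s..T} \<Longrightarrow> lo + d \<le> p t"
    and \<phi>: "\<And>x. (\<phi> has_real_derivative \<phi>1 x) (at x)" "\<And>x. (\<phi>1 has_real_derivative \<phi>2 x) (at x)"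
      "continuous_on UNIV \<phi>2" and \<phi>0: "\<And>x. x \<le> L \<Longrightarrow> 0 \<le> \<phi> x" and \<phi>lo: "\<phi> lo = 0" "\<phi>1 lo = 0"
  shows "integral {lo..p T} (\<lambda>x. \<phi> x * max 0 (u x T)) - integral {lo..p s} (\<lambda>x. \<phi> x * max 0 (u x s))
    \<le> integral {s..T} (\<lambda>t. integral {lo..p t} (\<lambda>x. \<phi>2 x * max 0 (u x t)))
      + integral {s..T} (\<lambda>t. positive_flux s T t * \<phi> (p t - a))
      - integral {s..T} (\<lambda>t. positive_flux s T t * \<phi> (p t))"
proof -
  obtain J J1 J2 M where "convex_profile J J1 J2 M"
    by (rule convex_profile_exists)
  note J = convex_profileD[OF this]
  have cont: "continuous_on A f" if "\<And>x. (f has_real_derivative f' x) (at x)" for A and f f' :: "real \<Rightarrow> real"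
    using that by (meson DERIV_continuous_on has_field_derivative_at_within)
  note \<phi>c = cont[OF \<phi>(1)] cont[OF \<phi>(2)] and Jc = cont[OF J(1)] cont[OF J(2)]
  have maxc: "continuous_on S (\<lambda>v::real. max 0 v)" for S
    by (intro continuous_intros)
  obtain C where C: "\<forall>t\<in>{s..T}. C-lipschitz_on {-L..L} (\<lambda>x. u x t)"
    using u_lip[OF times] by blast
  have C0: "0 \<le> C" using C times lipschitz_on_nonneg by fastforce
  let ?k = "positive_flux s T"
  have k: "0 \<le> ?k t" "?k t \<le> C" for t
    using positive_flux_nonneg[of s T t] positive_flux_bound[OF times(1) C C0, of t] by auto
  have Lpos: "-L < L" using p_bounds[of s] times by auto
  obtain B0 where B0: "0 \<le> B0" "\<And>z. z \<in> {-L..L} \<Longrightarrow> \<bar>\<phi> z\<bar> \<le> B0"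
    using bounded_on_Icc[OF \<phi>c(1)] by metis
  obtain B1 where B1: "0 \<le> B1" "\<And>z. z \<in> {-L..L} \<Longrightarrow> \<bar>\<phi>1 z\<bar> \<le> B1"
    using bounded_on_Icc[OF \<phi>c(2)] by metis
  obtain B2 where B2: "0 \<le> B2" "\<And>z. z \<in> {-L..L} \<Longrightarrow> \<bar>\<phi>2 z\<bar> \<le> B2"
    using bounded_on_Icc[OF continuous_on_subset[OF \<phi>(3)]] by (metis subset_UNIV)
  have pL: "lo < p t" "p t \<le> L" "p t - d \<ge> lo" "0 < t" if "t \<in> {s..T}" for t
    using d[OF that] \<open>0 < d\<close> p_bounds[of t] that times by auto
  have pc: "continuous_on {s..T} p" by (rule p_cont_subset[OF times(1)])
  define X where "X t = integral {lo..p t} (\<lambda>x. \<phi> x * max 0 (u x t))" for t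
  define Y where "Y t = integral {lo..p t} (\<lambda>x. \<phi>2 x * max 0 (u x t))" for t
  have Y_int: "Y integrable_on {s..T}"
    unfolding Y_def[abs_def]
    by (intro integrable_continuous_interval continuous_on_moving_integral[OF u_slab_continuous[OF times(1) _ \<phi>(3) maxc] pc])
      (use lo pL in force)+
  have k\<phi>_int: "(\<lambda>t. ?k t * \<phi> (p t - c)) integrable_on {s..T}" for c
    by (intro positive_flux_weight_integrable times continuous_on_comp_UNIV[OF \<phi>c(1)] continuous_intros pc)
  have k\<phi>_int0: "(\<lambda>t. ?k t * \<phi> (p t)) integrable_on {s..T}"
    using k\<phi>_int[of 0] by simp
  \<comment> \<open>\<open>max 0\<close> is positively homogeneous, so the distance 2 between
    \<open>J\<close> and the positive part scales to \<open>2 * \<delta>\<close>.\<close>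
  have approx: "\<bar>integral {lo..p t} (\<lambda>x. g x * (\<delta> * J (u x t / \<delta>))) - integral {lo..p t} (\<lambda>x. g x * max 0 (u x t))\<bar> \<le> B * (2 * \<delta>) * (2 * L)"
    if t: "t \<in> {s..T}" and "0 < \<delta>" and g: "continuous_on UNIV g" and B: "0 \<le> B" "\<And>z. z \<in> {-L..L} \<Longrightarrow> \<bar>g z\<bar> \<le> B" for t \<delta> g B
  proof -
    have "\<bar>integral {lo..p t} (\<lambda>x. g x * (\<delta> * J (u x t / \<delta>))) - integral {lo..p t} (\<lambda>x. g x * max 0 (u x t))\<bar> \<le> B * (2 * \<delta>) * (p t - lo)"
    proof (rule integral_diff_bound)
      show "continuous_on {lo..p t} (\<lambda>x. g x * (\<delta> * J (u x t / \<delta>)))"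
        by (rule u_slice_continuous[OF pL(4)[OF t] _ pL(2)[OF t] g, of lo "\<lambda>v. \<delta> * J (v / \<delta>)"])
          (use lo \<open>0 < \<delta>\<close> in \<open>auto intro!: continuous_intros continuous_on_comp_UNIV[OF Jc(1)]\<close>)
      show "continuous_on {lo..p t} (\<lambda>x. g x * max 0 (u x t))"
        by (rule u_slice_continuous[OF pL(4)[OF t] _ pL(2)[OF t] g maxc]) (use lo in auto)
      show "lo \<le> p t" using pL[OF t] by simp
      fix x assume x: "x \<in> {lo..p t}"
      have "\<delta> * \<bar>J (u x t / \<delta>) - max 0 (u x t / \<delta>)\<bar> \<le> \<delta> * 2"
        using J(11) \<open>0 < \<delta>\<close> by (intro mult_left_mono) auto
      moreover have "\<delta> * \<bar>J (u x t / \<delta>) - max 0 (u x t / \<delta>)\<bar> = \<bar>\<delta> * J (u x t / \<delta>) - max 0 (u x t)\<bar>"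
      proof -
        have "\<delta> * max 0 (u x t / \<delta>) = max 0 (u x t)"
          using \<open>0 < \<delta>\<close> by (simp add: max_def field_simps)
        then have "\<delta> * J (u x t / \<delta>) - max 0 (u x t) = \<delta> * (J (u x t / \<delta>) - max 0 (u x t / \<delta>))"
          by (simp add: right_diff_distrib)
        then show ?thesis
          using \<open>0 < \<delta>\<close> by (simp add: abs_mult)
      qed
      ultimately have "\<bar>g x\<bar> * \<bar>\<delta> * J (u x t / \<delta>) - max 0 (u x t)\<bar> \<le> B * (2 * \<delta>)"
        using B(2)[of x] x pL[OF t] lo B(1) by (intro mult_mono) auto
      then show "\<bar>g x * (\<delta> * J (u x t / \<delta>)) - g x * max 0 (u x t)\<bar> \<le> B * (2 * \<delta>)"
        by (simp add: right_diff_distrib[symmetric] abs_mult)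
    qed
    also have "\<dots> \<le> B * (2 * \<delta>) * (2 * L)"
      using pL[OF t] lo B(1) \<open>0 < \<delta>\<close> by (intro mult_left_mono) auto
    finally show ?thesis .
  qed
  have Z_bound: "X T - X s \<le> integral {s..T} Y + integral {s..T} (\<lambda>t. ?k t * \<phi> (p t - a))
      - integral {s..T} (\<lambda>t. ?k t * \<phi> (p t)) + (2 * B0 * (T - s)) * (1 / Z)" if "1 \<le> Z" for Z
  proof -
    have "0 < Z" using that by simp
    \<comment> \<open>The factor \<open>d / (2 * Z)\<close> makes the window of width
      \<open>\<delta> n * Z\<close> fit into the distance \<open>d\<close> between \<open>lo\<close>
      and \<open>p\<close>.\<close>
    define \<delta> where "\<delta> n = d / (2 * Z) / real (Suc n)" for n
    have \<delta>0: "0 < \<delta> n" for n using \<open>0 < Z\<close> \<open>0 < d\<close> by (simp add: \<delta>_def)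
    have \<delta>le: "\<delta> n * Z < d" "\<delta> n \<le> d" for n
    proof -
      have "\<delta> n \<le> d / (2 * Z)"
        using \<open>0 < Z\<close> \<open>0 < d\<close> divide_left_mono[of 1 "real (Suc n)" "d / (2 * Z)"] by (simp add: \<delta>_def)
      then have "\<delta> n * Z \<le> d / (2 * Z) * Z" using \<open>0 < Z\<close> by (intro mult_right_mono) auto
      then show *: "\<delta> n * Z < d" using \<open>0 < Z\<close> \<open>0 < d\<close> by simp
      have "\<delta> n * 1 \<le> \<delta> n * Z" using \<delta>0[of n] that by (intro mult_left_mono) auto
      then show "\<delta> n \<le> d" using * by simp
    qed
    have \<delta>lim: "\<delta> \<longlonglongrightarrow> 0"
    proof -
      have "(\<lambda>n. d / (2 * Z) * inverse (real (Suc n))) \<longlonglongrightarrow> d / (2 * Z) * 0"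
        by (intro tendsto_mult tendsto_const LIMSEQ_inverse_real_of_nat)
      moreover have "\<delta> = (\<lambda>n. d / (2 * Z) * inverse (real (Suc n)))"
        by (rule ext) (simp only: \<delta>_def divide_inverse)
      ultimately show ?thesis by (simp only: mult_zero_right)
    qed
    define R where "R n = kato_rate lo s T (\<delta> n * Z) \<phi> \<phi>1 \<phi>2
        (\<lambda>v. \<delta> n * J (v / \<delta> n)) (\<lambda>v. J1 (v / \<delta> n)) (\<lambda>v. J2 (v / \<delta> n) / \<delta> n)" for n
    have chain: "((\<lambda>v. \<delta> n * J (v / \<delta> n)) has_real_derivative J1 (v / \<delta> n)) (at v)"
      "((\<lambda>v. J1 (v / \<delta> n)) has_real_derivative J2 (v / \<delta> n) / \<delta> n) (at v)"
      "continuous_on UNIV (\<lambda>v. J2 (v / \<delta> n) / \<delta> n)" for n v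
    proof -
      have lin: "((\<lambda>v. v / \<delta> n) has_real_derivative 1 / \<delta> n) (at v)"
        using DERIV_cdivide[OF DERIV_ident] .
      show "((\<lambda>v. \<delta> n * J (v / \<delta> n)) has_real_derivative J1 (v / \<delta> n)) (at v)"
        using DERIV_cmult[OF DERIV_chain2[OF J(1) lin], of "\<delta> n"] \<delta>0[of n] by simp
      show "((\<lambda>v. J1 (v / \<delta> n)) has_real_derivative J2 (v / \<delta> n) / \<delta> n) (at v)"
        using DERIV_chain2[OF J(2) lin] by simp
      show "continuous_on UNIV (\<lambda>v. J2 (v / \<delta> n) / \<delta> n)"
        using \<delta>0[of n] by (intro continuous_intros continuous_on_comp_UNIV[OF J(3)]) auto
    qed
    have R_int: "R n integrable_on {s..T}" for n
      unfolding R_def using \<delta>0[of n] \<open>0 < Z\<close> \<delta>le[of n]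
      by (intro kato_rate_integrable[OF times lo d _ _ \<phi>c \<phi>(3) cont[OF chain(1)] cont[OF chain(2)] chain(3)]) auto
    have ineq: "integral {lo..p T} (\<lambda>x. \<phi> x * (\<delta> n * J (u x T / \<delta> n))) - integral {lo..p s} (\<lambda>x. \<phi> x * (\<delta> n * J (u x s / \<delta> n)))
        \<le> integral {s..T} (R n) + integral {s..T} (\<lambda>t. ?k t * \<phi> (p t - a))" for n
      unfolding R_def
    \<comment> \<open>The constant is a sum so that it covers both Lipschitz bounds: rescaling gives
      \<open>M / \<delta> n\<close> for the first derivative and
      \<open>M / (\<delta> n * \<delta> n)\<close> for the second.\<close>
    proof (rule kato_convex[OF times lo d _ _ \<phi> \<phi>0 \<phi>lo chain, where M = "M / \<delta> n + M / (\<delta> n * \<delta> n)"])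
      show "0 \<le> \<delta> n * Z" "\<delta> n * Z < d" using \<delta>0[of n] \<open>0 < Z\<close> \<delta>le by auto
      show "0 \<le> J1 (v / \<delta> n) \<and> J1 (v / \<delta> n) \<le> 1" for v by (rule J(4))
      show "0 \<le> J2 (v / \<delta> n) / \<delta> n" for v using J(5) \<delta>0[of n] by simp
      show "\<bar>J1 (v / \<delta> n) - J1 (w / \<delta> n)\<bar> \<le> (M / \<delta> n + M / (\<delta> n * \<delta> n)) * \<bar>v - w\<bar>" for v w
      proof -
        have "\<bar>J1 (v / \<delta> n) - J1 (w / \<delta> n)\<bar> \<le> M / \<delta> n * \<bar>v - w\<bar>"
          using J(7)[of "v / \<delta> n" "w / \<delta> n"] \<delta>0[of n] by (simp add: diff_divide_distrib[symmetric] abs_divide)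
        also have "\<dots> \<le> (M / \<delta> n + M / (\<delta> n * \<delta> n)) * \<bar>v - w\<bar>"
          using J(6) \<delta>0[of n] by (intro mult_right_mono) auto
        finally show ?thesis .
      qed
      show "\<bar>J2 (v / \<delta> n) / \<delta> n - J2 (w / \<delta> n) / \<delta> n\<bar> \<le> (M / \<delta> n + M / (\<delta> n * \<delta> n)) * \<bar>v - w\<bar>" for v w
      proof -
        have "\<bar>J2 (v / \<delta> n) - J2 (w / \<delta> n)\<bar> / \<delta> n \<le> M * \<bar>v / \<delta> n - w / \<delta> n\<bar> / \<delta> n"
          using J(8)[of "v / \<delta> n" "w / \<delta> n"] \<delta>0[of n] by (intro divide_right_mono) auto
        then have "\<bar>J2 (v / \<delta> n) / \<delta> n - J2 (w / \<delta> n) / \<delta> n\<bar> \<le> M / (\<delta> n * \<delta> n) * \<bar>v - w\<bar>"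
          using \<delta>0[of n] by (simp add: diff_divide_distrib[symmetric] abs_divide)
        also have "\<dots> \<le> (M / \<delta> n + M / (\<delta> n * \<delta> n)) * \<bar>v - w\<bar>"
          using J(6) \<delta>0[of n] by (intro mult_right_mono) auto
        finally show ?thesis .
      qed
      show "0 < \<delta> n" by (rule \<delta>0)
      show "\<delta> n * J (v / \<delta> n) = 0 \<and> J1 (v / \<delta> n) = 0" if "v \<le> \<delta> n" for v
        using J(9)[of "v / \<delta> n"] that \<delta>0[of n] by (simp add: divide_le_eq)
    qed
    \<comment> \<open>Limit of \<open>R n\<close> as \<open>\<delta> n\<close> tends to 0: the
      window integral with \<open>\<phi>1\<close> disappears with the window, the other two boundary
      terms keep their size and see the linearised solution.\<close>
    define G where "G t = Y t - ?k t * (2 * (\<phi> (p t) * J1 (?k t * Z))) + (?k t)\<^sup>2 * integral {0..Z} (\<lambda>z. \<phi> (p t) * J2 (?k t * z))" for t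
    \<comment> \<open>A bound on \<open>R n t\<close> uniform in \<open>n\<close> and
      \<open>t\<close>, one summand for each part of \<open>kato_rate\<close>; it is the dominating
      function in time.\<close>
    define Hb where "Hb = B2 * (C * (2 * L) + 2 * d) * (2 * L) + C * (2 * B0 + 2 * (B1 * d)) + C\<^sup>2 * (B0 * M * Z)"
    \<comment> \<open>In the variable \<open>x = p t - \<delta> n * z\<close> the length element
      absorbs the factor \<open>1 / \<delta> n\<close> of the second derivative, so this term
      neither vanishes nor blows up.\<close>
    have rescale: "integral {p t - \<delta> n * Z..p t} (\<lambda>x. \<phi> x * (J2 (u x t / \<delta> n) / \<delta> n))
        = integral {0..Z} (\<lambda>z. \<phi> (p t - \<delta> n * z) * J2 (u (p t - \<delta> n * z) t / \<delta> n))"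
      and rescale_cont: "(\<lambda>z. \<phi> (p t - \<delta> n * z) * J2 (u (p t - \<delta> n * z) t / \<delta> n)) integrable_on {0..Z}"
      if t: "t \<in> {s..T}" for t n
    proof -
      have c: "continuous_on {p t - \<delta> n * Z..p t} (\<lambda>x. \<phi> x * (J2 (u x t / \<delta> n) / \<delta> n))"
        by (rule u_slice_continuous[OF pL(4)[OF t] _ pL(2)[OF t] \<phi>c(1) chain(3)])
          (use pL[OF t] lo \<delta>le[of n] in auto)
      show "integral {p t - \<delta> n * Z..p t} (\<lambda>x. \<phi> x * (J2 (u x t / \<delta> n) / \<delta> n))
        = integral {0..Z} (\<lambda>z. \<phi> (p t - \<delta> n * z) * J2 (u (p t - \<delta> n * z) t / \<delta> n))"
        unfolding integral_rescale_left[OF \<delta>0 c] using \<delta>0[of n]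
        by (subst integral_mult_right[symmetric]) simp
      have "continuous_on {0..Z} (\<lambda>z. \<delta> n * (\<phi> (p t - \<delta> n * z) * (J2 (u (p t - \<delta> n * z) t / \<delta> n) / \<delta> n)))"
        using \<delta>0[of n] by (intro continuous_intros continuous_on_compose2[OF c, of _ "\<lambda>z. p t - \<delta> n * z"]) auto
      then show "(\<lambda>z. \<phi> (p t - \<delta> n * z) * J2 (u (p t - \<delta> n * z) t / \<delta> n)) integrable_on {0..Z}"
        using \<delta>0[of n] by (intro integrable_continuous_interval) (simp add: mult.left_commute)
    qed
    have inL: "x \<in> {-L..L}" if "t \<in> {s..T}" "x \<in> {p t - d..p t}" for x t
      using pL[OF that(1)] that(2) lo by auto
    have scaled_in: "p t - \<delta> n * z \<in> {p t - d..p t}" if "z \<in> {0..Z}" for t n z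
    proof -
      have "0 \<le> \<delta> n * z" "\<delta> n * z \<le> \<delta> n * Z"
        using that \<delta>0[of n] by (auto intro: mult_left_mono)
      then show ?thesis using \<delta>le[of n] by auto
    qed
    have middle: "\<bar>integral {p t - \<delta> n * Z..p t} (\<lambda>x. \<phi>1 x * J1 (u x t / \<delta> n))\<bar> \<le> B1 * (\<delta> n * Z)" if t: "t \<in> {s..T}" for t n
    proof -
      have "norm (integral {p t - \<delta> n * Z..p t} (\<lambda>x. \<phi>1 x * J1 (u x t / \<delta> n))) \<le> B1 * (p t - (p t - \<delta> n * Z))"
      proof (rule integral_bound)
        show "p t - \<delta> n * Z \<le> p t" using \<delta>0[of n] \<open>0 < Z\<close> by simp
        show "continuous_on {p t - \<delta> n * Z..p t} (\<lambda>x. \<phi>1 x * J1 (u x t / \<delta> n))"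
          by (rule u_slice_continuous[OF pL(4)[OF t] _ pL(2)[OF t] \<phi>c(2) cont[OF chain(2)]])
            (use pL[OF t] lo \<delta>le[of n] in auto)
        fix x assume x: "x \<in> {p t - \<delta> n * Z..p t}"
        have "\<bar>\<phi>1 x\<bar> * \<bar>J1 (u x t / \<delta> n)\<bar> \<le> B1 * 1"
          using B1 J(4) inL[OF t, of x] x \<delta>le[of n] by (intro mult_mono) auto
        then show "norm (\<phi>1 x * J1 (u x t / \<delta> n)) \<le> B1" by (simp add: abs_mult)
      qed
      then show ?thesis by simp
    qed
    have J2b: "\<bar>J2 v\<bar> \<le> M" for v using J(5,12) by simp
    have R_limit: "(\<forall>n. norm (R n t) \<le> Hb) \<and> (\<lambda>n. R n t) \<longlonglongrightarrow> G t" if t: "t \<in> {s..T}" for t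
    proof (intro conjI allI)
      have Yb: "\<bar>Y t\<bar> \<le> B2 * (C * (2 * L)) * (2 * L)"
      proof -
        have "norm (Y t) \<le> B2 * (C * (2 * L)) * (p t - lo)"
          unfolding Y_def
        proof (rule integral_bound)
          show "continuous_on {lo..p t} (\<lambda>x. \<phi>2 x * max 0 (u x t))"
            by (rule u_slice_continuous[OF pL(4)[OF t] _ pL(2)[OF t] \<phi>(3) maxc]) (use lo in auto)
          fix x assume x: "x \<in> {lo..p t}"
          have "\<bar>u x t\<bar> \<le> C * \<bar>x - p t\<bar>"
            by (rule u_bound_near_p[OF pL(4)[OF t]]) (use C t x lo pL[OF t] in auto)
          also have "\<dots> \<le> C * (2 * L)"
            using x lo pL[OF t] C0 by (intro mult_left_mono) auto
          finally have "\<bar>\<phi>2 x\<bar> * \<bar>max 0 (u x t)\<bar> \<le> B2 * (C * (2 * L))"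
            using B2 x lo pL[OF t] by (intro mult_mono) auto
          then show "norm (\<phi>2 x * max 0 (u x t)) \<le> B2 * (C * (2 * L))" by (simp add: abs_mult)
        qed (use pL[OF t] in auto)
        also have "\<dots> \<le> B2 * (C * (2 * L)) * (2 * L)"
          using pL[OF t] lo B2(1) C0 Lpos by (intro mult_left_mono) auto
        finally show ?thesis by simp
      qed
      show "norm (R n t) \<le> Hb" for n
      proof -
        have 1: "\<bar>integral {lo..p t} (\<lambda>x. \<phi>2 x * (\<delta> n * J (u x t / \<delta> n)))\<bar> \<le> B2 * (C * (2 * L) + 2 * d) * (2 * L)"
        proof -
          have "B2 * (2 * \<delta> n) * (2 * L) \<le> B2 * (2 * d) * (2 * L)"
            using \<delta>le(2)[of n] B2(1) Lpos by (intro mult_right_mono mult_left_mono) auto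
          then show ?thesis
            using approx[OF t \<delta>0[of n] \<phi>(3) B2] Yb unfolding Y_def by (simp add: algebra_simps)
        qed
        have ph: "p t - \<delta> n * Z \<in> {p t - d..p t}" using scaled_in[of Z t n] \<open>0 < Z\<close> by simp
        have "\<bar>\<phi> (p t - \<delta> n * Z)\<bar> * \<bar>J1 (u (p t - \<delta> n * Z) t / \<delta> n)\<bar> \<le> B0 * 1"
          using B0(2)[OF inL[OF t ph]] J(4) B0(1) by (intro mult_mono) auto
        then have 2: "\<bar>\<phi> (p t - \<delta> n * Z) * J1 (u (p t - \<delta> n * Z) t / \<delta> n)\<bar> \<le> B0"
          by (simp add: abs_mult)
        have "B1 * (\<delta> n * Z) \<le> B1 * d" using \<delta>le[of n] B1(1) by (intro mult_left_mono) auto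
        then have 3: "\<bar>integral {p t - \<delta> n * Z..p t} (\<lambda>x. \<phi>1 x * J1 (u x t / \<delta> n))\<bar> \<le> B1 * d"
          using middle[OF t, of n] by simp
        have 4: "\<bar>integral {0..Z} (\<lambda>z. \<phi> (p t - \<delta> n * z) * J2 (u (p t - \<delta> n * z) t / \<delta> n))\<bar> \<le> B0 * M * Z"
        proof -
          have "norm (integral {0..Z} (\<lambda>z. \<phi> (p t - \<delta> n * z) * J2 (u (p t - \<delta> n * z) t / \<delta> n))) \<le> integral {0..Z} (\<lambda>_. B0 * M)"
          proof (rule integral_norm_bound_integral[OF rescale_cont[OF t] integrable_const_ivl])
            fix z assume z: "z \<in> {0..Z}"
            have "\<bar>\<phi> (p t - \<delta> n * z)\<bar> * \<bar>J2 (u (p t - \<delta> n * z) t / \<delta> n)\<bar> \<le> B0 * M"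
              using B0(2)[OF inL[OF t scaled_in[OF z]]] J2b B0(1) by (intro mult_mono) auto
            then show "norm (\<phi> (p t - \<delta> n * z) * J2 (u (p t - \<delta> n * z) t / \<delta> n)) \<le> B0 * M"
              by (simp add: abs_mult)
          qed
          then show ?thesis using \<open>0 < Z\<close> by (simp add: mult_ac)
        qed
        define P where "P = 2 * (\<phi> (p t - \<delta> n * Z) * J1 (u (p t - \<delta> n * Z) t / \<delta> n)) + 2 * integral {p t - \<delta> n * Z..p t} (\<lambda>x. \<phi>1 x * J1 (u x t / \<delta> n))"
        define Q where "Q = integral {0..Z} (\<lambda>z. \<phi> (p t - \<delta> n * z) * J2 (u (p t - \<delta> n * z) t / \<delta> n))"
        have "\<bar>P\<bar> \<le> 2 * B0 + 2 * (B1 * d)"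
          using 2 3 unfolding P_def by linarith
        then have "\<bar>?k t * P\<bar> \<le> C * (2 * B0 + 2 * (B1 * d))"
          unfolding abs_mult using k[of t] C0 by (intro mult_mono) auto
        moreover have "\<bar>(?k t)\<^sup>2 * Q\<bar> \<le> C\<^sup>2 * (B0 * M * Z)"
          unfolding abs_mult using k[of t] C0 4 by (intro mult_mono) (auto simp: Q_def intro!: power_mono)
        moreover have "R n t = integral {lo..p t} (\<lambda>x. \<phi>2 x * (\<delta> n * J (u x t / \<delta> n))) - ?k t * P + (?k t)\<^sup>2 * Q"
          unfolding R_def kato_rate_def rescale[OF t] P_def Q_def ..
        ultimately show ?thesis
          using 1 unfolding Hb_def real_norm_def by linarith
      qed
      show "(\<lambda>n. R n t) \<longlonglongrightarrow> G t"
      proof -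
        have l1: "(\<lambda>n. integral {lo..p t} (\<lambda>x. \<phi>2 x * (\<delta> n * J (u x t / \<delta> n)))) \<longlonglongrightarrow> Y t"
        proof (rule LIM_zero_cancel, rule Lim_null_comparison)
          show "\<forall>\<^sub>F n in sequentially. norm (integral {lo..p t} (\<lambda>x. \<phi>2 x * (\<delta> n * J (u x t / \<delta> n))) - Y t) \<le> B2 * (2 * \<delta> n) * (2 * L)"
            using approx[OF t \<delta>0 \<phi>(3) B2] unfolding Y_def by simp
          have "(\<lambda>n. B2 * (2 * \<delta> n) * (2 * L)) \<longlonglongrightarrow> B2 * (2 * 0) * (2 * L)"
            by (intro tendsto_intros \<delta>lim)
          then show "(\<lambda>n. B2 * (2 * \<delta> n) * (2 * L)) \<longlonglongrightarrow> 0" by simp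
        qed
        have l3: "(\<lambda>n. integral {p t - \<delta> n * Z..p t} (\<lambda>x. \<phi>1 x * J1 (u x t / \<delta> n))) \<longlonglongrightarrow> 0"
        proof (rule Lim_null_comparison)
          show "\<forall>\<^sub>F n in sequentially. norm (integral {p t - \<delta> n * Z..p t} (\<lambda>x. \<phi>1 x * J1 (u x t / \<delta> n))) \<le> B1 * (\<delta> n * Z)"
            using middle[OF t] by simp
          have "(\<lambda>n. B1 * (\<delta> n * Z)) \<longlonglongrightarrow> B1 * (0 * Z)"
            by (intro tendsto_intros \<delta>lim)
          then show "(\<lambda>n. B1 * (\<delta> n * Z)) \<longlonglongrightarrow> 0" by simp
        qed
        have \<phi>lim: "(\<lambda>n. \<phi> (p t - \<delta> n * z)) \<longlonglongrightarrow> \<phi> (p t)" for z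
        proof -
          have "(\<lambda>n. p t - \<delta> n * z) \<longlonglongrightarrow> p t - 0 * z"
            by (intro tendsto_intros \<delta>lim)
          then show ?thesis
            using continuous_on_tendsto_compose[OF \<phi>c(1)[of UNIV]] by simp
        qed
        have Jlim: "(\<lambda>n. J1 (u (p t - \<delta> n * z) t / \<delta> n)) \<longlonglongrightarrow> J1 (\<kappa> t * z)"
          "(\<lambda>n. J2 (u (p t - \<delta> n * z) t / \<delta> n)) \<longlonglongrightarrow> J2 (\<kappa> t * z)" if "0 \<le> z" for z
          using continuous_on_tendsto_compose[OF Jc(2)[of UNIV] blow_up_limit[OF pL(4)[OF t] that \<delta>0 \<delta>lim]]
            continuous_on_tendsto_compose[OF J(3) blow_up_limit[OF pL(4)[OF t] that \<delta>0 \<delta>lim]] by simp_all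
        have l2: "(\<lambda>n. \<phi> (p t - \<delta> n * Z) * J1 (u (p t - \<delta> n * Z) t / \<delta> n)) \<longlonglongrightarrow> \<phi> (p t) * J1 (\<kappa> t * Z)"
          using \<open>0 < Z\<close> by (intro tendsto_mult \<phi>lim Jlim) auto
        have l4: "(\<lambda>n. integral {0..Z} (\<lambda>z. \<phi> (p t - \<delta> n * z) * J2 (u (p t - \<delta> n * z) t / \<delta> n)))
            \<longlonglongrightarrow> integral {0..Z} (\<lambda>z. \<phi> (p t) * J2 (\<kappa> t * z))"
        proof (rule dominated_convergence(2)[OF rescale_cont[OF t], where h = "\<lambda>_. B0 * M"])
          show "(\<lambda>_. B0 * M) integrable_on {0..Z}" by (rule integrable_const_ivl)
          fix z assume z: "z \<in> {0..Z}"
          show "(\<lambda>n. \<phi> (p t - \<delta> n * z) * J2 (u (p t - \<delta> n * z) t / \<delta> n)) \<longlonglongrightarrow> \<phi> (p t) * J2 (\<kappa> t * z)"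
            using z by (intro tendsto_mult \<phi>lim Jlim) auto
          fix n
          have "\<bar>\<phi> (p t - \<delta> n * z)\<bar> * \<bar>J2 (u (p t - \<delta> n * z) t / \<delta> n)\<bar> \<le> B0 * M"
            using B0(2)[OF inL[OF t scaled_in[OF z]]] J2b B0(1) by (intro mult_mono) auto
          then show "norm (\<phi> (p t - \<delta> n * z) * J2 (u (p t - \<delta> n * z) t / \<delta> n)) \<le> B0 * M"
            by (simp add: abs_mult)
        qed
        have "(\<lambda>n. R n t) \<longlonglongrightarrow> Y t - ?k t * (2 * (\<phi> (p t) * J1 (\<kappa> t * Z)) + 2 * 0) + (?k t)\<^sup>2 * integral {0..Z} (\<lambda>z. \<phi> (p t) * J2 (\<kappa> t * z))"
          unfolding R_def kato_rate_def rescale[OF t] by (intro tendsto_intros l1 l2 l3 l4)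
        also have "Y t - ?k t * (2 * (\<phi> (p t) * J1 (\<kappa> t * Z)) + 2 * 0) + (?k t)\<^sup>2 * integral {0..Z} (\<lambda>z. \<phi> (p t) * J2 (\<kappa> t * z)) = G t"
        \<comment> \<open>The blow-up produces \<open>\<kappa>\<close>, whereas \<open>G\<close>
          contains its positive part; where the two differ, the prefactor
          \<open>positive_flux\<close> is 0.\<close>
        proof (cases "0 < \<kappa> t")
          case True
          then have "?k t = \<kappa> t" using t by (simp add: positive_flux_def)
          then show ?thesis by (simp add: G_def)
        next
          case False
          then have "?k t = 0" using t by (simp add: positive_flux_def)
          then show ?thesis by (simp add: G_def)
        qed
        finally show ?thesis .
      qed
    qed
    have dct: "G integrable_on {s..T}" "(\<lambda>n. integral {s..T} (R n)) \<longlonglongrightarrow> integral {s..T} G"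
    proof -
      have Rb: "norm (R n t) \<le> Hb" and Rl: "(\<lambda>n. R n t) \<longlonglongrightarrow> G t" if "t \<in> {s..T}" for n t
        using R_limit[OF that] by auto
      note dc = dominated_convergence[where f = R and g = G and h = "\<lambda>_. Hb", OF R_int integrable_const_ivl]
      show "G integrable_on {s..T}" by (rule dc(1)) (rule Rb Rl, assumption)+
      show "(\<lambda>n. integral {s..T} (R n)) \<longlonglongrightarrow> integral {s..T} G" by (rule dc(2)) (rule Rb Rl, assumption)+
    qed
    have lim: "(\<lambda>n. integral {lo..p t} (\<lambda>x. \<phi> x * (\<delta> n * J (u x t / \<delta> n)))) \<longlonglongrightarrow> X t" if t: "t \<in> {s..T}" for t
    proof (rule LIM_zero_cancel, rule Lim_null_comparison)
      show "\<forall>\<^sub>F n in sequentially. norm (integral {lo..p t} (\<lambda>x. \<phi> x * (\<delta> n * J (u x t / \<delta> n))) - X t) \<le> B0 * (2 * \<delta> n) * (2 * L)"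
        using approx[OF t \<delta>0 \<phi>c(1) B0] unfolding X_def by simp
      have "(\<lambda>n. B0 * (2 * \<delta> n) * (2 * L)) \<longlonglongrightarrow> B0 * (2 * 0) * (2 * L)"
        by (intro tendsto_intros \<delta>lim)
      then show "(\<lambda>n. B0 * (2 * \<delta> n) * (2 * L)) \<longlonglongrightarrow> 0" by simp
    qed
    have "X T - X s \<le> integral {s..T} G + integral {s..T} (\<lambda>t. ?k t * \<phi> (p t - a))"
    proof (rule LIMSEQ_le)
      show "(\<lambda>n. integral {lo..p T} (\<lambda>x. \<phi> x * (\<delta> n * J (u x T / \<delta> n))) - integral {lo..p s} (\<lambda>x. \<phi> x * (\<delta> n * J (u x s / \<delta> n)))) \<longlonglongrightarrow> X T - X s"
        using times by (intro tendsto_diff lim) auto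
      show "(\<lambda>n. integral {s..T} (R n) + integral {s..T} (\<lambda>t. ?k t * \<phi> (p t - a))) \<longlonglongrightarrow> integral {s..T} G + integral {s..T} (\<lambda>t. ?k t * \<phi> (p t - a))"
        using dct by (intro tendsto_intros) auto
    qed (use ineq in auto)
    also have "integral {s..T} G \<le> integral {s..T} (\<lambda>t. Y t - ?k t * \<phi> (p t) + 2 * B0 * (1 / Z))"
    proof (rule integral_le)
      show "G integrable_on {s..T}" using dct by simp
      show "(\<lambda>t. Y t - ?k t * \<phi> (p t) + 2 * B0 * (1 / Z)) integrable_on {s..T}"
        by (intro integrable_add integrable_diff Y_int k\<phi>_int0 integrable_const_ivl)
      fix t assume t: "t \<in> {s..T}"
      let ?\<kappa> = "?k t"
      \<comment> \<open>\<open>?\<kappa> * J2 (?\<kappa> * z)\<close> is the derivative of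
        \<open>J1 (?\<kappa> * z)\<close>. The quadratic term therefore gives back one of the two
        copies of \<open>\<phi> (p t) * ?\<kappa> * J1 (?\<kappa> * Z)\<close> subtracted in
        \<open>G\<close>.\<close>
      have "((\<lambda>z. ?\<kappa> * J2 (?\<kappa> * z)) has_integral (J1 (?\<kappa> * Z) - J1 (?\<kappa> * 0))) {0..Z}"
        using \<open>0 < Z\<close>
      proof (intro has_integral_derivative)
        show "((\<lambda>z. J1 (?\<kappa> * z)) has_real_derivative ?\<kappa> * J2 (?\<kappa> * z)) (at z)" for z
          using DERIV_chain2[OF J(2) DERIV_cmult_Id, of ?\<kappa> z] by (simp add: mult.commute)
      qed simp
      then have "integral {0..Z} (\<lambda>z. ?\<kappa> * J2 (?\<kappa> * z)) = J1 (?\<kappa> * Z) - J1 (?\<kappa> * 0)"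
        by (rule integral_unique)
      then have "?\<kappa> * integral {0..Z} (\<lambda>z. J2 (?\<kappa> * z)) = J1 (?\<kappa> * Z) - J1 (?\<kappa> * 0)"
        by (simp only: integral_mult_right)
      then have "?\<kappa> * integral {0..Z} (\<lambda>z. J2 (?\<kappa> * z)) = J1 (?\<kappa> * Z)"
        using J(9)[of 0] by simp
      moreover have "integral {0..Z} (\<lambda>z. \<phi> (p t) * J2 (?\<kappa> * z)) = \<phi> (p t) * integral {0..Z} (\<lambda>z. J2 (?\<kappa> * z))"
        by (rule integral_mult_right)
      ultimately have "?\<kappa>\<^sup>2 * integral {0..Z} (\<lambda>z. \<phi> (p t) * J2 (?\<kappa> * z)) = ?\<kappa> * (\<phi> (p t) * J1 (?\<kappa> * Z))"
        by (simp add: power2_eq_square mult_ac)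
      then have G_eq: "G t = Y t - \<phi> (p t) * (?\<kappa> * J1 (?\<kappa> * Z))"
        by (simp add: G_def mult_ac)
      \<comment> \<open>Either \<open>2 \<le> ?\<kappa> * Z\<close>, where \<open>J1\<close> has
        reached 1 and nothing is lost, or \<open>?\<kappa>\<close> itself is below
        \<open>2 / Z\<close>.\<close>
      have "?\<kappa> - ?\<kappa> * J1 (?\<kappa> * Z) \<le> 2 / Z"
      proof (cases "2 \<le> ?\<kappa> * Z")
        case True
        then show ?thesis using J(10)[OF True] \<open>0 < Z\<close> by simp
      next
        case False
        then have "?\<kappa> \<le> 2 / Z" using \<open>0 < Z\<close> by (simp add: pos_le_divide_eq)
        moreover have "0 \<le> ?\<kappa> * J1 (?\<kappa> * Z)" using J(4) k by simp
        ultimately show ?thesis by linarith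
      qed
      then have "\<phi> (p t) * (?\<kappa> - ?\<kappa> * J1 (?\<kappa> * Z)) \<le> \<phi> (p t) * (2 / Z)"
        using \<phi>0[OF pL(2)[OF t]] by (rule mult_left_mono)
      also have "\<dots> \<le> B0 * (2 / Z)"
        using B0(2)[of "p t"] pL[OF t] lo \<open>0 < Z\<close> by (intro mult_right_mono) auto
      finally show "G t \<le> Y t - ?k t * \<phi> (p t) + 2 * B0 * (1 / Z)"
        unfolding G_eq by (simp add: algebra_simps)
    qed
    also have "integral {s..T} (\<lambda>t. Y t - ?k t * \<phi> (p t) + 2 * B0 * (1 / Z))
        = integral {s..T} (\<lambda>t. Y t - ?k t * \<phi> (p t)) + integral {s..T} (\<lambda>t. 2 * B0 * (1 / Z))"
      by (intro Henstock_Kurzweil_Integration.integral_add integrable_diff Y_int k\<phi>_int0 integrable_const_ivl)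
    also have "integral {s..T} (\<lambda>t. Y t - ?k t * \<phi> (p t)) = integral {s..T} Y - integral {s..T} (\<lambda>t. ?k t * \<phi> (p t))"
      by (intro Henstock_Kurzweil_Integration.integral_diff Y_int k\<phi>_int0)
    also have "integral {s..T} (\<lambda>t. 2 * B0 * (1 / Z)) = 2 * B0 * (T - s) * (1 / Z)"
      using times by simp
    finally show ?thesis by simp
  qed
  have "X T - X s \<le> integral {s..T} Y + integral {s..T} (\<lambda>t. ?k t * \<phi> (p t - a)) - integral {s..T} (\<lambda>t. ?k t * \<phi> (p t))"
  proof (rule le_if_le_plus_small[of 1])
    fix e :: real assume e: "0 < e" "e \<le> 1"
    then show "X T - X s \<le> integral {s..T} Y + integral {s..T} (\<lambda>t. ?k t * \<phi> (p t - a)) - integral {s..T} (\<lambda>t. ?k t * \<phi> (p t)) + (2 * B0 * (T - s)) * e"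
      using Z_bound[of "1 / e"] by simp
  qed simp
  then show ?thesis unfolding X_def Y_def .
qed

end

section \<open>Weights up to the wall: the Neumann condition\<close>

lemma cutoff_error:
  fixes f \<psi> :: "real \<Rightarrow> real"
  assumes f: "continuous_on {lo..c} f" and \<psi>: "continuous_on UNIV \<psi>" "\<And>x. 0 \<le> \<psi> x \<and> \<psi> x \<le> 1" "\<And>x. 2 \<le> x \<Longrightarrow> \<psi> x = 1"
    and K: "\<And>x. x \<in> {lo..c} \<Longrightarrow> \<bar>f x\<bar> \<le> K" and m: "0 < m" "lo + 2 / m \<le> c"
  shows "\<bar>integral {lo..c} (\<lambda>x. f x * \<psi> (m * (x - lo))) - integral {lo..c} f\<bar> \<le> K * (2 / m)"
proof -
  let ?e = "lo + 2 / m"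
  have e: "lo \<le> ?e" using m by simp
  have \<psi>c: "continuous_on S (\<lambda>x. \<psi> (m * (x - lo)))" for S
    by (intro continuous_on_comp_UNIV[OF \<psi>(1)] continuous_intros)
  have f1: "continuous_on {lo..c} (\<lambda>x. f x * \<psi> (m * (x - lo)))"
    by (intro continuous_on_mult f \<psi>c)
  have sub: "continuous_on {lo..?e} g" "continuous_on {?e..c} g" if "continuous_on {lo..c} g" for g :: "real \<Rightarrow> real"
    using order_trans[OF e] order_trans[OF _ m(2)] by (auto intro: continuous_on_subset[OF that])
  have split: "integral {lo..c} g = integral {lo..?e} g + integral {?e..c} g" if "continuous_on {lo..c} g" for g :: "real \<Rightarrow> real"
    using that m e by (intro Henstock_Kurzweil_Integration.integral_combine[symmetric] integrable_continuous_interval) auto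
  have "integral {?e..c} (\<lambda>x. f x * \<psi> (m * (x - lo))) = integral {?e..c} f"
  proof (rule integral_cong)
    fix x assume "x \<in> {?e..c}"
    then have "2 / m \<le> x - lo" by simp
    then have "2 \<le> m * (x - lo)" using m by (simp add: pos_divide_le_eq mult.commute)
    then show "f x * \<psi> (m * (x - lo)) = f x" by (simp add: \<psi>(3))
  qed
  moreover have "\<bar>integral {lo..?e} (\<lambda>x. f x * \<psi> (m * (x - lo))) - integral {lo..?e} f\<bar> \<le> K * (?e - lo)"
  proof (rule integral_diff_bound[OF sub(1)[OF f1] sub(1)[OF f] e])
    fix x assume x: "x \<in> {lo..?e}"
    have "\<bar>f x * \<psi> (m * (x - lo)) - f x\<bar> = \<bar>f x\<bar> * (1 - \<psi> (m * (x - lo)))"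
    proof -
      have "f x * \<psi> (m * (x - lo)) - f x = - (f x * (1 - \<psi> (m * (x - lo))))"
        by (simp add: algebra_simps)
      then show ?thesis using \<psi>(2) by (simp add: abs_mult)
    qed
    also have "\<dots> \<le> K * 1"
      using K[of x] x m \<psi>(2)[of "m * (x - lo)"] by (intro mult_mono) auto
    finally show "\<bar>f x * \<psi> (m * (x - lo)) - f x\<bar> \<le> K" by simp
  qed
  ultimately show ?thesis
    using split[OF f] split[OF f1] by simp
qed

context weak_solution
begin

text \<open>\<open>kato_interior\<close> is applied to \<open>\<phi>\<close> times a cutoff that
  rises in a layer of width of order \<open>1 / m n\<close> at \<open>-L\<close>. The second
  derivative of this weight is of order \<open>(m n)\<^sup>2\<close>, and the width of the layer
  compensates only one factor. The limit exists because \<open>\<phi> * max 0 u\<close> has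
  derivative 0 at \<open>-L\<close>, by the Neumann condition and \<open>\<phi>1 (-L) = 0\<close>,
  and because the second derivative of the step has integral 0.\<close>

lemma kato:
  fixes \<phi> \<phi>1 \<phi>2 :: "real \<Rightarrow> real"
  defines "src \<equiv> \<lambda>t. if -L < p t - a then \<phi> (p t - a) else 0"
  assumes times: "0 < s" "s < T"
    and \<phi>: "\<And>x. (\<phi> has_real_derivative \<phi>1 x) (at x)" "\<And>x. (\<phi>1 has_real_derivative \<phi>2 x) (at x)"
      "continuous_on UNIV \<phi>2" and \<phi>0: "\<And>x. x \<in> {-L..L} \<Longrightarrow> 0 \<le> \<phi> x" and \<phi>L: "\<phi>1 (-L) = 0"
  shows "(\<lambda>t. positive_flux s T t * src t) integrable_on {s..T}"
    and "integral {-L..p T} (\<lambda>x. \<phi> x * max 0 (u x T)) - integral {-L..p s} (\<lambda>x. \<phi> x * max 0 (u x s))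
      \<le> integral {s..T} (\<lambda>t. integral {-L..p t} (\<lambda>x. \<phi>2 x * max 0 (u x t)))
        + integral {s..T} (\<lambda>t. positive_flux s T t * src t)
        - integral {s..T} (\<lambda>t. positive_flux s T t * \<phi> (p t))"
proof -
  obtain \<psi> \<psi>1 \<psi>2 M where step: "smooth_step \<psi> \<psi>1 \<psi>2 M"
    by (rule smooth_step_exists)
  note \<psi> = smooth_stepD[OF step]
  have M0: "0 \<le> M" using \<psi>(5)[of 0] by simp
  have cont: "continuous_on A f" if "\<And>x. (f has_real_derivative f' x) (at x)" for A and f f' :: "real \<Rightarrow> real"
    using that by (meson DERIV_continuous_on has_field_derivative_at_within)
  note \<phi>c = cont[OF \<phi>(1)] cont[OF \<phi>(2)] and \<psi>c = cont[OF \<psi>(1)] cont[OF \<psi>(2)]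
  have maxc: "continuous_on S (\<lambda>v::real. max 0 v)" for S
    by (intro continuous_intros)
  obtain C where C: "\<forall>t\<in>{s..T}. C-lipschitz_on {-L..L} (\<lambda>x. u x t)"
    using u_lip[OF times] by blast
  have C0: "0 \<le> C" using C times lipschitz_on_nonneg by fastforce
  let ?k = "positive_flux s T"
  have k: "0 \<le> ?k t" "?k t \<le> C" for t
    using positive_flux_nonneg[of s T t] positive_flux_bound[OF times(1) C C0, of t] by auto
  have Lpos: "-L < L" using p_bounds[of s] times by auto
  obtain B0 where B0: "0 \<le> B0" "\<And>z. z \<in> {-L..L} \<Longrightarrow> \<bar>\<phi> z\<bar> \<le> B0"
    using bounded_on_Icc[OF \<phi>c(1)] by metis
  obtain B1 where B1: "0 \<le> B1" "\<And>z. z \<in> {-L..L} \<Longrightarrow> \<bar>\<phi>1 z\<bar> \<le> B1"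
    using bounded_on_Icc[OF \<phi>c(2)] by metis
  obtain B2 where B2: "0 \<le> B2" "\<And>z. z \<in> {-L..L} \<Longrightarrow> \<bar>\<phi>2 z\<bar> \<le> B2"
    using bounded_on_Icc[OF continuous_on_subset[OF \<phi>(3)]] by (metis subset_UNIV)
  obtain r where r: "0 < r" "\<And>t. t \<in> {s..T} \<Longrightarrow> -L + r < p t \<and> p t < L - r"
    using p_compact_bounds[OF times(1)] by blast
  have rL: "r < 2 * L" using r(1) r(2)[of s] times by auto
  have pc: "continuous_on {s..T} p" by (rule p_cont_subset[OF times(1)])
  define w where "w x t = max 0 (u x t)" for x t
  have w_cont: "continuous_on {-L..L} (\<lambda>x. w x t)" if "0 < t" for t
    using u_slice_continuous[OF that, of "-L" L "\<lambda>_. 1" "\<lambda>v. max 0 v"] maxc unfolding w_def by simp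
  have w_lip: "\<bar>w x t - w y t\<bar> \<le> C * \<bar>x - y\<bar>" if "t \<in> {s..T}" "x \<in> {-L..L}" "y \<in> {-L..L}" for t x y
  proof -
    have "\<bar>w x t - w y t\<bar> \<le> \<bar>u x t - u y t\<bar>" by (auto simp: w_def)
    also have "\<dots> \<le> C * \<bar>x - y\<bar>"
      using lipschitz_onD[of C "{-L..L}" "\<lambda>x. u x t" x y] C that by (simp add: dist_real_def)
    finally show ?thesis .
  qed
  have w_bound: "\<bar>w x t\<bar> \<le> C * (2 * L)" if "t \<in> {s..T}" "x \<in> {-L..L}" for t x
  proof -
    have t: "0 < t" and "p t \<in> {-L..L}" using that times p_bounds[of t] by auto
    then have "\<bar>w x t - w (p t) t\<bar> \<le> C * \<bar>x - p t\<bar>" using that by (intro w_lip)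
    also have "\<dots> \<le> C * (2 * L)" using that \<open>p t \<in> {-L..L}\<close> C0 by (intro mult_left_mono) auto
    finally show ?thesis using zero[OF t] by (simp add: w_def)
  qed
  \<comment> \<open>With \<open>4 / r\<close> the layer ends at \<open>-L + 2 / m n\<close>, at most
    \<open>r / 2\<close> from the wall and hence to the left of \<open>p\<close>, already for
    \<open>n = 0\<close>.\<close>
  define m where "m n = 4 / r + real n" for n
  have m: "0 < m n" "4 \<le> m n * r" for n
  proof -
    have "0 < 4 / r" using r(1) by simp
    then show "0 < m n" unfolding m_def by (rule add_pos_nonneg) simp
    have "m n * r = 4 + real n * r" using r(1) by (simp add: m_def distrib_right)
    then show "4 \<le> m n * r" using r(1) by simp
  qed
  have m_inv: "1 / m n \<le> r / 4" "2 / m n \<le> r / 2" for n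
    using m[of n] r(1) by (auto simp: pos_divide_le_eq field_simps)
  have m_lim: "(\<lambda>n. c / m n) \<longlonglongrightarrow> 0" for c
  proof -
    have "filterlim m at_top sequentially"
      unfolding m_def by (intro filterlim_tendsto_add_at_top[OF tendsto_const] filterlim_real_sequentially)
    then show ?thesis
      by (intro tendsto_divide_0[OF tendsto_const] filterlim_at_top_imp_at_infinity)
  qed
  define lo where "lo n = -L + 1 / m n" for n
  define \<Phi> where "\<Phi> n x = \<phi> x * \<psi> (m n * (x - (-L)))" for n x
  define \<Phi>1 where "\<Phi>1 n x = \<phi>1 x * \<psi> (m n * (x - (-L))) + \<phi> x * (m n * \<psi>1 (m n * (x - (-L))))" for n x
  define \<Phi>2 where "\<Phi>2 n x = \<phi>2 x * \<psi> (m n * (x - (-L))) + 2 * \<phi>1 x * (m n * \<psi>1 (m n * (x - (-L))))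
      + \<phi> x * ((m n)\<^sup>2 * \<psi>2 (m n * (x - (-L))))" for n x
  have lin: "((\<lambda>x. m n * (x - (-L))) has_real_derivative m n) (at x)" for n x
    by (auto intro!: derivative_eq_intros)
  have d\<psi>: "((\<lambda>x. \<psi> (m n * (x - (-L)))) has_real_derivative m n * \<psi>1 (m n * (x - (-L)))) (at x)"
    "((\<lambda>x. m n * \<psi>1 (m n * (x - (-L)))) has_real_derivative (m n)\<^sup>2 * \<psi>2 (m n * (x - (-L)))) (at x)" for n x
    using DERIV_chain2[OF \<psi>(1) lin[of n x]] DERIV_cmult[OF DERIV_chain2[OF \<psi>(2) lin[of n x]], of "m n"]
    by (simp_all add: power2_eq_square mult_ac)
  have d\<Phi>: "(\<Phi> n has_real_derivative \<Phi>1 n x) (at x)" "(\<Phi>1 n has_real_derivative \<Phi>2 n x) (at x)" for n x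
    unfolding \<Phi>_def[abs_def] \<Phi>1_def[abs_def] \<Phi>2_def
    using DERIV_mult[OF \<phi>(1)[of x] d\<psi>(1)[of n x]]
      DERIV_add[OF DERIV_mult[OF \<phi>(2)[of x] d\<psi>(1)[of n x]] DERIV_mult[OF \<phi>(1)[of x] d\<psi>(2)[of n x]]]
    by (simp_all add: algebra_simps)
  have \<Phi>2c: "continuous_on UNIV (\<Phi>2 n)" for n
    unfolding \<Phi>2_def[abs_def]
    by (intro continuous_on_add continuous_on_mult continuous_on_const \<phi>(3) \<phi>c
        continuous_on_comp_UNIV[OF \<psi>(3)] continuous_on_comp_UNIV[OF \<psi>c(1)] continuous_on_comp_UNIV[OF \<psi>c(2)] continuous_intros)
  have below: "\<psi> (m n * (x - (-L))) = 0" "\<psi>1 (m n * (x - (-L))) = 0" "\<psi>2 (m n * (x - (-L))) = 0" if "x \<le> lo n" for n x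
  proof -
    have "x - (-L) \<le> 1 / m n" using that by (simp add: lo_def)
    then have "m n * (x - (-L)) \<le> m n * (1 / m n)" using m(1)[of n] by (intro mult_left_mono) auto
    then have "m n * (x - (-L)) \<le> 1" using m(1)[of n] by simp
    then show "\<psi> (m n * (x - (-L))) = 0" "\<psi>1 (m n * (x - (-L))) = 0" "\<psi>2 (m n * (x - (-L))) = 0"
      using \<psi>(7) \<psi>(9) by auto
  qed
  have above: "\<psi> (m n * (x - (-L))) = 1" "\<psi>1 (m n * (x - (-L))) = 0" "\<psi>2 (m n * (x - (-L))) = 0" if "-L + 2 / m n \<le> x" for n x
  proof -
    have "2 / m n \<le> x - (-L)" using that by simp
    then have "m n * (2 / m n) \<le> m n * (x - (-L))" using m(1)[of n] by (intro mult_left_mono) auto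
    then have "2 \<le> m n * (x - (-L))" using m(1)[of n] by simp
    then show "\<psi> (m n * (x - (-L))) = 1" "\<psi>1 (m n * (x - (-L))) = 0" "\<psi>2 (m n * (x - (-L))) = 0"
      using \<psi>(8) \<psi>(9) by auto
  qed
  have lo: "-L < lo n" for n using m(1)[of n] by (simp add: lo_def)
  have lo_p: "lo n + r / 2 \<le> p t" "-L + 2 / m n \<le> p t" "p t \<in> {-L..L}" "0 < t" "p t \<le> L" "-L \<le> p t"
    if "t \<in> {s..T}" for n t
    using r(2)[OF that] m_inv[of n] r(1) that times by (auto simp: lo_def)
  have from_lo: "integral {lo n..p t} f = integral {-L..p t} f"
    if t: "t \<in> {s..T}" and f: "continuous_on {-L..p t} f" and z: "\<And>x. x \<le> lo n \<Longrightarrow> f x = 0" for n t and f :: "real \<Rightarrow> real"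
  proof -
    have "integral {-L..lo n} f + integral {lo n..p t} f = integral {-L..p t} f"
      using lo[of n] lo_p(1)[OF t, of n] r(1) f
      by (intro Henstock_Kurzweil_Integration.integral_combine integrable_continuous_interval) auto
    moreover have "integral {-L..lo n} f = integral {-L..lo n} (\<lambda>_. 0)"
      by (rule integral_cong) (simp add: z)
    ultimately show ?thesis by simp
  qed
  have gw_cont: "continuous_on {-L..p t} (\<lambda>x. g x * w x t)" if "t \<in> {s..T}" "continuous_on UNIV g" for t g
    using lo_p[OF that(1)] by (intro continuous_on_mult continuous_on_subset[OF that(2)] continuous_on_subset[OF w_cont]) auto
  define X where "X n t = integral {-L..p t} (\<lambda>x. \<Phi> n x * w x t)" for n t
  define Y where "Y n t = integral {-L..p t} (\<lambda>x. \<Phi>2 n x * w x t)" for n t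
  have ineq: "X n T - X n s \<le> integral {s..T} (Y n) + integral {s..T} (\<lambda>t. ?k t * \<Phi> n (p t - a)) - integral {s..T} (\<lambda>t. ?k t * \<phi> (p t))" for n
  proof -
    have 1: "\<Phi> n x = 0" "\<Phi>1 n x = 0" "\<Phi>2 n x = 0" if "x \<le> lo n" for x
      using below[OF that] by (auto simp: \<Phi>_def \<Phi>1_def \<Phi>2_def)
    have 2: "0 \<le> \<Phi> n x" if "x \<le> L" for x
      using \<phi>0[of x] 1(1)[of x] lo[of n] \<psi>(4) that by (cases "x \<le> lo n") (auto simp: \<Phi>_def)
    have X: "integral {lo n..p t} (\<lambda>x. \<Phi> n x * max 0 (u x t)) = X n t" if "t \<in> {s..T}" for t
      using from_lo[OF that gw_cont[OF that cont[OF d\<Phi>(1)]], of n n] 1 by (simp add: X_def w_def)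
    have Y: "integral {lo n..p t} (\<lambda>x. \<Phi>2 n x * max 0 (u x t)) = Y n t" if "t \<in> {s..T}" for t
      using from_lo[OF that gw_cont[OF that \<Phi>2c], of n n] 1 by (simp add: Y_def w_def)
    have "X n T - X n s \<le> integral {s..T} (\<lambda>t. integral {lo n..p t} (\<lambda>x. \<Phi>2 n x * max 0 (u x t)))
      + integral {s..T} (\<lambda>t. ?k t * \<Phi> n (p t - a)) - integral {s..T} (\<lambda>t. ?k t * \<Phi> n (p t))"
      using kato_interior[OF times lo _ lo_p(1) d\<Phi> \<Phi>2c 2 1(1) 1(2), of n] X r(1) times by simp
    moreover have "integral {s..T} (\<lambda>t. integral {lo n..p t} (\<lambda>x. \<Phi>2 n x * max 0 (u x t))) = integral {s..T} (Y n)"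
      by (rule integral_cong) (rule Y)
    moreover have "integral {s..T} (\<lambda>t. ?k t * \<Phi> n (p t)) = integral {s..T} (\<lambda>t. ?k t * \<phi> (p t))"
    proof (rule integral_cong)
      fix t assume "t \<in> {s..T}"
      then show "?k t * \<Phi> n (p t) = ?k t * \<phi> (p t)"
        using above(1)[OF lo_p(2), of t n] by (simp add: \<Phi>_def)
    qed
    ultimately show ?thesis by simp
  qed
  have X_lim: "(\<lambda>n. X n t) \<longlonglongrightarrow> integral {-L..p t} (\<lambda>x. \<phi> x * w x t)" if t: "t \<in> {s..T}" for t
  proof (rule LIM_zero_cancel, rule Lim_null_comparison)
    have "\<bar>integral {-L..p t} (\<lambda>x. (\<phi> x * w x t) * \<psi> (m n * (x - (-L)))) - integral {-L..p t} (\<lambda>x. \<phi> x * w x t)\<bar> \<le> B0 * (C * (2 * L)) * (2 / m n)" for n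
    proof (rule cutoff_error[OF gw_cont[OF t \<phi>c(1)] \<psi>c(1) \<psi>(4) \<psi>(8) _ m(1) lo_p(2)[OF t]])
      fix x assume x: "x \<in> {-L..p t}"
      then show "\<bar>\<phi> x * w x t\<bar> \<le> B0 * (C * (2 * L))"
        unfolding abs_mult using lo_p[OF t] B0 w_bound[OF t, of x] by (intro mult_mono) auto
    qed
    then show "\<forall>\<^sub>F n in sequentially. norm (X n t - integral {-L..p t} (\<lambda>x. \<phi> x * w x t)) \<le> B0 * (C * (2 * L)) * (2 / m n)"
      by (intro always_eventually allI) (simp add: X_def \<Phi>_def mult_ac)
    show "(\<lambda>n. B0 * (C * (2 * L)) * (2 / m n)) \<longlonglongrightarrow> 0"
      by (intro tendsto_mult_right_zero m_lim)
  qed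
  define g where "g x t = \<phi> x * w x t" for x t
  \<comment> \<open>Provides the dominating constant for \<open>V\<close>; its pointwise limit comes
    from \<open>g_deriv\<close>.\<close>
  have g_lip: "\<bar>g (-L + h) t - g (-L) t\<bar> \<le> (B1 * (C * (2 * L)) + B0 * C) * h" if t: "t \<in> {s..T}" and h: "0 \<le> h" "h \<le> 2 * L" for t h
  proof -
    have in1: "-L + h \<in> {-L..L}" "-L \<in> {-L..L}" using h by auto
    have "g (-L + h) t - g (-L) t = (\<phi> (-L + h) - \<phi> (-L)) * w (-L + h) t + \<phi> (-L) * (w (-L + h) t - w (-L) t)"
      by (simp add: g_def algebra_simps)
    also have "\<bar>\<dots>\<bar> \<le> \<bar>\<phi> (-L + h) - \<phi> (-L)\<bar> * \<bar>w (-L + h) t\<bar> + \<bar>\<phi> (-L)\<bar> * \<bar>w (-L + h) t - w (-L) t\<bar>"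
      by (metis abs_mult abs_triangle_ineq)
    also have "\<dots> \<le> (B1 * h) * (C * (2 * L)) + B0 * (C * h)"
    proof (intro add_mono mult_mono w_bound[OF t in1(1)])
      show "\<bar>\<phi> (-L + h) - \<phi> (-L)\<bar> \<le> B1 * h"
        using lipschitz_bound_if_deriv_bound[OF \<phi>(1), of "-L" L B1 "-L + h" "-L"] B1 in1 h by simp
      show "\<bar>w (-L + h) t - w (-L) t\<bar> \<le> C * h"
        using w_lip[OF t in1] h by simp
    qed (use B0 B1 in1 h C0 in auto)
    finally show ?thesis by (simp add: algebra_simps)
  qed
  have g_deriv: "(\<lambda>n. m n * (g (-L + y / m n) t - g (-L) t)) \<longlonglongrightarrow> 0" if t: "t \<in> {s..T}" and y: "0 \<le> y" "y \<le> 2" for t y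
  proof (cases "y = 0")
    case True
    then show ?thesis by simp
  next
    case False
    then have "0 < y" using y by simp
    have t0: "0 < t" using lo_p[OF t] by simp
    have "((\<lambda>x. (u x t - u (-L) t) / (x - (-L))) \<longlongrightarrow> 0) (at (-L) within {-L..L})"
      using neumann(2)[OF t0] by (simp add: has_field_derivative_iff)
    then have "((\<lambda>x. \<bar>(u x t - u (-L) t) / (x - (-L))\<bar>) \<longlongrightarrow> 0) (at (-L) within {-L..L})"
      by (rule tendsto_rabs_zero)
    \<comment> \<open>The positive part is 1-Lipschitz, so the difference quotients of
      \<open>w\<close> at the wall are dominated by those of \<open>u\<close>, and the Neumann
      condition passes to \<open>w\<close>.\<close>
    then have "((\<lambda>x. (w x t - w (-L) t) / (x - (-L))) \<longlongrightarrow> 0) (at (-L) within {-L..L})"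
    proof (rule Lim_null_comparison[rotated])
      show "\<forall>\<^sub>F x in at (-L) within {-L..L}. norm ((w x t - w (-L) t) / (x - (-L))) \<le> \<bar>(u x t - u (-L) t) / (x - (-L))\<bar>"
        by (intro always_eventually allI) (auto simp: w_def abs_divide intro!: divide_right_mono)
    qed
    then have "((\<lambda>x. w x t) has_real_derivative 0) (at (-L) within {-L..L})"
      by (simp add: has_field_derivative_iff)
    from DERIV_mult[OF has_field_derivative_at_within[OF \<phi>(1)] this]
    have "((\<lambda>x. g x t) has_real_derivative 0) (at (-L) within {-L..L})"
      by (simp add: g_def[abs_def] \<phi>L)
    then have lim: "((\<lambda>x. (g x t - g (-L) t) / (x - (-L))) \<longlongrightarrow> 0) (at (-L) within {-L..L})"
      by (simp add: has_field_derivative_iff)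
    have "filterlim (\<lambda>n. -L + y / m n) (at (-L) within {-L..L}) sequentially"
      unfolding filterlim_at
    proof (intro conjI always_eventually allI)
      show "(\<lambda>n. -L + y / m n) \<longlonglongrightarrow> -L"
        using tendsto_add[OF tendsto_const[of "-L"] m_lim[of y]] by simp
      fix n
      have "0 < y / m n" using \<open>0 < y\<close> m(1)[of n] by simp
      moreover have "y / m n \<le> 2 / m n" using y m(1)[of n] by (intro divide_right_mono) auto
      ultimately show "-L + y / m n \<in> {-L..L}" "-L + y / m n \<noteq> -L"
        using m_inv(2)[of n] rL r(1) by auto
    qed
    from filterlim_compose[OF lim this]
    have "(\<lambda>n. (g (-L + y / m n) t - g (-L) t) / (y / m n)) \<longlonglongrightarrow> 0" by simp
    then have "(\<lambda>n. y * ((g (-L + y / m n) t - g (-L) t) / (y / m n))) \<longlonglongrightarrow> 0"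
      by (rule tendsto_mult_right_zero)
    then show ?thesis using \<open>0 < y\<close> m by (simp add: mult.commute)
  qed
  \<comment> \<open>Contribution of the derivatives of the cutoff, in the layer variable
    \<open>y = m n * (x + L)\<close>. The length element removes one factor \<open>m n\<close>; the
    one left on \<open>\<psi>2\<close> is paired with an increment of \<open>g\<close>.\<close>
  define V where "V n t = integral {0..2} (\<lambda>y. 2 * \<phi>1 (-L + y / m n) * \<psi>1 y * w (-L + y / m n) t + \<psi>2 y * (m n * (g (-L + y / m n) t - g (-L) t)))" for n t
  have scaled: "0 \<le> y / m n" "y / m n \<le> 2 * L" "-L + y / m n \<in> {-L..L}" "-L + y / m n \<le> p t"
    if "y \<in> {0..2}" "t \<in> {s..T}" for y n t
  proof -
    have "y / m n \<le> 2 / m n" using that m(1)[of n] by (intro divide_right_mono) auto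
    moreover show "0 \<le> y / m n" using that m(1)[of n] by simp
    ultimately show "y / m n \<le> 2 * L" "-L + y / m n \<in> {-L..L}" "-L + y / m n \<le> p t"
      using m_inv(2)[of n] rL r(1) lo_p(2)[OF that(2), of n] by auto
  qed
  have sc_cont: "continuous_on {0..2} (\<lambda>y. f (-L + y / m n))" if "continuous_on {-L..L} f" "t \<in> {s..T}" for f :: "real \<Rightarrow> real" and n t
  proof (rule continuous_on_compose2[OF that(1)])
    show "continuous_on {0..2} (\<lambda>y. -L + y / m n)"
      using m(1)[of n] by (intro continuous_intros) auto
    show "(\<lambda>y. -L + y / m n) ` {0..2} \<subseteq> {-L..L}"
      using scaled(3)[OF _ that(2)] by blast
  qed
  have V_int: "(\<lambda>y. 2 * \<phi>1 (-L + y / m n) * \<psi>1 y * w (-L + y / m n) t + \<psi>2 y * (m n * (g (-L + y / m n) t - g (-L) t))) integrable_on {0..2}"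
    if t: "t \<in> {s..T}" for n t
  proof -
    have wc: "continuous_on {-L..L} (\<lambda>x. w x t)" using w_cont lo_p[OF t] by simp
    have gc: "continuous_on {-L..L} (\<lambda>x. g x t)"
      unfolding g_def by (intro continuous_on_mult \<phi>c wc)
    show ?thesis
      by (intro integrable_continuous_interval continuous_on_add continuous_on_mult continuous_on_diff continuous_on_const
          sc_cont[OF \<phi>c(2) t] sc_cont[OF wc t] sc_cont[OF gc t] \<psi>c continuous_on_subset[OF \<psi>(3)]) auto
  qed
  have V_integrand: "\<bar>2 * \<phi>1 (-L + y / m n) * \<psi>1 y * w (-L + y / m n) t + \<psi>2 y * (m n * (g (-L + y / m n) t - g (-L) t))\<bar>
      \<le> 2 * B1 * M * (C * (2 * L)) + M * ((B1 * (C * (2 * L)) + B0 * C) * 2)" (is "\<bar>?A + ?D\<bar> \<le> ?bA + ?bD")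
    if t: "t \<in> {s..T}" and y: "y \<in> {0..2}" for n t y
  proof -
    note sc = scaled[OF y t, of n]
    have "\<bar>\<phi>1 (-L + y / m n)\<bar> * \<bar>\<psi>1 y\<bar> * \<bar>w (-L + y / m n) t\<bar> \<le> B1 * M * (C * (2 * L))"
      using B1 sc(3) \<psi>(5)[of y] w_bound[OF t sc(3)] M0 by (intro mult_mono) auto
    then have A: "\<bar>?A\<bar> \<le> ?bA" by (simp add: abs_mult mult_ac)
    have "m n * \<bar>g (-L + y / m n) t - g (-L) t\<bar> \<le> m n * ((B1 * (C * (2 * L)) + B0 * C) * (y / m n))"
      using g_lip[OF t sc(1,2)] m(1)[of n] by (intro mult_left_mono) auto
    also have "\<dots> = (B1 * (C * (2 * L)) + B0 * C) * y" using m(1)[of n] by simp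
    also have "\<dots> \<le> (B1 * (C * (2 * L)) + B0 * C) * 2"
      using y B0(1) B1(1) C0 Lpos by (intro mult_left_mono add_nonneg_nonneg mult_nonneg_nonneg) auto
    finally have G: "m n * \<bar>g (-L + y / m n) t - g (-L) t\<bar> \<le> (B1 * (C * (2 * L)) + B0 * C) * 2" .
    have "\<bar>\<psi>2 y\<bar> * (m n * \<bar>g (-L + y / m n) t - g (-L) t\<bar>) \<le> ?bD"
      by (rule mult_mono[OF \<psi>(6) G M0]) (use m(1)[of n] in simp)
    then have D: "\<bar>?D\<bar> \<le> ?bD" using m(1)[of n] by (simp add: abs_mult)
    show ?thesis using A D abs_triangle_ineq[of ?A ?D] by linarith
  qed
  define KV where "KV = (2 * B1 * M * (C * (2 * L)) + M * ((B1 * (C * (2 * L)) + B0 * C) * 2)) * 2"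
  have KV_half: "KV / 2 = 2 * B1 * M * (C * (2 * L)) + M * ((B1 * (C * (2 * L)) + B0 * C) * 2)"
    by (simp add: KV_def)
  have V_bound: "\<bar>V n t\<bar> \<le> KV" if t: "t \<in> {s..T}" for n t
  proof -
    have "norm (V n t) \<le> integral {0..2::real} (\<lambda>_. KV / 2)"
      unfolding V_def
      by (rule integral_norm_bound_integral[OF V_int[OF t] integrable_const_ivl])
        (unfold real_norm_def KV_half, rule V_integrand[OF t])
    then show ?thesis by simp
  qed
  have V_lim: "(\<lambda>n. V n t) \<longlonglongrightarrow> 0" if t: "t \<in> {s..T}" for t
  proof -
    have "(\<lambda>n. V n t) \<longlonglongrightarrow> integral {0..2::real} (\<lambda>_. 0)"
      unfolding V_def
    proof (rule dominated_convergence(2)[OF V_int[OF t], where h = "\<lambda>_. KV / 2"])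
      show "(\<lambda>_. KV / 2) integrable_on {0..2::real}" by (rule integrable_const_ivl)
      fix y :: real assume y: "y \<in> {0..2}"
      show "norm (2 * \<phi>1 (-L + y / m n) * \<psi>1 y * w (-L + y / m n) t + \<psi>2 y * (m n * (g (-L + y / m n) t - g (-L) t))) \<le> KV / 2" for n
        unfolding real_norm_def KV_half by (rule V_integrand[OF t y])
      have xlim: "(\<lambda>n. -L + y / m n) \<longlonglongrightarrow> -L"
        using tendsto_add[OF tendsto_const[of "-L"] m_lim[of y]] by simp
      have "(\<lambda>n. \<phi>1 (-L + y / m n)) \<longlonglongrightarrow> \<phi>1 (-L)"
        by (rule continuous_on_tendsto_compose[OF \<phi>c(2)[of UNIV] xlim]) auto
      moreover have "(\<lambda>n. w (-L + y / m n) t) \<longlonglongrightarrow> w (-L) t"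
      proof (rule continuous_on_tendsto_compose[OF w_cont xlim])
        show "0 < t" using lo_p[OF t] by simp
        show "-L \<in> {-L..L}" using Lpos by auto
        show "\<forall>\<^sub>F n in sequentially. -L + y / m n \<in> {-L..L}"
          using scaled(3)[OF y t] by simp
      qed
      ultimately have "(\<lambda>n. 2 * \<phi>1 (-L + y / m n) * \<psi>1 y * w (-L + y / m n) t + \<psi>2 y * (m n * (g (-L + y / m n) t - g (-L) t)))
          \<longlonglongrightarrow> 2 * \<phi>1 (-L) * \<psi>1 y * w (-L) t + \<psi>2 y * 0"
        using y by (intro tendsto_intros g_deriv[OF t]) auto
      then show "(\<lambda>n. 2 * \<phi>1 (-L + y / m n) * \<psi>1 y * w (-L + y / m n) t + \<psi>2 y * (m n * (g (-L + y / m n) t - g (-L) t))) \<longlonglongrightarrow> 0"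
        by (simp add: \<phi>L)
    qed
    then show ?thesis by simp
  qed
  have Y_split: "Y n t = integral {-L..p t} (\<lambda>x. (\<phi>2 x * w x t) * \<psi> (m n * (x - (-L)))) + V n t" if t: "t \<in> {s..T}" for n t
  proof -
    define q where "q x = (2 * \<phi>1 x * (m n * \<psi>1 (m n * (x - (-L)))) + \<phi> x * ((m n)\<^sup>2 * \<psi>2 (m n * (x - (-L))))) * w x t" for x
    have wc: "continuous_on {-L..L} (\<lambda>x. w x t)" using w_cont lo_p[OF t] by simp
    have qc: "continuous_on {-L..L} q"
      unfolding q_def[abs_def]
      by (intro continuous_on_add continuous_on_mult continuous_on_const \<phi>c wc
        continuous_on_comp_UNIV[OF \<psi>(3)] continuous_on_comp_UNIV[OF \<psi>c(2)] continuous_intros)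
    have q1: "continuous_on {-L..p t} (\<lambda>x. (\<phi>2 x * w x t) * \<psi> (m n * (x - (-L))))"
      using lo_p[OF t] by (intro continuous_on_mult continuous_on_comp_UNIV[OF \<psi>c(1)] continuous_on_subset[OF \<phi>(3)]
          continuous_on_subset[OF wc] continuous_intros) auto
    have "Y n t = integral {-L..p t} (\<lambda>x. (\<phi>2 x * w x t) * \<psi> (m n * (x - (-L))) + q x)"
      unfolding Y_def by (intro arg_cong[of _ _ "integral {-L..p t}"] ext) (simp add: \<Phi>2_def q_def algebra_simps)
    also have "\<dots> = integral {-L..p t} (\<lambda>x. (\<phi>2 x * w x t) * \<psi> (m n * (x - (-L)))) + integral {-L..p t} q"
      using lo_p[OF t] by (intro Henstock_Kurzweil_Integration.integral_add integrable_continuous_interval q1 continuous_on_subset[OF qc]) auto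
    also have "integral {-L..p t} q = V n t"
    proof -
      have e: "-L + 2 / m n \<le> p t" "-L \<le> -L + 2 / m n" using lo_p(2)[OF t] m(1)[of n] by auto
      have "integral {-L..p t} q = integral {-L..-L + 2 / m n} q + integral {-L + 2 / m n..p t} q"
        using e lo_p(5)[OF t] order_trans[OF e(1) lo_p(5)[OF t]]
        by (intro Henstock_Kurzweil_Integration.integral_combine[symmetric] integrable_continuous_interval continuous_on_subset[OF qc]) auto
      also have "integral {-L + 2 / m n..p t} q = integral {-L + 2 / m n..p t} (\<lambda>_. 0)"
      proof (rule integral_cong)
        fix x assume "x \<in> {-L + 2 / m n..p t}"
        then show "q x = 0" using above[of n x] by (simp add: q_def)
      qed
      also have "integral {-L..-L + 2 / m n} q = (1 / m n) * integral {0..2} (\<lambda>y. q (-L + (1 / m n) * y))"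
      proof -
        have "continuous_on {-L..-L + 1 / m n * 2} q"
          by (rule continuous_on_subset[OF qc]) (use order_trans[OF e(1) lo_p(5)[OF t]] in auto)
        from integral_rescale[OF _ this] show ?thesis using m(1)[of n] by simp
      qed
      also have "\<dots> = integral {0..2} (\<lambda>y. (1 / m n) * q (-L + (1 / m n) * y))"
        by (rule integral_mult_right[symmetric])
      also have "\<dots> = integral {0..2} (\<lambda>y. (2 * \<phi>1 (-L + y / m n) * \<psi>1 y * w (-L + y / m n) t + \<psi>2 y * (m n * (g (-L + y / m n) t - g (-L) t))) + m n * g (-L) t * \<psi>2 y)"
        using m(1)[of n] by (intro integral_cong) (simp add: q_def g_def field_simps power2_eq_square)
      also have "\<dots> = V n t + integral {0..2} (\<lambda>y. m n * g (-L) t * \<psi>2 y)"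
        unfolding V_def by (intro Henstock_Kurzweil_Integration.integral_add V_int[OF t] integrable_continuous_interval
          continuous_on_mult continuous_on_const continuous_on_subset[OF \<psi>(3)]) auto
      \<comment> \<open>\<open>\<psi>1\<close> vanishes at both ends. This is what permits
        subtracting the constant \<open>g (-L) t\<close> in \<open>V\<close>.\<close>
      also have "integral {0..2} (\<lambda>y. m n * g (-L) t * \<psi>2 y) = 0"
      proof -
        have "integral {0..2} \<psi>2 = \<psi>1 2 - \<psi>1 0"
          by (intro integral_unique has_integral_derivative \<psi>(2)) simp
        then show ?thesis using \<psi>(9)[of 2] \<psi>(9)[of 0] by simp
      qed
      finally show ?thesis by simp
    qed
    finally show ?thesis .
  qed
  have Y_lim: "(\<lambda>n. Y n t) \<longlonglongrightarrow> integral {-L..p t} (\<lambda>x. \<phi>2 x * w x t)"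
    and Y_bound: "\<And>n. norm (Y n t) \<le> B2 * (C * (2 * L)) * (2 * L) + KV" if t: "t \<in> {s..T}" for t
  proof -
    have bnd: "\<bar>\<phi>2 x * w x t\<bar> \<le> B2 * (C * (2 * L))" if "x \<in> {-L..p t}" for x
      unfolding abs_mult using lo_p[OF t] B2 w_bound[OF t, of x] that by (intro mult_mono) auto
    have err: "\<bar>integral {-L..p t} (\<lambda>x. (\<phi>2 x * w x t) * \<psi> (m n * (x - (-L)))) - integral {-L..p t} (\<lambda>x. \<phi>2 x * w x t)\<bar> \<le> B2 * (C * (2 * L)) * (2 / m n)" for n
      by (rule cutoff_error[OF gw_cont[OF t \<phi>(3)] \<psi>c(1) \<psi>(4) \<psi>(8) bnd m(1) lo_p(2)[OF t]])
    have "(\<lambda>n. integral {-L..p t} (\<lambda>x. (\<phi>2 x * w x t) * \<psi> (m n * (x - (-L))))) \<longlonglongrightarrow> integral {-L..p t} (\<lambda>x. \<phi>2 x * w x t)"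
    proof (rule LIM_zero_cancel, rule Lim_null_comparison)
      show "\<forall>\<^sub>F n in sequentially. norm (integral {-L..p t} (\<lambda>x. (\<phi>2 x * w x t) * \<psi> (m n * (x - (-L)))) - integral {-L..p t} (\<lambda>x. \<phi>2 x * w x t)) \<le> B2 * (C * (2 * L)) * (2 / m n)"
        using err by simp
      show "(\<lambda>n. B2 * (C * (2 * L)) * (2 / m n)) \<longlonglongrightarrow> 0"
        by (intro tendsto_mult_right_zero m_lim)
    qed
    from tendsto_add[OF this V_lim[OF t]]
    show "(\<lambda>n. Y n t) \<longlonglongrightarrow> integral {-L..p t} (\<lambda>x. \<phi>2 x * w x t)"
      by (simp add: Y_split[OF t])
    fix n
    have "norm (integral {-L..p t} (\<lambda>x. (\<phi>2 x * w x t) * \<psi> (m n * (x - (-L))))) \<le> B2 * (C * (2 * L)) * (p t - (-L))"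
    proof (rule integral_bound)
      show "continuous_on {-L..p t} (\<lambda>x. (\<phi>2 x * w x t) * \<psi> (m n * (x - (-L))))"
        by (intro continuous_on_mult[OF gw_cont[OF t \<phi>(3)]] continuous_on_comp_UNIV[OF \<psi>c(1)] continuous_intros)
      fix x assume x: "x \<in> {-L..p t}"
      have "\<bar>\<phi>2 x * w x t\<bar> * \<bar>\<psi> (m n * (x - (-L)))\<bar> \<le> B2 * (C * (2 * L)) * 1"
        using bnd[OF x] \<psi>(4)[of "m n * (x - (-L))"] by (intro mult_mono) auto
      then show "norm ((\<phi>2 x * w x t) * \<psi> (m n * (x - (-L)))) \<le> B2 * (C * (2 * L))"
        by (simp add: abs_mult)
    qed (use lo_p[OF t] in auto)
    also have "\<dots> \<le> B2 * (C * (2 * L)) * (2 * L)"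
      using lo_p[OF t] B2(1) C0 Lpos by (intro mult_left_mono) auto
    finally show "norm (Y n t) \<le> B2 * (C * (2 * L)) * (2 * L) + KV"
      using V_bound[OF t, of n] Y_split[OF t, of n] by simp
  qed
  have Y_int: "Y n integrable_on {s..T}" for n
  proof -
    have "continuous_on ({-L..L} \<times> {s..T}) (\<lambda>(x, t). \<Phi>2 n x * max 0 (u x t))"
      by (rule u_slab_continuous[OF times(1) _ \<Phi>2c maxc]) simp
    from continuous_on_moving_integral[OF this pc]
    show ?thesis
      unfolding Y_def[abs_def] w_def using r(2) r(1) by (intro integrable_continuous_interval) force
  qed
  have Y_dct: "(\<lambda>n. integral {s..T} (Y n)) \<longlonglongrightarrow> integral {s..T} (\<lambda>t. integral {-L..p t} (\<lambda>x. \<phi>2 x * w x t))"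
    by (rule dominated_convergence(2)[OF Y_int integrable_const_ivl]) (rule Y_bound Y_lim, assumption)+
  have \<Phi>_le: "norm (?k t * \<Phi> n (p t - a)) \<le> C * B0" if t: "t \<in> {s..T}" for n t
  proof (cases "-L \<le> p t - a")
    case True
    then have "\<bar>\<phi> (p t - a)\<bar> \<le> B0" using lo_p[OF t] a_pos by (intro B0) auto
    then have "\<bar>\<phi> (p t - a)\<bar> * \<bar>\<psi> (m n * (p t - a - (-L)))\<bar> \<le> B0 * 1"
      using \<psi>(4)[of "m n * (p t - a - (-L))"] B0(1) by (intro mult_mono) auto
    then have "\<bar>\<Phi> n (p t - a)\<bar> \<le> B0" by (simp add: \<Phi>_def abs_mult)
    then show ?thesis using k[of t] C0 unfolding real_norm_def abs_mult by (intro mult_mono) auto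
  next
    case False
    then have "\<Phi> n (p t - a) = 0" using below(1)[of "p t - a" n] lo[of n] by (simp add: \<Phi>_def)
    then show ?thesis using C0 B0 by simp
  qed
  \<comment> \<open>At \<open>p t - a = -L\<close> every cutoff is 0, so the limit is 0 there too;
    this is the origin of the strict inequality in \<open>src\<close>.\<close>
  have src_lim: "(\<lambda>n. ?k t * \<Phi> n (p t - a)) \<longlonglongrightarrow> ?k t * src t" if t: "t \<in> {s..T}" for t
  proof (cases "-L < p t - a")
    case True
    have "\<forall>\<^sub>F n in sequentially. 2 / m n < p t - a - (-L)"
      using order_tendstoD(2)[OF m_lim[of 2]] True by simp
    then have "\<forall>\<^sub>F n in sequentially. ?k t * \<Phi> n (p t - a) = ?k t * src t"
    proof eventually_elim
      case (elim n)
      then show ?case using above(1)[of n "p t - a"] True by (simp add: \<Phi>_def src_def)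
    qed
    then show ?thesis by (rule tendsto_eventually)
  next
    case False
    then have "\<Phi> n (p t - a) = 0" for n using below(1)[of "p t - a" n] lo[of n] by (simp add: \<Phi>_def)
    then show ?thesis using False by (simp add: src_def)
  qed
  have \<Phi>_int: "(\<lambda>t. ?k t * \<Phi> n (p t - a)) integrable_on {s..T}" for n
    by (intro positive_flux_weight_integrable times continuous_on_comp_UNIV[OF cont[OF d\<Phi>(1)]] continuous_intros pc)
  note dc = dominated_convergence[where h = "\<lambda>_. C * B0", OF \<Phi>_int integrable_const_ivl]
  show "(\<lambda>t. positive_flux s T t * src t) integrable_on {s..T}"
    by (rule dc(1)) (rule \<Phi>_le src_lim, assumption)+
  have src_dct: "(\<lambda>n. integral {s..T} (\<lambda>t. ?k t * \<Phi> n (p t - a))) \<longlonglongrightarrow> integral {s..T} (\<lambda>t. ?k t * src t)"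
    by (rule dc(2)) (rule \<Phi>_le src_lim, assumption)+
  have "integral {-L..p T} (\<lambda>x. \<phi> x * w x T) - integral {-L..p s} (\<lambda>x. \<phi> x * w x s)
      \<le> integral {s..T} (\<lambda>t. integral {-L..p t} (\<lambda>x. \<phi>2 x * w x t))
        + integral {s..T} (\<lambda>t. ?k t * src t) - integral {s..T} (\<lambda>t. ?k t * \<phi> (p t))"
  proof (rule LIMSEQ_le)
    show "(\<lambda>n. X n T - X n s) \<longlonglongrightarrow> integral {-L..p T} (\<lambda>x. \<phi> x * w x T) - integral {-L..p s} (\<lambda>x. \<phi> x * w x s)"
      using times by (intro tendsto_diff X_lim) auto
    show "(\<lambda>n. integral {s..T} (Y n) + integral {s..T} (\<lambda>t. ?k t * \<Phi> n (p t - a)) - integral {s..T} (\<lambda>t. ?k t * \<phi> (p t)))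
        \<longlonglongrightarrow> integral {s..T} (\<lambda>t. integral {-L..p t} (\<lambda>x. \<phi>2 x * w x t)) + integral {s..T} (\<lambda>t. ?k t * src t) - integral {s..T} (\<lambda>t. ?k t * \<phi> (p t))"
      by (intro tendsto_intros Y_dct src_dct)
  qed (use ineq in auto)
  then show "integral {-L..p T} (\<lambda>x. \<phi> x * max 0 (u x T)) - integral {-L..p s} (\<lambda>x. \<phi> x * max 0 (u x s))
      \<le> integral {s..T} (\<lambda>t. integral {-L..p t} (\<lambda>x. \<phi>2 x * max 0 (u x t)))
        + integral {s..T} (\<lambda>t. positive_flux s T t * src t)
        - integral {s..T} (\<lambda>t. positive_flux s T t * \<phi> (p t))"
    unfolding w_def .
qed

end

section \<open>Sign and conservation of mass\<close>

lemma continuous_on_reflect: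
  fixes u :: "real \<Rightarrow> real \<Rightarrow> real"
  assumes "continuous_on ({-L..L} \<times> S) (\<lambda>(x, t). u x t)"
  shows "continuous_on ({-L..L} \<times> S) (\<lambda>(x, t). - u (- x) t)"
proof -
  have "continuous_on ({-L..L} \<times> S) (\<lambda>z. (- fst z, snd z))"
    by (intro continuous_intros)
  moreover have "(\<lambda>z. (- fst z, snd z)) ` ({-L..L} \<times> S) \<subseteq> {-L..L} \<times> S"
    by auto
  ultimately have "continuous_on ({-L..L} \<times> S) (\<lambda>z. u (- fst z) (snd z))"
    using continuous_on_compose2[OF assms] by fastforce
  then show ?thesis
    unfolding case_prod_beta by (rule continuous_on_minus)
qed

lemma DERIV_reflect:
  fixes g :: "real \<Rightarrow> real"
  assumes "(g has_real_derivative D) (at (- x) within {-L..L})"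
  shows "((\<lambda>x. - g (- x)) has_real_derivative D) (at x within {-L..L})"
proof -
  have i: "uminus ` {-L..L} = {-L..L}" by simp
  have "((\<lambda>x. g (- x)) has_real_derivative D * (-1)) (at x within {-L..L})"
    using DERIV_image_chain[of g D "\<lambda>x. - x" x "{-L..L}" "-1"] DERIV_minus[OF DERIV_ident, of x "{-L..L}"] assms i
    by (simp add: o_def)
  from DERIV_minus[OF this] show ?thesis by simp
qed

lemma DERIV_reflect_UNIV:
  fixes g :: "real \<Rightarrow> real"
  assumes "(g has_real_derivative D) (at (- x))"
  shows "((\<lambda>x. - g (- x)) has_real_derivative D) (at x)"
  using assms DERIV_mirror[of g D x] DERIV_minus[of "\<lambda>x. g (- x)" "- D" x] by simp

context weak_solution
begin

text \<open>The equation is linear in the pair of \<open>u\<close> and \<open>\<kappa>\<close> for a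
  given \<open>p\<close>, so both change sign together. It turns bounds on the positive part left of
  \<open>p\<close> into bounds on the negative part.\<close>

lemma weak_solution_neg: "weak_solution L a (\<lambda>x t. - u x t) p (\<lambda>t. - \<kappa> t)"
proof
  show "0 < a" by (rule a_pos)
  show "continuous_on {0<..} p" by (rule p_cont)
  show "-L < p t \<and> p t < L" if "0 < t" for t using p_bounds that .
  show "continuous_on ({-L..L} \<times> {0<..}) (\<lambda>(x, t). - u x t)"
    using continuous_on_minus[OF u_cont] by (simp add: case_prod_beta)
  show "\<exists>C. \<forall>t\<in>{s..T}. C-lipschitz_on {-L..L} (\<lambda>x. - u x t)" if "0 < s" "s < T" for s T
    using u_lip[OF that] by (auto simp: lipschitz_on_def dist_minus)
  show "((\<lambda>x. - u x t) has_real_derivative - (- \<kappa> t)) (at (p t))" if "0 < t" for t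
    by (intro DERIV_minus flux that)
  show "- u (p t) t = 0" if "0 < t" for t using zero[OF that] by simp
  show "((\<lambda>x. - u x t) has_real_derivative 0) (at L within {-L..L})"
    "((\<lambda>x. - u x t) has_real_derivative 0) (at (-L) within {-L..L})" if "0 < t" for t
    using DERIV_minus[OF neumann(1)[OF that]] DERIV_minus[OF neumann(2)[OF that]] by simp_all
  show "price_equation L a (\<lambda>x t. - u x t) p (\<lambda>t. - \<kappa> t)"
    using eq unfolding price_equation_def set_lebesgue_integral_def by simp
qed

text \<open>Reflection with a change of sign exchanges buyers and vendors. The two signs cancel in
  the space derivative, so \<open>\<kappa>\<close> is unchanged; source and sink swap places, and
  the sign of \<open>u\<close> compensates for that.\<close>

lemma weak_solution_reflect: "weak_solution L a (\<lambda>x t. - u (- x) t) (\<lambda>t. - p t) \<kappa>"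
proof
  show "0 < a" by (rule a_pos)
  show "continuous_on {0<..} (\<lambda>t. - p t)" by (intro continuous_on_minus p_cont)
  show "-L < - p t \<and> - p t < L" if "0 < t" for t using p_bounds[OF that] by auto
  show "continuous_on ({-L..L} \<times> {0<..}) (\<lambda>(x, t). - u (- x) t)"
    by (rule continuous_on_reflect[OF u_cont])
  show "\<exists>C. \<forall>t\<in>{s..T}. C-lipschitz_on {-L..L} (\<lambda>x. - u (- x) t)" if st: "0 < s" "s < T" for s T
  proof -
    obtain C where C: "\<forall>t\<in>{s..T}. C-lipschitz_on {-L..L} (\<lambda>x. u x t)"
      using u_lip[OF st] by blast
    have "C-lipschitz_on {-L..L} (\<lambda>x. - u (- x) t)" if "t \<in> {s..T}" for t
    proof (rule lipschitz_onI)
      have Ct: "C-lipschitz_on {-L..L} (\<lambda>x. u x t)" using C that by blast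
      show "0 \<le> C" by (rule lipschitz_on_nonneg[OF Ct])
      fix x y assume "x \<in> {-L..L}" "y \<in> {-L..L}"
      then have "dist (u (- x) t) (u (- y) t) \<le> C * dist (- x) (- y)"
        by (intro lipschitz_onD[OF Ct]) auto
      then show "dist (- u (- x) t) (- u (- y) t) \<le> C * dist x y"
        by (simp add: dist_minus)
    qed
    then show ?thesis by blast
  qed
  show "((\<lambda>x. - u (- x) t) has_real_derivative - \<kappa> t) (at (- p t))" if "0 < t" for t
    by (rule DERIV_reflect_UNIV) (simp add: flux that)
  show "- u (- (- p t)) t = 0" if "0 < t" for t using zero[OF that] by simp
  show "((\<lambda>x. - u (- x) t) has_real_derivative 0) (at L within {-L..L})"
    "((\<lambda>x. - u (- x) t) has_real_derivative 0) (at (-L) within {-L..L})" if "0 < t" for t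
    by (rule DERIV_reflect; simp add: neumann that)+
  show "price_equation L a (\<lambda>x t. - u (- x) t) (\<lambda>t. - p t) \<kappa>"
    unfolding price_equation_def
  proof (intro allI impI)
    fix D assume D: "test_function ({-L<..<L} \<times> {0<..}) D"
    \<comment> \<open>The chain rule puts \<open>(-1) ^ i\<close> on the \<open>i\<close>-th space
      derivative. The derivatives in the equation, one in time or two in space, keep their
      sign.\<close>
    define D' where "D' i j x t = (-1) ^ i * D i j (- x) t" for i j :: nat and x t :: real
    have smooth: "smooth_partials D" using D by (simp add: test_function_def)
    have "test_function ({-L<..<L} \<times> {0<..}) D'"
      unfolding test_function_def smooth_partials_def
    proof (intro conjI allI)
      fix i j
      have "continuous_on UNIV (\<lambda>(x, t). D i j x t)" using smooth by (simp add: smooth_partials_def)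
      then have "continuous_on UNIV (\<lambda>z. case (- fst z, snd z) of (x, t) \<Rightarrow> D i j x t)"
        by (rule continuous_on_compose2) (auto intro!: continuous_intros)
      then show "continuous_on UNIV (\<lambda>(x, t). D' i j x t)"
        unfolding D'_def case_prod_beta by (intro continuous_intros) simp
      fix x t
      have "((\<lambda>y. D i j y t) has_real_derivative D (Suc i) j (- x) t) (at (- x))"
        using smooth by (simp add: smooth_partials_def)
      then have "((\<lambda>y. D i j (- y) t) has_real_derivative - D (Suc i) j (- x) t) (at x)"
        by (simp add: DERIV_mirror)
      from DERIV_cmult[OF this, of "(-1) ^ i"]
      show "((\<lambda>y. D' i j y t) has_real_derivative D' (Suc i) j x t) (at x)"
        by (simp add: D'_def)
      have "((\<lambda>s. D i j (- x) s) has_real_derivative D i (Suc j) (- x) t) (at t)"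
        using smooth by (simp add: smooth_partials_def)
      from DERIV_cmult[OF this, of "(-1) ^ i"]
      show "((\<lambda>s. D' i j x s) has_real_derivative D' i (Suc j) x t) (at t)"
        by (simp add: D'_def)
    next
      obtain K where K: "compact K" "K \<subseteq> {-L<..<L} \<times> {0<..}" "\<And>x t. (x, t) \<notin> K \<Longrightarrow> D 0 0 x t = 0"
        using D unfolding test_function_def by blast
      show "\<exists>K. compact K \<and> K \<subseteq> {-L<..<L} \<times> {0<..} \<and> (\<forall>x t. (x, t) \<notin> K \<longrightarrow> D' 0 0 x t = 0)"
      proof (intro exI[of _ "(\<lambda>z. (- fst z, snd z)) ` K"] conjI allI impI)
        show "compact ((\<lambda>z. (- fst z, snd z)) ` K)"
          by (intro compact_continuous_image K continuous_intros)
        show "(\<lambda>z. (- fst z, snd z)) ` K \<subseteq> {-L<..<L} \<times> {0<..}"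
          using K(2) by force
        fix x t assume "(x, t) \<notin> (\<lambda>z. (- fst z, snd z)) ` K"
        then have "(- x, t) \<notin> K" by (force simp: image_iff)
        then show "D' 0 0 x t = 0" using K(3) by (simp add: D'_def)
      qed
    qed
    from eq[unfolded price_equation_def, rule_format, OF this]
    have E: "(LINT t:{0<..}|lborel. (LINT x:{-L<..<L}|lborel. u x t * (- D' 0 1 x t - D' 2 0 x t)))
        = (LINT t:{0<..}|lborel. \<kappa> t * (D' 0 0 (p t - a) t - D' 0 0 (p t + a) t))" .
    have "(LINT x:{-L<..<L}|lborel. - u (- x) t * (- D 0 1 x t - D 2 0 x t))
        = - (LINT x:{-L<..<L}|lborel. u x t * (- D' 0 1 x t - D' 2 0 x t))" for t
    proof -
      have "(LINT x:{-L<..<L}|lborel. - u (- x) t * (- D 0 1 x t - D 2 0 x t))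
          = (LINT x|lborel. indicator {-L<..<L} (- x) *\<^sub>R (- u x t * (- D 0 1 (- x) t - D 2 0 (- x) t)))"
        unfolding set_lebesgue_integral_def
        by (subst lborel_integral_real_affine[where c = "-1" and t = 0]) auto
      also have "\<dots> = (LINT x|lborel. - (indicator {-L<..<L} x *\<^sub>R (u x t * (- D' 0 1 x t - D' 2 0 x t))))"
        by (intro Bochner_Integration.integral_cong) (auto simp: D'_def indicator_def)
      finally show ?thesis by (simp add: set_lebesgue_integral_def)
    qed
    then have "(LINT t:{0<..}|lborel. (LINT x:{-L<..<L}|lborel. - u (- x) t * (- D 0 1 x t - D 2 0 x t)))
        = - (LINT t:{0<..}|lborel. \<kappa> t * (D' 0 0 (p t - a) t - D' 0 0 (p t + a) t))"
      unfolding E[symmetric] by (simp add: set_lebesgue_integral_def)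
    also have "\<dots> = (LINT t:{0<..}|lborel. - (\<kappa> t * (D' 0 0 (p t - a) t - D' 0 0 (p t + a) t)))"
      by (simp add: set_lebesgue_integral_def)
    also have "\<dots> = (LINT t:{0<..}|lborel. \<kappa> t * (D 0 0 (- p t - a) t - D 0 0 (- p t + a) t))"
    proof (intro set_lebesgue_integral_cong ballI allI impI)
      fix t
      have "- (p t + a) = - p t - a" "- (p t - a) = - p t + a" by simp_all
      then show "- (\<kappa> t * (D' 0 0 (p t - a) t - D' 0 0 (p t + a) t)) = \<kappa> t * (D 0 0 (- p t - a) t - D 0 0 (- p t + a) t)"
        unfolding D'_def by (simp only: power_0 mult_1) (simp add: right_diff_distrib)
    qed simp
    finally show "(LINT t:{0<..}|lborel. (LINT x:{-L<..<L}|lborel. - u (- x) t * (- D 0 1 x t - D 2 0 x t)))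
        = (LINT t:{0<..}|lborel. \<kappa> t * (D 0 0 (- p t - a) t - D 0 0 (- p t + a) t))" .
  qed
qed

lemma positive_flux_integrable:
  assumes "0 < s" "s < T"
  shows "(\<lambda>t. positive_flux s T t * c) integrable_on {s..T}"
  by (rule positive_flux_weight_integrable(1)[OF assms continuous_on_const])

lemma slice_continuous: "0 < t \<Longrightarrow> continuous_on {-L..L} (\<lambda>x. u x t)"
  using u_slice_continuous[of t "-L" L "\<lambda>_. 1" "\<lambda>v. v"] by simp

text \<open>With a constant weight the diffusion term is 0, and the source returns either exactly
  what leaves at \<open>p\<close> or, from beyond \<open>-L\<close>, nothing.\<close>

lemma positive_mass_decreasing:
  assumes "0 < s" "s < T"
  shows "integral {-L..p T} (\<lambda>x. max 0 (u x T)) \<le> integral {-L..p s} (\<lambda>x. max 0 (u x s))"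
proof -
  note K = kato[where \<phi> = "\<lambda>_. 1" and ?\<phi>1.0 = "\<lambda>_. 0" and ?\<phi>2.0 = "\<lambda>_. 0", OF assms]
  have 1: "(\<lambda>t. positive_flux s T t * (if -L < p t - a then 1 else 0)) integrable_on {s..T}"
    by (rule K(1)) auto
  have 2: "integral {-L..p T} (\<lambda>x. 1 * max 0 (u x T)) - integral {-L..p s} (\<lambda>x. 1 * max 0 (u x s))
      \<le> integral {s..T} (\<lambda>t. integral {-L..p t} (\<lambda>x. 0 * max 0 (u x t)))
        + integral {s..T} (\<lambda>t. positive_flux s T t * (if -L < p t - a then 1 else 0))
        - integral {s..T} (\<lambda>t. positive_flux s T t * 1)"
    by (rule K(2)) auto
  have "integral {s..T} (\<lambda>t. positive_flux s T t * (if -L < p t - a then 1 else 0)) \<le> integral {s..T} (\<lambda>t. positive_flux s T t * 1)"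
    by (rule integral_le[OF 1 positive_flux_integrable[OF assms]]) (auto intro!: mult_left_mono positive_flux_nonneg)
  with 2 show ?thesis by simp
qed

text \<open>The integral tends to 0 at time 0, cannot increase and is nonnegative, hence it is 0;
  continuity of the slice gives the pointwise sign.\<close>

lemma nonpositive_left_of_p:
  assumes lim: "((\<lambda>t. integral {-L..p t} (\<lambda>x. max 0 (u x t))) \<longlongrightarrow> 0) (at_right 0)"
    and t: "0 < t" and x: "x \<in> {-L..p t}"
  shows "u x t \<le> 0"
proof -
  have c: "continuous_on {-L..p t} (\<lambda>x. max 0 (u x t))"
    using p_bounds[OF t] by (intro continuous_intros continuous_on_subset[OF slice_continuous[OF t]]) auto
  have "integral {-L..p t} (\<lambda>x. max 0 (u x t)) \<le> 0"
  proof (rule tendsto_lowerbound[OF lim])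
    show "\<forall>\<^sub>F s in at_right 0. integral {-L..p t} (\<lambda>x. max 0 (u x t)) \<le> integral {-L..p s} (\<lambda>x. max 0 (u x s))"
      using eventually_at_right_less[of "0::real"] eventually_at_right_real[OF t]
      by eventually_elim (auto intro!: positive_mass_decreasing)
  qed simp
  moreover have "0 \<le> integral {-L..p t} (\<lambda>x. max 0 (u x t))"
    by (intro integral_nonneg integrable_continuous_interval c) auto
  ultimately have "integral (cbox (-L) (p t)) (\<lambda>x. max 0 (u x t)) = 0" by simp
  then have "max 0 (u x t) = 0"
    using integral_cbox_eq_0_iff[of "-L" "p t" "\<lambda>x. max 0 (u x t)"] c p_bounds[OF t] x by auto
  then show ?thesis by simp
qed

end

text \<open>The sign condition on the datum survives only in the two traces, from which the sign of
  \<open>f\<close> at positive times is recovered. Reflection exchanges the traces and the masses,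
  so the locale is closed under it.\<close>

locale conserving_solution = weak_solution L a f p \<kappa> for L a f p \<kappa> +
  fixes M\<^sub>B M\<^sub>V :: real
  assumes left_trace: "((\<lambda>t. integral {-L..p t} (\<lambda>x. max 0 (- f x t))) \<longlongrightarrow> 0) (at_right 0)"
    and right_trace: "((\<lambda>t. integral {p t..L} (\<lambda>x. max 0 (f x t))) \<longlongrightarrow> 0) (at_right 0)"
    and buyers: "\<And>t. 0 < t \<Longrightarrow> integral {-L..p t} (\<lambda>x. f x t) = M\<^sub>B"
    and vendors: "\<And>t. 0 < t \<Longrightarrow> integral {p t..L} (\<lambda>x. - f x t) = M\<^sub>V"
    and M\<^sub>B_pos: "0 < M\<^sub>B" and M\<^sub>V_pos: "0 < M\<^sub>V"
begin

lemma conserving_solution_reflect: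
  "conserving_solution L a (\<lambda>x t. - f (- x) t) (\<lambda>t. - p t) \<kappa> M\<^sub>V M\<^sub>B"
proof -
  interpret r: weak_solution L a "\<lambda>x t. - f (- x) t" "\<lambda>t. - p t" \<kappa>
    by (rule weak_solution_reflect)
  have refl: "integral {-L..- c} (\<lambda>x. g (- x)) = integral {c..L} g" "integral {- c..L} (\<lambda>x. g (- x)) = integral {-L..c} g"
    for g :: "real \<Rightarrow> real" and c
    using Henstock_Kurzweil_Integration.integral_reflect_real[of L c g]
      Henstock_Kurzweil_Integration.integral_reflect_real[of c "-L" g] by simp_all
  show ?thesis
  proof
    show "((\<lambda>t. integral {-L..- p t} (\<lambda>x. max 0 (- (- f (- x) t)))) \<longlongrightarrow> 0) (at_right 0)"
      using right_trace refl(1)[of _ "\<lambda>x. max 0 (f x _)"] by simp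
    show "((\<lambda>t. integral {- p t..L} (\<lambda>x. max 0 (- f (- x) t))) \<longlongrightarrow> 0) (at_right 0)"
      using left_trace refl(2)[of _ "\<lambda>x. max 0 (- f x _)"] by simp
    show "integral {-L..- p t} (\<lambda>x. - f (- x) t) = M\<^sub>V" if "0 < t" for t
      using vendors[OF that] refl(1)[of "p t" "\<lambda>x. - f x t"] by simp
    show "integral {- p t..L} (\<lambda>x. - (- f (- x) t)) = M\<^sub>B" if "0 < t" for t
      using buyers[OF that] refl(2)[of "p t" "\<lambda>x. f x t"] by simp
  qed (rule M\<^sub>V_pos M\<^sub>B_pos)+
qed

lemma f_nonneg:
  assumes "0 < t" "x \<in> {-L..p t}"
  shows "0 \<le> f x t"
  using weak_solution.nonpositive_left_of_p[OF weak_solution_neg left_trace assms] by simp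

text \<open>A negative value would make \<open>f\<close> negative immediately to the left of
  \<open>p t\<close>, against \<open>f_nonneg\<close>.\<close>

lemma flux_nonneg:
  assumes t: "0 < t"
  shows "0 \<le> \<kappa> t"
proof (rule ccontr)
  assume "\<not> 0 \<le> \<kappa> t"
  then have "0 < - \<kappa> t" by simp
  from DERIV_pos_inc_left[OF flux[OF t] this]
  obtain d where d: "0 < d" "\<And>h. 0 < h \<Longrightarrow> h < d \<Longrightarrow> f (p t - h) t < f (p t) t" by blast
  define h where "h = min (d / 2) (p t + L)"
  have h: "0 < h" "h < d" "h \<le> p t + L"
    using d(1) p_bounds[OF t] by (auto simp: h_def)
  have "0 \<le> f (p t - h) t"
    using h by (intro f_nonneg t) auto
  then show False using d(2)[OF h(1,2)] zero[OF t] by simp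
qed

lemma weighted_continuous:
  assumes "0 < t" "continuous_on UNIV \<phi>"
  shows "continuous_on {-L..p t} (\<lambda>x. \<phi> x * f x t)"
  using u_slice_continuous[OF assms(1) _ _ assms(2), of "-L" "p t" "\<lambda>v. v"] p_bounds[OF assms(1)] by simp

text \<open>
  The mass of the buyers is conserved, so the upper bound for the weight \<open>c - \<phi>\<close> is a lower
  bound for the weight \<open>\<phi>\<close>.
\<close>

lemma buyers_lower_bound:
  fixes \<phi> \<phi>1 \<phi>2 :: "real \<Rightarrow> real"
  assumes times: "0 < s" "s < T"
    and \<phi>: "\<And>x. (\<phi> has_real_derivative \<phi>1 x) (at x)" "\<And>x. (\<phi>1 has_real_derivative \<phi>2 x) (at x)"
      "continuous_on UNIV \<phi>2" and c: "\<And>x. x \<in> {-L..L} \<Longrightarrow> \<phi> x \<le> c" and \<phi>L: "\<phi>1 (-L) = 0"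
    and G: "\<And>t. t \<in> {s..T} \<Longrightarrow> G \<le> (c - \<phi> (p t)) - (if -L < p t - a then c - \<phi> (p t - a) else 0)"
  shows "integral {s..T} (\<lambda>t. integral {-L..p t} (\<lambda>x. \<phi>2 x * f x t)) + integral {s..T} (\<lambda>t. positive_flux s T t * G)
    \<le> integral {-L..p T} (\<lambda>x. \<phi> x * f x T) - integral {-L..p s} (\<lambda>x. \<phi> x * f x s)"
proof -
  let ?k = "positive_flux s T"
  let ?src = "\<lambda>t. if -L < p t - a then c - \<phi> (p t - a) else 0"
  have cont: "continuous_on A g" if "\<And>x. (g has_real_derivative g' x) (at x)" for A and g g' :: "real \<Rightarrow> real"
    using that by (meson DERIV_continuous_on has_field_derivative_at_within)
  have d: "((\<lambda>x. c - \<phi> x) has_real_derivative - \<phi>1 x) (at x)" "((\<lambda>x. - \<phi>1 x) has_real_derivative - \<phi>2 x) (at x)"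
    "continuous_on UNIV (\<lambda>x. - \<phi>2 x)" for x
    using DERIV_diff[OF DERIV_const \<phi>(1)] DERIV_minus[OF \<phi>(2)] \<phi>(3) by (auto intro: continuous_on_minus)
  have K1: "(\<lambda>t. ?k t * ?src t) integrable_on {s..T}"
    by (rule kato(1)[OF times d]) (use c \<phi>L in auto)
  have K2: "integral {-L..p T} (\<lambda>x. (c - \<phi> x) * max 0 (f x T)) - integral {-L..p s} (\<lambda>x. (c - \<phi> x) * max 0 (f x s))
      \<le> integral {s..T} (\<lambda>t. integral {-L..p t} (\<lambda>x. - \<phi>2 x * max 0 (f x t)))
        + integral {s..T} (\<lambda>t. ?k t * ?src t) - integral {s..T} (\<lambda>t. ?k t * (c - \<phi> (p t)))"
    by (rule kato(2)[OF times d]) (use c \<phi>L in auto)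
  have mass: "integral {-L..p t} (\<lambda>x. (c - \<phi> x) * max 0 (f x t)) = c * M\<^sub>B - integral {-L..p t} (\<lambda>x. \<phi> x * f x t)" if t: "0 < t" for t
  proof -
    have "integral {-L..p t} (\<lambda>x. (c - \<phi> x) * max 0 (f x t)) = integral {-L..p t} (\<lambda>x. c * f x t - \<phi> x * f x t)"
      using f_nonneg[OF t] by (intro integral_cong) (simp add: left_diff_distrib)
    also have "\<dots> = integral {-L..p t} (\<lambda>x. c * f x t) - integral {-L..p t} (\<lambda>x. \<phi> x * f x t)"
      by (intro Henstock_Kurzweil_Integration.integral_diff integrable_continuous_interval weighted_continuous t continuous_on_const cont[OF \<phi>(1)])
    also have "integral {-L..p t} (\<lambda>x. c * f x t) = c * M\<^sub>B"
      using buyers[OF t] by simp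
    finally show ?thesis .
  qed
  have inner: "integral {s..T} (\<lambda>t. integral {-L..p t} (\<lambda>x. - \<phi>2 x * max 0 (f x t))) = - integral {s..T} (\<lambda>t. integral {-L..p t} (\<lambda>x. \<phi>2 x * f x t))"
  proof -
    have "integral {-L..p t} (\<lambda>x. - \<phi>2 x * max 0 (f x t)) = - integral {-L..p t} (\<lambda>x. \<phi>2 x * f x t)" if "t \<in> {s..T}" for t
    proof -
      have "integral {-L..p t} (\<lambda>x. - \<phi>2 x * max 0 (f x t)) = integral {-L..p t} (\<lambda>x. - (\<phi>2 x * f x t))"
        using f_nonneg[of t] that times by (intro integral_cong) simp
      then show ?thesis by simp
    qed
    then have "integral {s..T} (\<lambda>t. integral {-L..p t} (\<lambda>x. - \<phi>2 x * max 0 (f x t))) = integral {s..T} (\<lambda>t. - integral {-L..p t} (\<lambda>x. \<phi>2 x * f x t))"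
      by (intro integral_cong)
    then show ?thesis by simp
  qed
  have P1: "(\<lambda>t. ?k t * (c - \<phi> (p t))) integrable_on {s..T}"
    by (intro positive_flux_weight_integrable times continuous_on_diff continuous_on_const
        continuous_on_comp_UNIV[OF cont[OF \<phi>(1)]] p_cont_subset)
  have "integral {s..T} (\<lambda>t. ?k t * G) \<le> integral {s..T} (\<lambda>t. ?k t * (c - \<phi> (p t)) - ?k t * ?src t)"
  proof (rule integral_le[OF positive_flux_integrable[OF times] integrable_diff[OF P1 K1]])
    fix t assume "t \<in> {s..T}"
    then show "?k t * G \<le> ?k t * (c - \<phi> (p t)) - ?k t * ?src t"
      using mult_left_mono[OF G positive_flux_nonneg] by (simp add: right_diff_distrib)
  qed
  also have "\<dots> = integral {s..T} (\<lambda>t. ?k t * (c - \<phi> (p t))) - integral {s..T} (\<lambda>t. ?k t * ?src t)"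
    by (rule Henstock_Kurzweil_Integration.integral_diff[OF P1 K1])
  finally show ?thesis
    using K2 mass[of T] mass[of s] inner times by simp
qed

lemma weighted_mass_bounds:
  assumes t: "0 < t" and \<phi>: "continuous_on UNIV \<phi>" and bounds: "\<And>x. x \<in> {-L..L} \<Longrightarrow> b \<le> \<phi> x \<and> \<phi> x \<le> c"
  shows "b * M\<^sub>B \<le> integral {-L..p t} (\<lambda>x. \<phi> x * f x t)" "integral {-L..p t} (\<lambda>x. \<phi> x * f x t) \<le> c * M\<^sub>B"
proof -
  have i: "(\<lambda>x. \<phi> x * f x t) integrable_on {-L..p t}" "(\<lambda>x. d * f x t) integrable_on {-L..p t}" for d
    by (intro integrable_continuous_interval weighted_continuous t \<phi> continuous_on_const)+
  have e: "integral {-L..p t} (\<lambda>x. d * f x t) = d * M\<^sub>B" for d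
    using buyers[OF t] by simp
  have "integral {-L..p t} (\<lambda>x. b * f x t) \<le> integral {-L..p t} (\<lambda>x. \<phi> x * f x t)"
    using bounds p_bounds[OF t] f_nonneg[OF t] by (intro integral_le i mult_right_mono) auto
  then show "b * M\<^sub>B \<le> integral {-L..p t} (\<lambda>x. \<phi> x * f x t)" by (simp only: e)
  have "integral {-L..p t} (\<lambda>x. \<phi> x * f x t) \<le> integral {-L..p t} (\<lambda>x. c * f x t)"
    using bounds p_bounds[OF t] f_nonneg[OF t] by (intro integral_le i mult_right_mono) auto
  then show "integral {-L..p t} (\<lambda>x. \<phi> x * f x t) \<le> c * M\<^sub>B" by (simp only: e)
qed

text \<open>
  While \<open>p - a < -L\<close> the buyers receive no source, hence lose nothing either, and their density
  solves the heat equation on \<open>(-L, L)\<close> although it vanishes beyond \<open>p\<close>.  The moment against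
  \<open>cosh (n (x + L))\<close> then grows like \<open>exp (n\<^sup>2 t)\<close> while staying below \<open>M\<^sub>B exp (2 n L)\<close>.
\<close>

lemma price_ge:
  assumes t0: "0 < t0"
  shows "-L + a \<le> p t0"
proof (rule ccontr)
  assume "\<not> -L + a \<le> p t0"
  then have less: "p t0 < -L + a" by simp
  have "isCont p t0"
    using continuous_on_eq_continuous_at[OF open_greaterThan, of 0 p] p_cont t0 by auto
  then have "\<forall>\<^sub>F t in nhds t0. p t < -L + a"
    using less by (metis isCont_def tendsto_at_iff_tendsto_nhds order_tendstoD(2))
  then obtain d where d: "0 < d" "\<And>t. dist t t0 < d \<Longrightarrow> p t < -L + a"
    by (auto simp: eventually_nhds_metric)
  define \<tau> where "\<tau> = d / 2"
  have \<tau>: "0 < \<tau>" using d(1) by (simp add: \<tau>_def)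
  have out: "p t < -L + a" if "t \<in> {t0..t0 + \<tau>}" for t
    using that d(1) by (intro d(2)) (auto simp: dist_real_def \<tau>_def)
  have Lpos: "-L < L" using p_bounds[OF t0] by auto
  \<comment> \<open>The moment yields \<open>(1 + \<tau>) ^ (n * n) \<le> exp (2 * n * L)\<close>.
    The \<open>n\<close>-th root leaves a left side unbounded in \<open>n\<close> and a right side
    independent of it.\<close>
  have bound: "(1 + \<tau>) ^ n \<le> exp (2 * L)" if n: "1 \<le> n" for n :: nat
  proof -
    define \<phi> where "\<phi> x = cosh (real n * (x + L))" for x
    define \<phi>1 where "\<phi>1 x = real n * sinh (real n * (x + L))" for x
    define \<phi>2 where "\<phi>2 x = (real n)\<^sup>2 * \<phi> x" for x
    define c where "c = cosh (real n * (2 * L))"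
    have d\<phi>: "(\<phi> has_real_derivative \<phi>1 x) (at x)" "(\<phi>1 has_real_derivative \<phi>2 x) (at x)" for x
      unfolding \<phi>_def[abs_def] \<phi>1_def[abs_def] \<phi>2_def
      by (auto intro!: derivative_eq_intros simp: power2_eq_square)
    have \<phi>c: "continuous_on UNIV \<phi>"
      using d\<phi>(1) by (meson DERIV_continuous_on has_field_derivative_at_within)
    then have \<phi>2c: "continuous_on UNIV \<phi>2"
      unfolding \<phi>2_def[abs_def] by (intro continuous_intros)
    have \<phi>b: "1 \<le> \<phi> x \<and> \<phi> x \<le> c" if "x \<in> {-L..L}" for x
    proof
      show "1 \<le> \<phi> x" by (simp add: \<phi>_def cosh_real_ge_1)
      have 0: "0 \<le> real n * (x + L)" and le: "real n * (x + L) \<le> real n * (2 * L)"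
        using that by (auto intro: mult_left_mono)
      show "\<phi> x \<le> c"
        unfolding \<phi>_def c_def using le by (simp only: cosh_real_nonneg_le_iff[OF 0 order_trans[OF 0 le]])
    qed
    define W where "W t = integral {-L..p t} (\<lambda>x. \<phi> x * f x t)" for t
    have W_bounds: "M\<^sub>B \<le> W t" "W t \<le> c * M\<^sub>B" if "0 < t" for t
      using weighted_mass_bounds[OF that \<phi>c \<phi>b] by (simp_all add: W_def)
    \<comment> \<open>With the source beyond the wall only the loss \<open>c - \<phi> (p t)\<close>
      is left, which is nonnegative, so \<open>G = 0\<close> is admissible in
      \<open>buyers_lower_bound\<close>.\<close>
    have grow: "(real n)\<^sup>2 * integral {s..T} W \<le> W T - W s" if sT: "t0 \<le> s" "s < T" "T \<le> t0 + \<tau>" for s T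
    proof -
      have "integral {s..T} (\<lambda>t. integral {-L..p t} (\<lambda>x. \<phi>2 x * f x t)) + integral {s..T} (\<lambda>t. positive_flux s T t * 0) \<le> W T - W s"
        unfolding W_def
      proof (rule buyers_lower_bound[OF _ sT(2) d\<phi> \<phi>2c])
        show "0 < s" using sT t0 by simp
        show "\<phi> x \<le> c" if "x \<in> {-L..L}" for x using \<phi>b[OF that] by simp
        show "\<phi>1 (-L) = 0" by (simp add: \<phi>1_def)
        fix t assume t: "t \<in> {s..T}"
        then have "p t < -L + a" "0 < t" using out[of t] sT t0 by auto
        then show "0 \<le> c - \<phi> (p t) - (if -L < p t - a then c - \<phi> (p t - a) else 0)"
          using \<phi>b[of "p t"] p_bounds[of t] by auto
      qed
      moreover have "(\<lambda>t. integral {-L..p t} (\<lambda>x. \<phi>2 x * f x t)) = (\<lambda>t. (real n)\<^sup>2 * W t)"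
        by (simp add: \<phi>2_def W_def mult.assoc)
      ultimately show ?thesis by simp
    qed
    have W_int: "W integrable_on {s..T}" if "0 < s" for s T
    proof -
      have "continuous_on ({-L..L} \<times> {s..T}) (\<lambda>(x, t). \<phi> x * f x t)"
        using u_slab_continuous[OF that _ \<phi>c continuous_on_id, of "-L" T] by simp
      moreover have "-L < p t \<and> p t \<le> L" if "t \<in> {s..T}" for t
        using p_bounds[of t] that \<open>0 < s\<close> by auto
      ultimately show ?thesis
        unfolding W_def[abs_def]
        by (intro integrable_continuous_interval continuous_on_moving_integral[OF _ p_cont_subset[OF that]])
    qed
    have mono: "W s \<le> W t" if "t0 \<le> s" "s < t" "t \<le> t0 + \<tau>" for s t
    proof -
      have "0 \<le> integral {s..t} W"
        using W_bounds(1) M\<^sub>B_pos that t0 by (intro integral_nonneg W_int) (auto intro!: order_trans[OF less_imp_le[OF M\<^sub>B_pos]])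
      then have "0 \<le> (real n)\<^sup>2 * integral {s..t} W" by simp
      then show ?thesis using grow[OF that] by simp
    qed
    have step: "W s * (1 + (real n)\<^sup>2 * (T - s)) \<le> W T" if sT: "t0 \<le> s" "s < T" "T \<le> t0 + \<tau>" for s T
    proof -
      have "integral {s..T} (\<lambda>_. W s) \<le> integral {s..T} W"
      proof (rule integral_le[OF integrable_const_ivl W_int])
        fix t assume "t \<in> {s..T}"
        then show "W s \<le> W t" using mono[of s t] sT by (cases "s = t") auto
      qed (use sT t0 in simp)
      then have "(real n)\<^sup>2 * (W s * (T - s)) \<le> (real n)\<^sup>2 * integral {s..T} W"
        using sT by (intro mult_left_mono) (auto simp: mult.commute)
      then show ?thesis using grow[OF sT] by (simp add: algebra_simps)
    qed
    \<comment> \<open>A discrete Gronwall argument: \<open>n\<^sup>2\<close> steps of length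
      \<open>\<eta>\<close> fill the time window of length \<open>\<tau>\<close>, and each
      multiplies \<open>W\<close> by at least
      \<open>1 + n\<^sup>2 * \<eta> = 1 + \<tau>\<close>.\<close>
    define \<eta> where "\<eta> = \<tau> / (real n)\<^sup>2"
    have \<eta>: "0 < \<eta>" "(real n)\<^sup>2 * \<eta> = \<tau>" using n \<tau> by (auto simp: \<eta>_def)
    have iter: "M\<^sub>B * (1 + \<tau>) ^ i \<le> W (t0 + real i * \<eta>)" if "i \<le> n\<^sup>2" for i
      using that
    proof (induction i)
      case 0
      then show ?case using W_bounds(1)[OF t0] by simp
    next
      case (Suc i)
      have "real (Suc i) * \<eta> \<le> real (n\<^sup>2) * \<eta>"
        by (rule mult_right_mono[OF of_nat_mono[OF Suc.prems] less_imp_le[OF \<eta>(1)]])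
      also have "\<dots> = \<tau>" using \<eta>(2) by simp
      finally have le: "real (Suc i) * \<eta> \<le> \<tau>" .
      have "M\<^sub>B * (1 + \<tau>) ^ Suc i = (M\<^sub>B * (1 + \<tau>) ^ i) * (1 + \<tau>)" by simp
      also have "\<dots> \<le> W (t0 + real i * \<eta>) * (1 + \<tau>)"
        using Suc \<tau> by (intro mult_right_mono) auto
      also have "\<dots> = W (t0 + real i * \<eta>) * (1 + (real n)\<^sup>2 * ((t0 + real (Suc i) * \<eta>) - (t0 + real i * \<eta>)))"
        using \<eta>(2) by (simp add: algebra_simps)
      also have "\<dots> \<le> W (t0 + real (Suc i) * \<eta>)"
        using \<eta>(1) le by (intro step) (auto simp: algebra_simps)
      finally show ?case .
    qed
    have "M\<^sub>B * (1 + \<tau>) ^ n\<^sup>2 \<le> c * M\<^sub>B"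
      using iter[of "n\<^sup>2"] W_bounds(2)[of "t0 + real (n\<^sup>2) * \<eta>"] \<eta>(2) \<tau> t0 by simp
    then have "(1 + \<tau>) ^ n\<^sup>2 \<le> c" using M\<^sub>B_pos by (simp add: mult.commute)
    also have "c \<le> exp (real n * (2 * L))"
    proof -
      have "exp (- (real n * (2 * L))) \<le> exp (real n * (2 * L))" using Lpos by simp
      then show ?thesis by (simp add: c_def cosh_def)
    qed
    also have "\<dots> = exp (2 * L) ^ n"
      by (simp add: exp_of_nat_mult)
    finally have "((1 + \<tau>) ^ n) ^ n \<le> exp (2 * L) ^ n"
      by (simp add: power2_eq_square power_mult)
    moreover obtain k where "n = Suc k" using n by (cases n) auto
    ultimately show ?thesis
      using power_le_imp_le_base[of "(1 + \<tau>) ^ n" k "exp (2 * L)"] by simp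
  qed
  obtain n where "exp (2 * L) < (1 + \<tau>) ^ n"
    using real_arch_pow[of "1 + \<tau>" "exp (2 * L)"] \<tau> by auto
  also have "\<dots> \<le> (1 + \<tau>) ^ max 1 n" using \<tau> by (intro power_increasing) auto
  also have "\<dots> \<le> exp (2 * L)" by (rule bound) simp
  finally show False by simp
qed

text \<open>The buyers carry the weight \<open>- q * (x + L)\<^sup>2 / 2\<close>, whose sign is
  admissible because \<open>buyers_lower_bound\<close> asks only for an upper bound on the weight.
  The vendors carry \<open>a * (x + L)\<^sup>2 / 2\<close> in reflected coordinates, that is
  \<open>a * (L - x)\<^sup>2 / 2\<close> in the original ones.\<close>

lemma mass_ratio_bound:
  assumes "a < L"
  shows "a * M\<^sub>V \<le> (4 * L - 3 * a) * M\<^sub>B"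
proof (rule ccontr)
  assume neg: "\<not> a * M\<^sub>V \<le> (4 * L - 3 * a) * M\<^sub>B"
  define q where "q = 4 * L - 3 * a"
  have q: "0 < q" using assms a_pos by (simp add: q_def)
  interpret r: conserving_solution L a "\<lambda>x t. - f (- x) t" "\<lambda>t. - p t" \<kappa> M\<^sub>V M\<^sub>B
    by (rule conserving_solution_reflect)
  define D where "D = a * M\<^sub>V - q * M\<^sub>B"
  have D: "0 < D" using neg by (simp add: D_def q_def)
  \<comment> \<open>\<open>E\<close> bounds the growth of the combined moment, since
    \<open>(x + L)\<^sup>2 / 2\<close> is at most \<open>2 * L\<^sup>2\<close>. With this
    \<open>T\<close> the growth forced on it, \<open>D * (T - 1) = D + E\<close>, is larger. Time
    starts at 1 because the estimates need a positive initial time.\<close>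
  define E where "E = (a * (2 * L\<^sup>2)) * M\<^sub>V + (q * (2 * L\<^sup>2)) * M\<^sub>B"
  define T where "T = 2 + E / D"
  have "0 \<le> E" using a_pos q M\<^sub>B_pos M\<^sub>V_pos by (simp add: E_def)
  then have T: "1 < T" "0 < (1::real)" using D by (auto simp: T_def add_pos_nonneg intro: less_le_trans[of _ 2])
  have sq: "0 \<le> (x + L)\<^sup>2 / 2 \<and> (x + L)\<^sup>2 / 2 \<le> 2 * L\<^sup>2" if "x \<in> {-L..L}" for x
  proof -
    have "(x + L)\<^sup>2 \<le> (2 * L)\<^sup>2" using that by (intro power_mono) auto
    then show ?thesis by (simp add: power_mult_distrib)
  qed
  have d: "((\<lambda>x. k * ((x + L)\<^sup>2 / 2)) has_real_derivative k * (x + L)) (at x)"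
    "((\<lambda>x. k * (x + L)) has_real_derivative k) (at x)" for k x
    by (auto intro!: derivative_eq_intros)
  have kc: "continuous_on UNIV (\<lambda>x. k * ((x + L)\<^sup>2 / 2))" for k
    by (intro continuous_intros) auto
  \<comment> \<open>The common exchange constant: factor \<open>q\<close> times the least loss
    \<open>a\<^sup>2 / 2\<close> of the buyers equals factor \<open>a\<close> times the greatest
    loss \<open>a * q / 2\<close> of the vendors. This equality dictates the factors
    \<open>q\<close> and \<open>a\<close>.\<close>
  let ?G = "q * a\<^sup>2 / 2"
  have B: "integral {1..T} (\<lambda>t. integral {-L..p t} (\<lambda>x. - q * f x t)) + integral {1..T} (\<lambda>t. positive_flux 1 T t * ?G)
    \<le> integral {-L..p T} (\<lambda>x. - q * ((x + L)\<^sup>2 / 2) * f x T) - integral {-L..p 1} (\<lambda>x. - q * ((x + L)\<^sup>2 / 2) * f x 1)"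
  proof (rule buyers_lower_bound[OF T(2,1) d continuous_on_const, where c = 0])
    show "- q * ((x + L)\<^sup>2 / 2) \<le> 0" for x using q by simp
    fix t assume "t \<in> {1..T}"
    then have p: "-L + a \<le> p t" by (intro price_ge) auto
    then have "a * a \<le> a * (2 * (p t + L) - a)" using a_pos by (intro mult_left_mono) auto
    then have "q / 2 * a\<^sup>2 \<le> q / 2 * (a * (2 * (p t + L) - a))" using q by (simp add: power2_eq_square)
    also have "\<dots> = q * ((p t + L)\<^sup>2 / 2) - q * ((p t - a + L)\<^sup>2 / 2)"
      by (simp add: power2_eq_square field_simps)
    finally have le: "?G \<le> q * ((p t + L)\<^sup>2 / 2) - q * ((p t - a + L)\<^sup>2 / 2)" by simp
    then show "?G \<le> 0 - - q * ((p t + L)\<^sup>2 / 2) - (if -L < p t - a then 0 - - q * ((p t - a + L)\<^sup>2 / 2) else 0)"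
    proof (cases "-L < p t - a")
      \<comment> \<open>Only \<open>p t - a = -L\<close> is left, and there the omitted source term
        has weight 0.\<close>
      case False
      then have "p t - a + L = 0" using p by simp
      then show ?thesis using le by simp
    qed simp
  qed simp
  have V: "integral {1..T} (\<lambda>t. integral {-L..- p t} (\<lambda>x. a * - f (- x) t)) + integral {1..T} (\<lambda>t. positive_flux 1 T t * - ?G)
    \<le> integral {-L..- p T} (\<lambda>x. a * ((x + L)\<^sup>2 / 2) * - f (- x) T) - integral {-L..- p 1} (\<lambda>x. a * ((x + L)\<^sup>2 / 2) * - f (- x) 1)"
  proof (rule r.buyers_lower_bound[OF T(2,1) d continuous_on_const, where c = "a * (2 * L\<^sup>2)"])
    show "a * ((x + L)\<^sup>2 / 2) \<le> a * (2 * L\<^sup>2)" if "x \<in> {-L..L}" for x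
      using sq[OF that] a_pos by (intro mult_left_mono) auto
    fix t assume t: "t \<in> {1..T}"
    define z where "z = - p t"
    \<comment> \<open>The upper bound on \<open>z\<close> gives
      \<open>2 * (z + L) - a \<le> q\<close>, where \<open>4 * L - 3 * a\<close> originates. By the
      lower bound the source is dropped only where its weight is 0.\<close>
    have z: "-L + a \<le> z" "z \<le> L - a"
      using r.price_ge[of t] price_ge[of t] t by (auto simp: z_def)
    have "a * (2 * (z + L) - a) \<le> a * q" using z a_pos by (intro mult_left_mono) (auto simp: q_def)
    then have "a / 2 * (a * (2 * (z + L) - a)) \<le> a / 2 * (a * q)" using a_pos by (intro mult_left_mono) auto
    moreover have "a / 2 * (a * (2 * (z + L) - a)) = a * ((z + L)\<^sup>2 / 2) - a * ((z - a + L)\<^sup>2 / 2)"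
      by (simp add: power2_eq_square field_simps)
    moreover have "a / 2 * (a * q) = ?G" by (simp add: power2_eq_square)
    ultimately have "- ?G \<le> a * ((z - a + L)\<^sup>2 / 2) - a * ((z + L)\<^sup>2 / 2)"
      by linarith
    moreover have "a * ((z - a + L)\<^sup>2 / 2) = 0" if "\<not> -L < z - a" using that z by simp
    moreover have "0 \<le> a * (2 * L\<^sup>2)" using a_pos by simp
    ultimately show "- ?G \<le> a * (2 * L\<^sup>2) - a * ((- p t + L)\<^sup>2 / 2) - (if -L < - p t - a then a * (2 * L\<^sup>2) - a * ((- p t - a + L)\<^sup>2 / 2) else 0)"
      unfolding z_def[symmetric] by (cases "-L < z - a") auto
  qed simp
  have "integral {1..T} (\<lambda>t. integral {-L..p t} (\<lambda>x. - q * f x t)) = integral {1..T} (\<lambda>t. - q * M\<^sub>B)"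
  proof (rule integral_cong)
    fix t assume "t \<in> {1..T}"
    then show "integral {-L..p t} (\<lambda>x. - q * f x t) = - q * M\<^sub>B"
      using buyers[of t] by (subst integral_mult_right) auto
  qed
  then have 1: "integral {1..T} (\<lambda>t. integral {-L..p t} (\<lambda>x. - q * f x t)) = - q * M\<^sub>B * (T - 1)"
    using T by (simp add: mult.commute)
  have "integral {1..T} (\<lambda>t. integral {-L..- p t} (\<lambda>x. a * - f (- x) t)) = integral {1..T} (\<lambda>t. a * M\<^sub>V)"
  proof (rule integral_cong)
    fix t assume "t \<in> {1..T}"
    then show "integral {-L..- p t} (\<lambda>x. a * - f (- x) t) = a * M\<^sub>V"
      using r.buyers[of t] by (subst integral_mult_right) auto
  qed
  then have 2: "integral {1..T} (\<lambda>t. integral {-L..- p t} (\<lambda>x. a * - f (- x) t)) = a * M\<^sub>V * (T - 1)"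
    using T by (simp add: mult.commute)
  have 3: "integral {1..T} (\<lambda>t. positive_flux 1 T t * - ?G) = - integral {1..T} (\<lambda>t. positive_flux 1 T t * ?G)"
    by simp
  have bq: "- (q * (2 * L\<^sup>2)) \<le> - q * ((x + L)\<^sup>2 / 2) \<and> - q * ((x + L)\<^sup>2 / 2) \<le> 0" if "x \<in> {-L..L}" for x
    using sq[OF that] q mult_left_mono[of "(x + L)\<^sup>2 / 2" "2 * L\<^sup>2" q] by auto
  have ba: "0 \<le> a * ((x + L)\<^sup>2 / 2) \<and> a * ((x + L)\<^sup>2 / 2) \<le> a * (2 * L\<^sup>2)" if "x \<in> {-L..L}" for x
    using sq[OF that] a_pos mult_left_mono[of "(x + L)\<^sup>2 / 2" "2 * L\<^sup>2" a] by auto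
  define X where "X t = integral {-L..p t} (\<lambda>x. - q * ((x + L)\<^sup>2 / 2) * f x t)" for t
  define Y where "Y t = integral {-L..- p t} (\<lambda>x. a * ((x + L)\<^sup>2 / 2) * - f (- x) t)" for t
  \<comment> \<open>The same \<open>I\<close> enters both inequalities, with opposite signs:
    reflection leaves \<open>\<kappa>\<close>, and hence \<open>positive_flux\<close>,
    unchanged.\<close>
  define I where "I = integral {1..T} (\<lambda>t. positive_flux 1 T t * ?G)"
  have wB: "- (q * (2 * L\<^sup>2)) * M\<^sub>B \<le> X t" "X t \<le> 0 * M\<^sub>B" if "0 < t" for t
    unfolding X_def by (rule weighted_mass_bounds[OF that kc bq], assumption)+
  have wV: "0 * M\<^sub>V \<le> Y t" "Y t \<le> a * (2 * L\<^sup>2) * M\<^sub>V" if "0 < t" for t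
    unfolding Y_def by (rule r.weighted_mass_bounds[OF that kc ba], assumption)+
  have B': "- q * M\<^sub>B * (T - 1) + I \<le> X T - X 1"
    using B unfolding 1 X_def I_def .
  have V': "a * M\<^sub>V * (T - 1) + - I \<le> Y T - Y 1"
    using V unfolding 2 3 Y_def I_def .
  have T0: "0 < T" using T by simp
  have "D * (T - 1) = - q * M\<^sub>B * (T - 1) + a * M\<^sub>V * (T - 1)"
    by (simp add: D_def algebra_simps)
  also have "\<dots> \<le> E"
  proof -
    have "A + A' \<le> V2 + V1"
      if "A + I \<le> X T - X 1" "A' + - I \<le> Y T - Y 1" "- V1 \<le> X 1" "X T \<le> 0" "0 \<le> Y 1" "Y T \<le> V2" for A A' V1 V2
      using that by linarith
    from this[OF B' V', of "q * (2 * L\<^sup>2) * M\<^sub>B" "a * (2 * L\<^sup>2) * M\<^sub>V"] show ?thesis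
      unfolding E_def using wB(1)[OF T(2)] wB(2)[OF T0] wV(1)[OF T(2)] wV(2)[OF T0] by simp
  qed
  finally have "D * (T - 1) \<le> E" .
  moreover have "D * (T - 1) = D + E" using D by (simp add: T_def distrib_left)
  ultimately show False using D by simp
qed

end

section \<open>The initial datum\<close>

text \<open>Links the masses, which are Lebesgue integrals over open intervals, to the gauge
  integrals over closed intervals in the estimates.\<close>

lemma lebesgue_on_open_interval:
  fixes g :: "real \<Rightarrow> real"
  assumes "continuous_on {x..y} g"
  shows "integrable (lebesgue_on {x<..<y}) g" "(LINT z|lebesgue_on {x<..<y}. g z) = integral {x..y} g"
proof -
  have "set_integrable lebesgue {x..y} g"
    using continuous_imp_integrable_real[OF assms] by (simp add: integrable_restrict_space set_integrable_def)
  then have "set_integrable lebesgue {x<..<y} g"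
    by (rule set_integrable_subset) auto
  then show i: "integrable (lebesgue_on {x<..<y}) g"
    by (simp add: integrable_restrict_space set_integrable_def)
  have "(LINT z|lebesgue_on {x<..<y}. g z) = integral {x<..<y} g"
    by (rule lebesgue_integral_eq_integral[OF i]) simp
  then show "(LINT z|lebesgue_on {x<..<y}. g z) = integral {x..y} g"
    by (simp add: integral_open_interval_real)
qed

text \<open>If the integral were 0, the integrand would vanish almost everywhere and the interval
  would be a null set. It supplies the positivity of both initial masses.\<close>

lemma lebesgue_on_positive_integral:
  fixes g :: "real \<Rightarrow> real"
  assumes "x < y" and g: "integrable (lebesgue_on {x<..<y}) g" and pos: "\<And>z. z \<in> {x<..<y} \<Longrightarrow> 0 < g z"
  shows "0 < (LINT z|lebesgue_on {x<..<y}. g z)"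
proof (rule ccontr)
  let ?M = "lebesgue_on {x<..<y}"
  have nn: "AE z in ?M. 0 \<le> g z"
    by (rule AE_I2) (use pos in \<open>auto intro: less_imp_le\<close>)
  assume "\<not> 0 < integral\<^sup>L ?M g"
  moreover have "0 \<le> integral\<^sup>L ?M g" by (rule integral_nonneg_AE[OF nn])
  ultimately have "integral\<^sup>L ?M g = 0" by simp
  then have "AE z in ?M. g z = 0"
    using integral_nonneg_eq_0_iff_AE[OF g nn] by simp
  then have "AE z in ?M. False"
    by (rule AE_mp) (rule AE_I2, use pos in force)
  then have "emeasure ?M (space ?M) = 0"
    by (subst (asm) AE_iff_measurable[OF sets.top]) auto
  then show False
    using \<open>x < y\<close> by (simp add: emeasure_restrict_space)
qed

lemma square_integrable_imp_integrable_open_interval: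
  fixes g :: "real \<Rightarrow> real"
  assumes "g \<in> borel_measurable (lebesgue_on {x<..<y})" "integrable (lebesgue_on {x<..<y}) (\<lambda>z. (g z)\<^sup>2)"
  shows "integrable (lebesgue_on {x<..<y}) g"
proof (rule Bochner_Integration.integrable_bound[OF _ assms(1)])
  show "integrable (lebesgue_on {x<..<y}) (\<lambda>z. 1 + (g z)\<^sup>2)"
    by (intro Bochner_Integration.integrable_add assms(2) lebesgue_on_open_interval(1) continuous_on_const)
  have "\<bar>v\<bar> \<le> 1 + v\<^sup>2" for v :: real
    using zero_le_power2[of "\<bar>v\<bar> - 1/2"] by (simp add: power2_diff power_divide)
  then show "AE z in lebesgue_on {x<..<y}. norm (g z) \<le> norm (1 + (g z)\<^sup>2)"
    by simp
qed

lemma integrable_lebesgue_on_subinterval: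
  fixes g :: "real \<Rightarrow> real"
  assumes "integrable (lebesgue_on S) g" "{x<..<y} \<subseteq> S" "S \<in> sets lebesgue"
  shows "integrable (lebesgue_on {x<..<y}) g"
proof -
  have "set_integrable lebesgue S g"
    using assms by (simp add: integrable_restrict_space set_integrable_def)
  then have "set_integrable lebesgue {x<..<y} g"
    by (rule set_integrable_subset) (use assms in auto)
  then show ?thesis
    by (simp add: integrable_restrict_space set_integrable_def)
qed

lemma abs_le_add_square_div:
  fixes c z :: real
  assumes "0 < c"
  shows "\<bar>z\<bar> \<le> c + z\<^sup>2 / c"
proof -
  have "0 \<le> z\<^sup>2 - \<bar>z\<bar> * c + c\<^sup>2 / 4"
    using zero_le_power2[of "\<bar>z\<bar> - c / 2"] by (simp add: power2_diff power_divide)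
  then have "\<bar>z\<bar> * c \<le> c * c + z\<^sup>2"
    using zero_le_square[of c] unfolding power2_eq_square by linarith
  then show ?thesis using assms by (simp add: field_simps)
qed

text \<open>
  The bound \<open>\<bar>z\<bar> \<le> c + z\<^sup>2 / c\<close> replaces the Cauchy-Schwarz inequality: it turns the \<open>L\<^sup>2\<close>
  convergence into \<open>L\<^sup>1\<close> convergence and controls the datum on the short interval between
  \<open>p\<^sub>0\<close> and \<open>p t\<close>.
\<close>

lemma initial_trace_vanishes:
  fixes f :: "real \<Rightarrow> real \<Rightarrow> real" and f\<^sub>I p :: "real \<Rightarrow> real" and I :: "real \<Rightarrow> real set"
  defines "M \<equiv> \<lambda>L. lebesgue_on {-L<..<L::real}"
  assumes fI: "f\<^sub>I \<in> borel_measurable (M L)" "integrable (M L) (\<lambda>x. (f\<^sub>I x)\<^sup>2)"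
    and f: "\<And>t. 0 < t \<Longrightarrow> continuous_on {-L..L} (\<lambda>x. f x t)"
    and E: "((\<lambda>t. LINT x|M L. (f x t - f\<^sub>I x)\<^sup>2) \<longlongrightarrow> 0) (at_right 0)"
    and p: "(p \<longlongrightarrow> p\<^sub>0) (at_right 0)" and \<sigma>: "\<bar>\<sigma>\<bar> = 1"
    and I: "\<And>t. I t \<in> sets borel"
    and sign: "\<And>t x. 0 < t \<Longrightarrow> x \<in> I t \<Longrightarrow> x \<in> {-L<..<L} \<Longrightarrow> x \<notin> {min p\<^sub>0 (p t)..max p\<^sub>0 (p t)} \<Longrightarrow> 0 \<le> \<sigma> * f\<^sub>I x"
  shows "((\<lambda>t. LINT x|M L. indicator (I t) x * max 0 (- (\<sigma> * f x t))) \<longlongrightarrow> 0) (at_right 0)"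
proof -
  define N where "N = (LINT x|M L. (f\<^sub>I x)\<^sup>2)"
  have N: "0 \<le> N" unfolding N_def by simp
  have const: "integrable (M L) (\<lambda>x. c)" "(LINT x|M L. c) \<le> 2 * \<bar>L\<bar> * \<bar>c\<bar>" for c :: real
  proof -
    show "integrable (M L) (\<lambda>x. c)" unfolding M_def by (rule lebesgue_on_open_interval(1)) simp
    have "(LINT x|M L. c) = integral {-L..L} (\<lambda>x. c)"
      unfolding M_def by (rule lebesgue_on_open_interval(2)) simp
    also have "\<dots> \<le> 2 * \<bar>L\<bar> * \<bar>c\<bar>"
    proof (cases "0 \<le> L")
      case True
      then have "integral {-L..L} (\<lambda>x. c) = 2 * L * c" by simp
      also have "\<dots> \<le> 2 * L * \<bar>c\<bar>" using True by (intro mult_left_mono) auto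
      finally show ?thesis using True by simp
    qed (simp add: mult_nonpos_nonneg)
    finally show "(LINT x|M L. c) \<le> 2 * \<bar>L\<bar> * \<bar>c\<bar>" .
  qed
  have diff_int: "integrable (M L) (\<lambda>x. (f x t - f\<^sub>I x)\<^sup>2)" and f_meas: "(\<lambda>x. f x t) \<in> borel_measurable (M L)" if t: "0 < t" for t
  proof -
    have "integrable (M L) (\<lambda>x. (f x t)\<^sup>2)"
      unfolding M_def by (intro lebesgue_on_open_interval(1) continuous_intros f t)
    then have i: "integrable (M L) (\<lambda>x. 2 * (f x t)\<^sup>2 + 2 * (f\<^sub>I x)\<^sup>2)"
      using fI(2) by (intro Bochner_Integration.integrable_add integrable_mult_right)
    show m: "(\<lambda>x. f x t) \<in> borel_measurable (M L)"
      unfolding M_def by (intro borel_measurable_integrable lebesgue_on_open_interval(1) f t)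
    show "integrable (M L) (\<lambda>x. (f x t - f\<^sub>I x)\<^sup>2)"
    proof (rule Bochner_Integration.integrable_bound[OF i])
      show "(\<lambda>x. (f x t - f\<^sub>I x)\<^sup>2) \<in> borel_measurable (M L)"
        by (intro borel_measurable_power borel_measurable_diff m fI(1))
      have "(v - w)\<^sup>2 \<le> 2 * v\<^sup>2 + 2 * w\<^sup>2" for v w :: real
        using zero_le_power2[of "v + w"] by (simp add: power2_sum power2_diff)
      then show "AE x in M L. norm ((f x t - f\<^sub>I x)\<^sup>2) \<le> norm (2 * (f x t)\<^sup>2 + 2 * (f\<^sub>I x)\<^sup>2)"
        by simp
    qed
  qed
  have ind: "integrable (M L) (indicator {x..y} :: real \<Rightarrow> real)" "(LINT z|M L. indicator {x..y} z) \<le> y - x" if "x \<le> y" for x y :: real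
  proof -
    have i1: "integrable lebesgue (indicator {x..y} :: real \<Rightarrow> real)"
      using that by (intro integrable_real_indicator) simp_all
    have i2: "integrable lebesgue (\<lambda>z. indicator {-L<..<L} z *\<^sub>R (indicator {x..y} z :: real))"
      by (rule integrable_mult_indicator[OF _ i1]) simp
    then show "integrable (M L) (indicator {x..y} :: real \<Rightarrow> real)"
      by (simp add: M_def integrable_restrict_space)
    have "(LINT z|M L. indicator {x..y} z) = (LINT z|lebesgue. indicator {-L<..<L} z *\<^sub>R (indicator {x..y} z :: real))"
      unfolding M_def by (rule integral_restrict_space) simp
    also have "\<dots> \<le> (LINT z|lebesgue. (indicator {x..y} z :: real))"
      by (rule integral_mono[OF i2 i1]) (auto simp: indicator_def)
    also have "\<dots> = y - x" using that by simp
    finally show "(LINT z|M L. indicator {x..y} z) \<le> y - x" .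
  qed
  \<comment> \<open>\<open>c\<close> handles the distance between \<open>f\<close> and the datum;
    \<open>C\<close> handles the datum on the strip between \<open>p\<^sub>0\<close> and
    \<open>p t\<close>, the only place where its sign may be wrong.\<close>
  have bound: "(LINT x|M L. indicator (I t) x * max 0 (- (\<sigma> * f x t)))
      \<le> 2 * \<bar>L\<bar> * c + (LINT x|M L. (f x t - f\<^sub>I x)\<^sup>2) / c + (C * \<bar>p t - p\<^sub>0\<bar> + N / C)"
    if t: "0 < t" and c: "0 < c" and C: "0 < C" for t c C
  proof -
    define J where "J = {min p\<^sub>0 (p t)..max p\<^sub>0 (p t)}"
    have J: "integrable (M L) (indicator J :: real \<Rightarrow> real)" "(LINT z|M L. indicator J z) \<le> \<bar>p t - p\<^sub>0\<bar>"
    proof -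
      have "min p\<^sub>0 (p t) \<le> max p\<^sub>0 (p t)" "max p\<^sub>0 (p t) - min p\<^sub>0 (p t) = \<bar>p t - p\<^sub>0\<bar>"
        by (auto simp: min_def max_def)
      then show "integrable (M L) (indicator J :: real \<Rightarrow> real)" "(LINT z|M L. indicator J z) \<le> \<bar>p t - p\<^sub>0\<bar>"
        using ind[of "min p\<^sub>0 (p t)" "max p\<^sub>0 (p t)"] unfolding J_def by auto
    qed
    have i1: "integrable (M L) (\<lambda>x. c + (f x t - f\<^sub>I x)\<^sup>2 / c)" and i2: "integrable (M L) (\<lambda>x. C * indicator J x + (f\<^sub>I x)\<^sup>2 / C)"
      using diff_int[OF t] fI(2) J(1) const(1) by auto
    have point: "indicator (I t) x * max 0 (- (\<sigma> * f x t)) \<le> (c + (f x t - f\<^sub>I x)\<^sup>2 / c) + (C * indicator J x + (f\<^sub>I x)\<^sup>2 / C)"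
      if x: "x \<in> {-L<..<L}" for x
    proof -
      have nn: "0 \<le> c + (f x t - f\<^sub>I x)\<^sup>2 / c" "0 \<le> C * indicator J x + (f\<^sub>I x)\<^sup>2 / C"
        using c C by (auto intro!: add_nonneg_nonneg)
      show ?thesis
      proof (cases "x \<in> I t")
        case True
        have "\<bar>\<sigma> * (f x t - f\<^sub>I x)\<bar> = \<bar>f x t - f\<^sub>I x\<bar>" using \<sigma> by (simp add: abs_mult)
        then have 1: "- (\<sigma> * f x t) + \<sigma> * f\<^sub>I x \<le> c + (f x t - f\<^sub>I x)\<^sup>2 / c"
          using abs_le_add_square_div[OF c, of "f x t - f\<^sub>I x"] abs_ge_minus_self[of "\<sigma> * (f x t - f\<^sub>I x)"]
          by (simp add: right_diff_distrib)
        have 2: "- (\<sigma> * f\<^sub>I x) \<le> C * indicator J x + (f\<^sub>I x)\<^sup>2 / C"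
        proof (cases "x \<in> J")
          case True
          have "\<bar>\<sigma> * f\<^sub>I x\<bar> = \<bar>f\<^sub>I x\<bar>" using \<sigma> by (simp add: abs_mult)
          then show ?thesis
            using abs_le_add_square_div[OF C, of "f\<^sub>I x"] abs_ge_minus_self[of "\<sigma> * f\<^sub>I x"] True by simp
        next
          case False
          then show ?thesis
            using sign[OF t True x] nn(2) by (simp add: J_def)
        qed
        show ?thesis using 1 2 nn True by simp
      qed (use nn in auto)
    qed
    have "(LINT x|M L. indicator (I t) x * max 0 (- (\<sigma> * f x t))) \<le> (LINT x|M L. (c + (f x t - f\<^sub>I x)\<^sup>2 / c) + (C * indicator J x + (f\<^sub>I x)\<^sup>2 / C))"
    proof (rule integral_mono_AE[OF _ Bochner_Integration.integrable_add[OF i1 i2]])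
      show "AE x in M L. indicator (I t) x * max 0 (- (\<sigma> * f x t)) \<le> (c + (f x t - f\<^sub>I x)\<^sup>2 / c) + (C * indicator J x + (f\<^sub>I x)\<^sup>2 / C)"
        by (rule AE_I2) (use point in \<open>auto simp: M_def\<close>)
      show "integrable (M L) (\<lambda>x. indicator (I t) x * max 0 (- (\<sigma> * f x t)))"
      proof (rule Bochner_Integration.integrable_bound[OF Bochner_Integration.integrable_add[OF i1 i2]])
        have "indicator (I t) \<in> borel_measurable (M L)"
          unfolding M_def using I[of t]
          by (intro measurable_restrict_space1 borel_measurable_indicator sets_completionI_sets) simp
        then show "(\<lambda>x. indicator (I t) x * max 0 (- (\<sigma> * f x t))) \<in> borel_measurable (M L)"
          using f_meas[OF t] by (intro borel_measurable_times borel_measurable_max) auto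
        show "AE x in M L. norm (indicator (I t) x * max 0 (- (\<sigma> * f x t))) \<le> norm ((c + (f x t - f\<^sub>I x)\<^sup>2 / c) + (C * indicator J x + (f\<^sub>I x)\<^sup>2 / C))"
        proof (rule AE_I2)
          fix x assume "x \<in> space (M L)"
          then have "indicator (I t) x * max 0 (- (\<sigma> * f x t)) \<le> (c + (f x t - f\<^sub>I x)\<^sup>2 / c) + (C * indicator J x + (f\<^sub>I x)\<^sup>2 / C)"
            by (intro point) (simp add: M_def)
          moreover have "0 \<le> indicator (I t) x * max 0 (- (\<sigma> * f x t))" by simp
          ultimately show "norm (indicator (I t) x * max 0 (- (\<sigma> * f x t))) \<le> norm ((c + (f x t - f\<^sub>I x)\<^sup>2 / c) + (C * indicator J x + (f\<^sub>I x)\<^sup>2 / C))"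
            by (simp only: real_norm_def)
        qed
      qed
    qed
    also have "\<dots> = (LINT x|M L. c + (f x t - f\<^sub>I x)\<^sup>2 / c) + (LINT x|M L. C * indicator J x + (f\<^sub>I x)\<^sup>2 / C)"
      by (rule Bochner_Integration.integral_add[OF i1 i2])
    also have "(LINT x|M L. c + (f x t - f\<^sub>I x)\<^sup>2 / c) = (LINT x|M L. c) + (LINT x|M L. (f x t - f\<^sub>I x)\<^sup>2) / c"
      using diff_int[OF t] const(1) by simp
    also have "(LINT x|M L. C * indicator J x + (f\<^sub>I x)\<^sup>2 / C) = C * (LINT x|M L. indicator J x) + N / C"
      using J(1) fI(2) by (simp add: N_def)
    finally have "(LINT x|M L. indicator (I t) x * max 0 (- (\<sigma> * f x t)))
        \<le> (LINT x|M L. c) + (LINT x|M L. (f x t - f\<^sub>I x)\<^sup>2) / c + (C * (LINT x|M L. indicator J x) + N / C)" .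
    moreover have "(LINT x|M L. c) \<le> 2 * \<bar>L\<bar> * c"
      using const(2)[of c] unfolding abs_of_pos[OF c] .
    moreover have "C * (LINT x|M L. indicator J x) \<le> C * \<bar>p t - p\<^sub>0\<bar>"
      by (rule mult_left_mono[OF J(2) less_imp_le[OF C]])
    ultimately show ?thesis by linarith
  qed
  show ?thesis
  proof (rule tendstoI)
    fix e :: real assume e: "0 < e"
    \<comment> \<open>Each of the four terms of \<open>bound\<close> gets \<open>e / 4\<close>:
      \<open>c\<close> and \<open>C\<close> settle the two constant ones, then \<open>t\<close> is
      taken small for the other two. The summands 1 avoid a division by 0 in \<open>c\<close> and
      keep \<open>C\<close> positive.\<close>
    define c where "c = e / (8 * (\<bar>L\<bar> + 1))"
    define C where "C = 4 * (N + 1) / e"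
    have c: "0 < c" "2 * \<bar>L\<bar> * c \<le> e / 4" and C: "0 < C" "N / C \<le> e / 4"
      using e N by (auto simp: c_def C_def field_simps)
    have "\<forall>\<^sub>F t in at_right 0. (LINT x|M L. (f x t - f\<^sub>I x)\<^sup>2) < e * c / 4"
      using order_tendstoD(2)[OF E, of "e * c / 4"] e c by simp
    moreover have "\<forall>\<^sub>F t in at_right 0. dist (p t) p\<^sub>0 < e / (4 * C)"
      using tendstoD[OF p, of "e / (4 * C)"] e C by simp
    ultimately show "\<forall>\<^sub>F t in at_right 0. dist (LINT x|M L. indicator (I t) x * max 0 (- (\<sigma> * f x t))) 0 < e"
      using eventually_at_right_less[of "0::real"]
    proof eventually_elim
      case (elim t)
      have "(LINT x|M L. (f x t - f\<^sub>I x)\<^sup>2) / c < e / 4"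
        using elim(1) c by (simp add: pos_divide_less_eq)
      moreover have "C * \<bar>p t - p\<^sub>0\<bar> < e / 4"
        using elim(2) C by (simp add: dist_real_def field_simps)
      ultimately have "(LINT x|M L. indicator (I t) x * max 0 (- (\<sigma> * f x t))) < e"
        using bound[OF elim(3) c(1) C(1)] c(2) C(2) by linarith
      moreover have "0 \<le> (LINT x|M L. indicator (I t) x * max 0 (- (\<sigma> * f x t)))"
        by (intro Bochner_Integration.integral_nonneg) simp
      ultimately show ?case by (simp add: dist_real_def)
    qed
  qed
qed

theorem theorem2p5:
  fixes L a p\<^sub>0 :: real and f\<^sub>I :: "real \<Rightarrow> real"
  assumes "0 < a" and "a < L"
    and "f\<^sub>I \<in> borel_measurable (lebesgue_on {-L<..<L})"
    and "integrable (lebesgue_on {-L<..<L}) (\<lambda>x. (f\<^sub>I x)\<^sup>2)"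
    and "p\<^sub>0 \<in> {-L + a<..<L - a}"
    and "f\<^sub>I p\<^sub>0 = 0"
    and "\<And>x. x \<in> {-L<..<L} \<Longrightarrow> x < p\<^sub>0 \<Longrightarrow> f\<^sub>I x > 0"
    and "\<And>x. x \<in> {-L<..<L} \<Longrightarrow> x > p\<^sub>0 \<Longrightarrow> f\<^sub>I x < 0"
    and "buyer_mass L f\<^sub>I p\<^sub>0 / vendor_mass L f\<^sub>I p\<^sub>0
           \<notin> {a / (4 * L - 3 * a) .. (4 * L - 3 * a) / a}"
  shows "\<not> (\<exists>f p. global_solution L a f\<^sub>I p\<^sub>0 f p \<and> conserves_masses L f p)"
proof
  assume "\<exists>f p. global_solution L a f\<^sub>I p\<^sub>0 f p \<and> conserves_masses L f p"
  then obtain f p where gs: "global_solution L a f\<^sub>I p\<^sub>0 f p" and cm: "conserves_masses L f p"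
    by blast
  obtain lam where lam: "price_equation L a f p lam" "\<forall>t>0. ((\<lambda>x. f x t) has_real_derivative - lam t) (at (p t))"
    using gs unfolding global_solution_def by blast
  interpret weak_solution L a f p lam
  proof
    show "0 < a" by (rule assms(1))
    show "continuous_on {0<..} p"
      using gs unfolding global_solution_def by (auto elim: continuous_on_subset)
  qed (use gs lam in \<open>auto simp: global_solution_def\<close>)
  define MB where "MB = buyer_mass L f\<^sub>I p\<^sub>0"
  define MV where "MV = vendor_mass L f\<^sub>I p\<^sub>0"
  have p0: "-L < p\<^sub>0" "p\<^sub>0 < L" using assms(1,5) by auto
  have f0: "f x 0 = f\<^sub>I x" if "x \<in> {-L<..<L}" for x
    using gs that by (simp add: global_solution_def)
  have pz: "p 0 = p\<^sub>0" using gs by (simp add: global_solution_def)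
  \<comment> \<open>At time 0 the function agrees with the datum only inside the open interval,
    which is all that the two integrals see.\<close>
  have masses0: "buyer_mass L (\<lambda>x. f x 0) (p 0) = MB" "vendor_mass L (\<lambda>x. f x 0) (p 0) = MV"
    unfolding MB_def MV_def buyer_mass_def vendor_mass_def pz using p0
    by (auto intro!: Bochner_Integration.integral_cong f0)
  have fc: "continuous_on {-L..L} (\<lambda>x. f x t)" if "0 < t" for t
    using slice_continuous[OF that] .
  have buyers: "integral {-L..p t} (\<lambda>x. f x t) = MB" and vendors: "integral {p t..L} (\<lambda>x. - f x t) = MV" if t: "0 < t" for t
  proof -
    have c: "continuous_on {-L..p t} (\<lambda>x. f x t)" "continuous_on {p t..L} (\<lambda>x. f x t)"
      using p_bounds[OF t] by (auto intro: continuous_on_subset[OF fc[OF t]])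
    have m: "buyer_mass L (\<lambda>x. f x t) (p t) = MB" "vendor_mass L (\<lambda>x. f x t) (p t) = MV"
      using cm[unfolded conserves_masses_def, rule_format, of t] t masses0 by simp_all
    show "integral {-L..p t} (\<lambda>x. f x t) = MB"
      using m(1) lebesgue_on_open_interval(2)[OF c(1)] by (simp add: buyer_mass_def)
    show "integral {p t..L} (\<lambda>x. - f x t) = MV"
      using m(2) lebesgue_on_open_interval(2)[OF c(2)] by (simp add: vendor_mass_def)
  qed
  have fI_int: "integrable (lebesgue_on {-L<..<L}) f\<^sub>I"
    by (rule square_integrable_imp_integrable_open_interval[OF assms(3,4)])
  have "0 < MB"
    unfolding MB_def buyer_mass_def
    by (rule lebesgue_on_positive_integral[OF p0(1) integrable_lebesgue_on_subinterval[OF fI_int]]) (use p0 assms(7) in auto)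
  have "0 < (LINT x|lebesgue_on {p\<^sub>0<..<L}. - f\<^sub>I x)"
    by (rule lebesgue_on_positive_integral[OF p0(2) integrable_lebesgue_on_subinterval[OF Bochner_Integration.integrable_minus[OF fI_int]]])
      (use p0 assms(8) in auto)
  then have "0 < MV"
    by (simp add: MV_def vendor_mass_def)
  have E: "((\<lambda>t. LINT x|lebesgue_on {-L<..<L}. (f x t - f\<^sub>I x)\<^sup>2) \<longlongrightarrow> 0) (at_right 0)"
    using gs by (simp add: global_solution_def)
  have plim: "(p \<longlongrightarrow> p\<^sub>0) (at_right 0)"
  proof -
    have "continuous_on {0..} p" using gs by (simp add: global_solution_def)
    then have "(p \<longlongrightarrow> p 0) (at 0 within {0..})" by (simp add: continuous_on_def)
    then have "(p \<longlongrightarrow> p 0) (at_right 0)" by (rule tendsto_within_subset) auto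
    then show ?thesis by (simp only: pz)
  qed
  have part: "(LINT x|lebesgue_on {-L<..<L}. indicator J x * g x) = integral {x..y} g"
    if "continuous_on {x..y} g" "J \<inter> {-L<..<L} = {x<..<y}" for J x y and g :: "real \<Rightarrow> real"
  proof -
    have "(LINT x|lebesgue_on {-L<..<L}. indicator J x * g x) = (LINT z|lebesgue_on {x<..<y}. g z)"
      unfolding that(2)[symmetric] using that(2)
      by (simp add: integral_restrict_space mult.assoc[symmetric] indicator_inter_arith[symmetric] Int_commute)
    then show ?thesis using lebesgue_on_open_interval(2)[OF that(1)] by simp
  qed
  interpret conserving_solution L a f p lam MB MV
  proof
    show "((\<lambda>t. integral {-L..p t} (\<lambda>x. max 0 (- f x t))) \<longlongrightarrow> 0) (at_right 0)"
    proof (rule Lim_transform_eventually)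
      \<comment> \<open>The sign \<open>\<sigma>\<close> is 1 for the left trace and -1 for the
        right one, so that the part of the wrong sign is the negative part of
        \<open>\<sigma> * f\<close> in both cases.\<close>
      show "((\<lambda>t. LINT x|lebesgue_on {-L<..<L}. indicator {..<p t} x * max 0 (- (1 * f x t))) \<longlongrightarrow> 0) (at_right 0)"
        by (rule initial_trace_vanishes[OF assms(3,4) fc E plim]) (use assms(7) in \<open>auto intro: less_imp_le\<close>)
      show "\<forall>\<^sub>F t in at_right 0. (LINT x|lebesgue_on {-L<..<L}. indicator {..<p t} x * max 0 (- (1 * f x t))) = integral {-L..p t} (\<lambda>x. max 0 (- f x t))"
        using eventually_at_right_less[of "0::real"]
      proof eventually_elim
        case (elim t)
        have "continuous_on {-L..p t} (\<lambda>x. max 0 (- f x t))"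
          using p_bounds[OF elim] by (intro continuous_intros continuous_on_subset[OF fc[OF elim]]) auto
        moreover have "{..<p t} \<inter> {-L<..<L} = {-L<..<p t}" using p_bounds[OF elim] by auto
        ultimately show ?case using part by simp
      qed
    qed
    show "((\<lambda>t. integral {p t..L} (\<lambda>x. max 0 (f x t))) \<longlongrightarrow> 0) (at_right 0)"
    proof (rule Lim_transform_eventually)
      show "((\<lambda>t. LINT x|lebesgue_on {-L<..<L}. indicator {p t<..} x * max 0 (- ((-1) * f x t))) \<longlongrightarrow> 0) (at_right 0)"
        by (rule initial_trace_vanishes[OF assms(3,4) fc E plim]) (use assms(8) in \<open>auto intro: less_imp_le\<close>)
      show "\<forall>\<^sub>F t in at_right 0. (LINT x|lebesgue_on {-L<..<L}. indicator {p t<..} x * max 0 (- ((-1) * f x t))) = integral {p t..L} (\<lambda>x. max 0 (f x t))"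
        using eventually_at_right_less[of "0::real"]
      proof eventually_elim
        case (elim t)
        have "continuous_on {p t..L} (\<lambda>x. max 0 (f x t))"
          using p_bounds[OF elim] by (intro continuous_intros continuous_on_subset[OF fc[OF elim]]) auto
        moreover have "{p t<..} \<inter> {-L<..<L} = {p t<..<L}" using p_bounds[OF elim] by auto
        ultimately show ?case using part by simp
      qed
    qed
  qed (use buyers vendors \<open>0 < MB\<close> \<open>0 < MV\<close> in auto)
  have 1: "a * MV \<le> (4 * L - 3 * a) * MB"
    by (rule mass_ratio_bound[OF assms(2)])
  \<comment> \<open>The reflected solution has the masses exchanged, which gives the other end of
    the interval for the ratio.\<close>
  have 2: "a * MB \<le> (4 * L - 3 * a) * MV"
    by (rule conserving_solution.mass_ratio_bound[OF conserving_solution_reflect assms(2)])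
  have q: "0 < 4 * L - 3 * a" using assms(1,2) by simp
  have "a / (4 * L - 3 * a) \<le> MB / MV"
    using 1 q \<open>0 < MV\<close> by (simp add: pos_divide_le_eq pos_le_divide_eq mult.commute)
  moreover have "MB / MV \<le> (4 * L - 3 * a) / a"
    using 2 assms(1) \<open>0 < MV\<close> by (simp add: pos_divide_le_eq pos_le_divide_eq mult.commute)
  ultimately show False
    using assms(9) unfolding MB_def MV_def by simp
qed



end
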